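(* Let $(W,S)$ be a finitely generated Coxeter system and suppose $W$ is the fundamental group of a graph of groups $\Lambda$ in which each edge group is finite. Then $W$ has a visual graph of groups decomposition $\Psi$ (with respect to $S$) such that each vertex group of $\Psi$ is 1-ended or finite and is a subgroup of a conjugate of a vertex group of $\Lambda$, and each edge group of $\Psi$ is finite.
   Context: A Coxeter system $(W,S)$ is a group $W$ with generating set $S$ having a presentation $\langle S : (st)^{m(s,t)}\ (s,t\in S,\ m(s,t)<\infty)\rangle$, where $m:S^2\to\{1,2,\ldots,\infty\}$, $m(s,t)=m(t,s)$, and $m(s,t)=1$ iff $s=t$; it is finitely generated if $S$ is finite. A special subgroup is a subgroup generated by a subset of $S$. Vertex and edge groups of $\Lambda$ are identified with subgroups of $W=\pi_1(\Lambda)$. A visual graph of groups decomposition of $W$ (with respect to $S$) is a graph of groups $\Psi$ in which each vertex group and edge group is a special subgroup of $(W,S)$, the injection of each edge group into each of its endpoint vertex groups is inclusion, and the homomorphism $\pi_1(\Psi)\to W$ induced by the inclusions of the vertex groups into $W$ is an isomorphism. *)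

theory Defs
  imports
    "HOL-Algebra.Generated_Groups"
    "HOL-Library.Extended_Nat"
    "Graph_Theory.Digraph_Component"
    "Graph_Theory.Bidirected_Digraph"
begin

section \<open>Group presentations\<close>

text \<open>The letter \<open>(x, True)\<close> stands for the generator \<open>x\<close>, and \<open>(x, False)\<close> for its formal inverse.\<close>

type_synonym 'x word = "('x \<times> bool) list"

abbreviation words :: "'x set \<Rightarrow> 'x word set" where
  "words X \<equiv> lists (X \<times> UNIV)"

inductive_set pres_rel :: "'x set \<Rightarrow> 'x word set \<Rightarrow> ('x word \<times> 'x word) set"
  for X :: "'x set" and R :: "'x word set" where
  refl: "u \<in> words X \<Longrightarrow> (u, u) \<in> pres_rel X R"
| sym: "(u, v) \<in> pres_rel X R \<Longrightarrow> (v, u) \<in> pres_rel X R"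
| trans: "(u, v) \<in> pres_rel X R \<Longrightarrow> (v, w) \<in> pres_rel X R \<Longrightarrow> (u, w) \<in> pres_rel X R"
| append: "(u, v) \<in> pres_rel X R \<Longrightarrow> (u', v') \<in> pres_rel X R \<Longrightarrow> (u @ u', v @ v') \<in> pres_rel X R"
| cancel: "x \<in> X \<Longrightarrow> ([(x, b), (x, \<not> b)], []) \<in> pres_rel X R"
| relator: "r \<in> R \<Longrightarrow> r \<in> words X \<Longrightarrow> (r, []) \<in> pres_rel X R"

definition word_class :: "'x set \<Rightarrow> 'x word set \<Rightarrow> 'x word \<Rightarrow> 'x word set" where
  "word_class X R w = pres_rel X R `` {w}"

definition presented_group :: "'x set \<Rightarrow> 'x word set \<Rightarrow> 'x word set monoid" where
  "presented_group X R =
    \<lparr> carrier = words X // pres_rel X R,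
      monoid.mult = (\<lambda>A B. \<Union>a\<in>A. \<Union>b\<in>B. word_class X R (a @ b)),
      monoid.one = word_class X R [] \<rparr>"

lemma equiv_pres_rel: "equiv (words X) (pres_rel X R)"
proof (rule equivI)
  have "u \<in> words X \<and> v \<in> words X" if "(u, v) \<in> pres_rel X R" for u v
    using that by (induction rule: pres_rel.induct) auto
  then show "pres_rel X R \<subseteq> words X \<times> words X"
    by (intro subrelI SigmaI) blast+
  show "refl_on (words X) (pres_rel X R)"
    by (intro refl_onI pres_rel.refl)
  show "sym (pres_rel X R)"
    by (rule symI) (rule pres_rel.sym)
  show "trans (pres_rel X R)"
    by (rule transI) (rule pres_rel.trans)
qed

lemma mult_word_class:
  assumes u: "u \<in> words X" and v: "v \<in> words X"
  shows "word_class X R u \<otimes>\<^bsub>presented_group X R\<^esub> word_class X R v = word_class X R (u @ v)"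
proof -
  have "word_class X R (a @ b) = word_class X R (u @ v)"
    if "a \<in> word_class X R u" "b \<in> word_class X R v" for a b
  proof -
    have "(u @ v, a @ b) \<in> pres_rel X R"
      using that by (auto simp: word_class_def intro: pres_rel.append)
    then show ?thesis
      unfolding word_class_def by (rule equiv_class_eq[OF equiv_pres_rel, symmetric])
  qed
  moreover have "u \<in> word_class X R u" "v \<in> word_class X R v"
    using u v by (auto simp: word_class_def intro: pres_rel.refl)
  ultimately have "(\<Union>a\<in>word_class X R u. \<Union>b\<in>word_class X R v. word_class X R (a @ b)) = word_class X R (u @ v)"
    by blast
  then show ?thesis
    by (simp add: presented_group_def)
qed

lemma group_presented_group: "group (presented_group X R)"
proof -
  let ?G = "presented_group X R"
  have car: "carrier ?G = word_class X R ` words X"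
    by (auto simp: presented_group_def word_class_def quotient_def)
  have one: "\<one>\<^bsub>?G\<^esub> = word_class X R []"
    by (simp add: presented_group_def)
  have app: "u @ v \<in> words X" if "u \<in> words X" "v \<in> words X" for u v :: "'a word"
    using that by (simp only: append_in_lists_conv)
  have linv: "\<exists>v\<in>words X. (v @ u, []) \<in> pres_rel X R" if "u \<in> words X" for u
    using that
  proof (induction u rule: lists.induct)
    case Nil
    show ?case by (rule bexI[of _ "[]"]) (simp_all add: pres_rel.refl)
  next
    case (Cons l u)
    obtain x b where "l = (x, b)"
      by fastforce
    with Cons.hyps have l: "l = (x, b)" "x \<in> X" and u: "u \<in> words X"
      by simp_all
    obtain v where v: "v \<in> words X" "(v @ u, []) \<in> pres_rel X R"
      using Cons.IH by blast
    have "([(x, \<not> b), (x, b)], []) \<in> pres_rel X R"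
      using pres_rel.cancel[OF l(2), of "\<not> b"] by simp
    then have "(v @ ([(x, \<not> b), (x, b)] @ u), v @ ([] @ u)) \<in> pres_rel X R"
      using u v by (intro pres_rel.append pres_rel.refl)
    then have "((v @ [(x, \<not> b)]) @ l # u, []) \<in> pres_rel X R"
      using pres_rel.trans[OF _ v(2)] l by simp
    moreover have "v @ [(x, \<not> b)] \<in> words X"
      using v l by simp
    ultimately show ?case by blast
  qed
  have rep: "\<exists>u. u \<in> words X \<and> a = word_class X R u" if "a \<in> carrier ?G" for a
    using that unfolding car by (elim imageE) (intro exI conjI)
  have mult_closed: "word_class X R u \<in> carrier ?G" if "u \<in> words X" for u
    unfolding car using that by (rule imageI)
  show ?thesis
  proof (rule groupI)
    fix a assume a: "a \<in> carrier ?G"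
    obtain u where u: "u \<in> words X" "a = word_class X R u"
      using rep[OF a] by (elim exE conjE)
    obtain v where v: "v \<in> words X" "(v @ u, []) \<in> pres_rel X R"
      using linv[OF u(1)] by (elim bexE)
    have "word_class X R (v @ u) = word_class X R []"
      unfolding word_class_def by (rule equiv_class_eq[OF equiv_pres_rel v(2)])
    then have "word_class X R v \<otimes>\<^bsub>?G\<^esub> a = \<one>\<^bsub>?G\<^esub>"
      unfolding one u(2) mult_word_class[OF v(1) u(1)] .
    then show "\<exists>y\<in>carrier ?G. y \<otimes>\<^bsub>?G\<^esub> a = \<one>\<^bsub>?G\<^esub>"
      by (rule bexI) (rule mult_closed[OF v(1)])
    show "\<one>\<^bsub>?G\<^esub> \<otimes>\<^bsub>?G\<^esub> a = a"
      unfolding one u(2) mult_word_class[OF lists.Nil u(1)] append_Nil ..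
  next
    fix a b assume a: "a \<in> carrier ?G" and b: "b \<in> carrier ?G"
    obtain u where u: "u \<in> words X" "a = word_class X R u"
      using rep[OF a] by (elim exE conjE)
    obtain v where v: "v \<in> words X" "b = word_class X R v"
      using rep[OF b] by (elim exE conjE)
    show "a \<otimes>\<^bsub>?G\<^esub> b \<in> carrier ?G"
      unfolding u(2) v(2) mult_word_class[OF u(1) v(1)]
      by (rule mult_closed[OF app[OF u(1) v(1)]])
    fix c assume c: "c \<in> carrier ?G"
    obtain w where w: "w \<in> words X" "c = word_class X R w"
      using rep[OF c] by (elim exE conjE)
    show "a \<otimes>\<^bsub>?G\<^esub> b \<otimes>\<^bsub>?G\<^esub> c = a \<otimes>\<^bsub>?G\<^esub> (b \<otimes>\<^bsub>?G\<^esub> c)"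
      unfolding u(2) v(2) w(2) mult_word_class[OF u(1) v(1)] mult_word_class[OF v(1) w(1)]
        mult_word_class[OF app[OF u(1) v(1)] w(1)] mult_word_class[OF u(1) app[OF v(1) w(1)]]
        append_assoc ..
  next
    show "\<one>\<^bsub>?G\<^esub> \<in> carrier ?G"
      unfolding one by (rule mult_closed[OF lists.Nil])
  qed
qed

section \<open>Coxeter systems\<close>

definition coxeter_relators :: "'a set \<Rightarrow> ('a \<Rightarrow> 'a \<Rightarrow> enat) \<Rightarrow> 'a word set" where
  "coxeter_relators S m =
    {concat (replicate n [(s, True), (t, True)]) | s t n. s \<in> S \<and> t \<in> S \<and> m s t = enat n}"

definition coxeter_system :: "'a monoid \<Rightarrow> 'a set \<Rightarrow> bool" where
  "coxeter_system W S \<longleftrightarrow>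
    group W \<and> S \<subseteq> carrier W \<and>
    (\<exists>m :: 'a \<Rightarrow> 'a \<Rightarrow> enat.
      (\<forall>s\<in>S. \<forall>t\<in>S. 1 \<le> m s t \<and> m s t = m t s \<and> (m s t = 1 \<longleftrightarrow> s = t)) \<and>
      (\<exists>\<phi> \<in> iso (presented_group S (coxeter_relators S m)) W.
        \<forall>s\<in>S. \<phi> (word_class S (coxeter_relators S m) [(s, True)]) = s))"

definition special_subgroup :: "'a monoid \<Rightarrow> 'a set \<Rightarrow> 'a monoid \<Rightarrow> bool" where
  "special_subgroup W S H \<longleftrightarrow> (\<exists>A\<subseteq>S. H = subgroup_generated W A)"

section \<open>Graphs of groups\<close>

text \<open>Graphs are taken in the sense of Serre: every geometric edge is a pair of opposite arcs \<open>e\<close> and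
  \<open>opp e\<close>, whose edge groups coincide, and \<open>einj e\<close> embeds the edge group of \<open>e\<close> into the vertex
  group at the head of \<open>e\<close>.\<close>

record ('v, 'e, 'g, 'h) graph_of_groups =
  base :: "('v, 'e) pre_digraph"
  opp :: "'e \<Rightarrow> 'e"
  vgroup :: "'v \<Rightarrow> 'g monoid"
  egroup :: "'e \<Rightarrow> 'h monoid"
  einj :: "'e \<Rightarrow> 'h \<Rightarrow> 'g"

definition graph_of_groups :: "('v, 'e, 'g, 'h) graph_of_groups \<Rightarrow> bool" where
  "graph_of_groups \<Lambda> \<longleftrightarrow>
    bidirected_digraph (base \<Lambda>) (opp \<Lambda>) \<and> strongly_connected (base \<Lambda>) \<and>
    (\<forall>v \<in> verts (base \<Lambda>). group (vgroup \<Lambda> v)) \<and>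
    (\<forall>e \<in> arcs (base \<Lambda>). group (egroup \<Lambda> e) \<and> egroup \<Lambda> (opp \<Lambda> e) = egroup \<Lambda> e \<and>
      einj \<Lambda> e \<in> mon (egroup \<Lambda> e) (vgroup \<Lambda> (head (base \<Lambda>) e)))"

text \<open>The constant \<^const>\<open>Digraph_Component.spanning_tree\<close> does not apply here: it only excludes directed
  cycles, and every nonempty bidirected graph has directed cycles of length two. A maximal tree is
  a connected spanning subgraph, given by its set of arcs, without closed walks free of
  backtracking.\<close>

definition maximal_tree :: "('v, 'e) pre_digraph \<Rightarrow> ('e \<Rightarrow> 'e) \<Rightarrow> 'e set \<Rightarrow> bool" where
  "maximal_tree D rv T \<longleftrightarrow>
    T \<subseteq> arcs D \<and> rv ` T \<subseteq> T \<and> strongly_connected (D\<lparr>arcs := T\<rparr>) \<and>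
    (\<forall>u p. pre_digraph.awalk (D\<lparr>arcs := T\<rparr>) u p u \<and> successively (\<lambda>e f. f \<noteq> rv e) p \<longrightarrow> p = [])"

subsection \<open>The fundamental group with respect to a maximal tree\<close>

datatype ('v, 'e, 'g) pi1_gen = Vert 'v 'g | Edge 'e

definition pi1_gens :: "('v, 'e, 'g, 'h) graph_of_groups \<Rightarrow> ('v, 'e, 'g) pi1_gen set" where
  "pi1_gens \<Lambda> = {Vert v g | v g. v \<in> verts (base \<Lambda>) \<and> g \<in> carrier (vgroup \<Lambda> v)} \<union> Edge ` arcs (base \<Lambda>)"

text \<open>In order, the relations are: the multiplication tables of the vertex groups;
  \<open>opp e = e\<^sup>-\<^sup>1\<close>; \<open>e \<cdot> einj e a \<cdot> e\<^sup>-\<^sup>1 = einj (opp e) a\<close>; and \<open>e = 1\<close> for the arcs of the tree.\<close>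

definition pi1_relators ::
    "('v, 'e, 'g, 'h) graph_of_groups \<Rightarrow> 'e set \<Rightarrow> ('v, 'e, 'g) pi1_gen word set" where
  "pi1_relators \<Lambda> T =
    {[(Vert v g, True), (Vert v h, True), (Vert v (g \<otimes>\<^bsub>vgroup \<Lambda> v\<^esub> h), False)] | v g h.
      v \<in> verts (base \<Lambda>) \<and> g \<in> carrier (vgroup \<Lambda> v) \<and> h \<in> carrier (vgroup \<Lambda> v)} \<union>
    {[(Edge e, True), (Edge (opp \<Lambda> e), True)] | e. e \<in> arcs (base \<Lambda>)} \<union>
    {[(Edge e, True), (Vert (head (base \<Lambda>) e) (einj \<Lambda> e a), True), (Edge e, False),
      (Vert (tail (base \<Lambda>) e) (einj \<Lambda> (opp \<Lambda> e) a), False)] | e a.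
      e \<in> arcs (base \<Lambda>) \<and> a \<in> carrier (egroup \<Lambda> e)} \<union>
    {[(Edge e, True)] | e. e \<in> T}"

definition pi1 ::
    "('v, 'e, 'g, 'h) graph_of_groups \<Rightarrow> 'e set \<Rightarrow> ('v, 'e, 'g) pi1_gen word set monoid" where
  "pi1 \<Lambda> T = presented_group (pi1_gens \<Lambda>) (pi1_relators \<Lambda> T)"

definition pi1_class ::
    "('v, 'e, 'g, 'h) graph_of_groups \<Rightarrow> 'e set \<Rightarrow> ('v, 'e, 'g) pi1_gen \<Rightarrow> ('v, 'e, 'g) pi1_gen word set" where
  "pi1_class \<Lambda> T x = word_class (pi1_gens \<Lambda>) (pi1_relators \<Lambda> T) [(x, True)]"

text \<open>The vertex group at \<open>v\<close>, identified with its canonical image in the fundamental group.\<close>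

definition pi1_vgroup ::
    "('v, 'e, 'g, 'h) graph_of_groups \<Rightarrow> 'e set \<Rightarrow> 'v \<Rightarrow> ('v, 'e, 'g) pi1_gen word set set" where
  "pi1_vgroup \<Lambda> T v = (\<lambda>g. pi1_class \<Lambda> T (Vert v g)) ` carrier (vgroup \<Lambda> v)"

subsection \<open>Visual decompositions\<close>

text \<open>The homomorphism induced by the inclusions of the vertex groups sends each vertex group element
  to itself and each stable letter to \<open>1\<close>.\<close>

definition visual_decomposition ::
    "'a monoid \<Rightarrow> 'a set \<Rightarrow> ('v, 'e, 'a, 'a) graph_of_groups \<Rightarrow> bool" where
  "visual_decomposition W S \<Psi> \<longleftrightarrow>
    graph_of_groups \<Psi> \<and>
    (\<forall>v \<in> verts (base \<Psi>). special_subgroup W S (vgroup \<Psi> v)) \<and>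
    (\<forall>e \<in> arcs (base \<Psi>). special_subgroup W S (egroup \<Psi> e) \<and>
      (\<forall>a \<in> carrier (egroup \<Psi> e). einj \<Psi> e a = a)) \<and>
    (\<exists>T. maximal_tree (base \<Psi>) (opp \<Psi>) T \<and>
      (\<exists>\<psi> \<in> iso (pi1 \<Psi> T) W.
        (\<forall>v \<in> verts (base \<Psi>). \<forall>g \<in> carrier (vgroup \<Psi> v). \<psi> (pi1_class \<Psi> T (Vert v g)) = g) \<and>
        (\<forall>e \<in> arcs (base \<Psi>). \<psi> (pi1_class \<Psi> T (Edge e)) = \<one>\<^bsub>W\<^esub>)))"

section \<open>Ends of groups\<close>

definition cayley_graph :: "'a monoid \<Rightarrow> 'a set \<Rightarrow> ('a, 'a \<times> 'a) pre_digraph" where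
  "cayley_graph G A =
    \<lparr> verts = carrier G,
      arcs = carrier G \<times> (A \<union> m_inv G ` A),
      tail = fst,
      head = (\<lambda>(g, a). g \<otimes>\<^bsub>G\<^esub> a) \<rparr>"

text \<open>The number of ends of a symmetric, locally finite digraph (whose strongly connected components
  are the components of the underlying graph): the supremum of the number of infinite components
  left after removing a finite set of vertices.\<close>

definition num_ends :: "('v, 'e) pre_digraph \<Rightarrow> enat" where
  "num_ends D =
    (SUP K \<in> {K. finite K \<and> K \<subseteq> verts D}.
      let \<C> = {C \<in> pre_digraph.sccs_verts (D \<restriction> (verts D - K)). infinite C}
      in if finite \<C> then enat (card \<C>) else \<infinity>)"

text \<open>The number of ends of a Cayley graph does not depend on the chosen finite generating set.\<close>

definition one_ended :: "'a monoid \<Rightarrow> bool" where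
  "one_ended G \<longleftrightarrow>
    (\<exists>A. finite A \<and> A \<subseteq> carrier G \<and> generate G A = carrier G \<and> num_ends (cayley_graph G A) = 1)"

end

theory Submission
  imports Defs "HOL-Algebra.Multiplicative_Group"
begin

text \<open>Join two generators when their product has finite order. Splitting the generating set along
  subsets that generate finite subgroups and separate this graph, as long as possible, yields a tree
  of bags; the tree of the special subgroups they generate has fundamental group \<open>W\<close>, since every
  relator of the presentation lives in one bag. Let \<open>A\<close> be one of the unsplittable bags.

  If \<open>\<langle>A\<rangle>\<close> is infinite, it is 1-ended because the complement of every ball in its Cayley graph is
  connected: a path can be pushed off an element \<open>w\<close> of minimal length on it, as the generators that
  shorten \<open>w\<close> generate a finite subgroup, so that the others are connected to each other through
  cosets of finite dihedral groups above \<open>w\<close>.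

  On the Bass--Serre tree of \<open>\<Lambda>\<close> the generators in \<open>A\<close> that fix a given edge generate a finite
  subgroup. The fixed points of each of the others lie on one side of the edge, and on the same side
  for all of them, since two involutions with fixed points on different sides have a product of
  infinite order. Hence a vertex \<open>x\<close> minimizing the sum of the distances from \<open>x\<close> to \<open>s x\<close>, \<open>s \<in> A\<close>,
  is fixed by \<open>\<langle>A\<rangle>\<close>. That the Bass--Serre graph is a tree follows from the existence of a derivation
  on \<open>\<pi>\<^sub>1(\<Lambda>)\<close>, defined on the generators, that counts modulo 2 how often a path from the base point to
  its translate crosses each edge.\<close>

section \<open>Homomorphisms from presented groups\<close>

text \<open>Unsplittability enters twice, for two different finite subgroups: the one spanned by the
  descents at an element of the Cayley graph, and the one spanned by the generators fixing an arc of
  the Bass--Serre tree. Both times it spreads a statement about two generators with a product of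
  finite order to all generators outside the subgroup. Gluing the halves of a splitting back into a
  tree requires the separator to stay inside one bag while each half is split further. Therefore
  cliques, sets whose pairwise products have finite order, are tracked: no splitting cuts a clique,
  and a set spanning a finite subgroup is one. The same fact puts both letters of a Coxeter relator
  into one bag. The groups are given by presentations, so the geometry is extracted from
  homomorphisms out of them: permutations of signed elements give the parity cocycle behind the
  exchange condition, and a semidirect product with sets of arcs gives separation by edges.\<close>

definition word_eval :: "('b, 'm) monoid_scheme \<Rightarrow> ('x \<Rightarrow> 'b) \<Rightarrow> 'x word \<Rightarrow> 'b" where
  "word_eval H f w = foldr (\<lambda>l a. (if snd l then f (fst l) else inv\<^bsub>H\<^esub> (f (fst l))) \<otimes>\<^bsub>H\<^esub> a) w \<one>\<^bsub>H\<^esub>"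

lemma word_eval_simps [simp]:
  "word_eval H f [] = \<one>\<^bsub>H\<^esub>"
  "word_eval H f ((x, b) # w) = (if b then f x else inv\<^bsub>H\<^esub> (f x)) \<otimes>\<^bsub>H\<^esub> word_eval H f w"
  by (simp_all add: word_eval_def)

lemma (in group) word_eval_closed:
  assumes f: "f \<in> X \<rightarrow> carrier G" and w: "w \<in> words X"
  shows "word_eval G f w \<in> carrier G"
  using w
proof (induction w rule: lists.induct)
  case (Cons l w)
  then have "f (fst l) \<in> carrier G"
    using f by auto
  then show ?case
    using Cons.IH by (cases l) auto
qed simp

lemma (in group) word_eval_append:
  assumes f: "f \<in> X \<rightarrow> carrier G" and u: "u \<in> words X" and v: "v \<in> words X"
  shows "word_eval G f (u @ v) = word_eval G f u \<otimes> word_eval G f v"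
  using u
proof (induction u rule: lists.induct)
  case Nil
  then show ?case
    using word_eval_closed[OF f v] by simp
next
  case (Cons l u)
  then have "f (fst l) \<in> carrier G"
    using f by auto
  then show ?case
    using Cons.IH word_eval_closed[OF f v] word_eval_closed[OF f Cons.hyps(2)]
    by (cases l) (auto simp: m_assoc)
qed

lemma (in group) word_eval_pow:
  assumes "f \<in> X \<rightarrow> carrier G" "u \<in> words X"
  shows "word_eval G f (concat (replicate n u)) = word_eval G f u [^] n"
proof (induction n)
  case (Suc n)
  have "concat (replicate n u) \<in> words X"
    using assms(2) by (induction n) (auto simp del: in_lists_conv_set)
  then show ?case
    using Suc assms word_eval_closed[OF assms] nat_pow_comm[of "word_eval G f u" n 1]
    by (simp add: word_eval_append[of f X] del: in_lists_conv_set)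
qed simp

lemma pres_rel_words:
  "(u, v) \<in> pres_rel X R \<Longrightarrow> u \<in> words X \<and> v \<in> words X"
  using equiv_pres_rel[of X R] unfolding equiv_def by blast

lemma (in group) word_eval_pres_rel:
  assumes f: "f \<in> X \<rightarrow> carrier G"
    and R: "\<And>r. r \<in> R \<Longrightarrow> r \<in> words X \<Longrightarrow> word_eval G f r = \<one>"
    and uv: "(u, v) \<in> pres_rel X R"
  shows "word_eval G f u = word_eval G f v"
  using uv
proof (induction rule: pres_rel.induct)
  case (append u v u' v')
  then show ?case
    using f pres_rel_words[OF append.hyps(1)] pres_rel_words[OF append.hyps(2)]
    by (simp add: word_eval_append)
next
  case (cancel x b)
  then have "f x \<in> carrier G"
    using f by blast
  then show ?case
    by simp
qed (use R in auto)

lemma word_class_in_carrier: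
  "w \<in> words X \<Longrightarrow> word_class X R w \<in> carrier (presented_group X R)"
  by (auto simp: presented_group_def word_class_def quotient_def)

lemma carrier_presented_group:
  "carrier (presented_group X R) = word_class X R ` words X"
  by (auto simp: presented_group_def word_class_def quotient_def)

lemma one_presented_group: "\<one>\<^bsub>presented_group X R\<^esub> = word_class X R []"
  by (simp add: presented_group_def)

text \<open>Von Dyck's theorem. The map evaluates a chosen representative of each class;
  \<open>word_eval_pres_rel\<close> makes the choice irrelevant.\<close>

theorem presented_group_hom:
  assumes "group H"
    and f: "f \<in> X \<rightarrow> carrier H"
    and R: "\<And>r. r \<in> R \<Longrightarrow> r \<in> words X \<Longrightarrow> word_eval H f r = \<one>\<^bsub>H\<^esub>"
  shows "\<exists>\<theta> \<in> hom (presented_group X R) H. \<forall>x\<in>X. \<theta> (word_class X R [(x, True)]) = f x"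
proof -
  interpret group H by fact
  define \<theta> where "\<theta> C = word_eval H f (SOME u. u \<in> C)" for C
  have \<theta>: "\<theta> (word_class X R w) = word_eval H f w" if w: "w \<in> words X" for w
  proof -
    have "w \<in> word_class X R w"
      using w by (simp add: word_class_def pres_rel.refl)
    then have "(SOME u. u \<in> word_class X R w) \<in> word_class X R w"
      by (rule someI)
    then have "(w, SOME u. u \<in> word_class X R w) \<in> pres_rel X R"
      by (simp add: word_class_def)
    from word_eval_pres_rel[OF f R this] show ?thesis
      by (simp add: \<theta>_def)
  qed
  show ?thesis
  proof (intro bexI[of _ \<theta>] ballI)
    show "\<theta> (word_class X R [(x, True)]) = f x" if "x \<in> X" for x
      using that f by (simp add: \<theta> Pi_iff)
    show "\<theta> \<in> hom (presented_group X R) H"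
    proof (rule homI)
      fix a b assume "a \<in> carrier (presented_group X R)" "b \<in> carrier (presented_group X R)"
      then obtain u v where uv: "a = word_class X R u" "b = word_class X R v" "u \<in> words X" "v \<in> words X"
        unfolding carrier_presented_group by blast
      then have "u @ v \<in> words X"
        by simp
      then show "\<theta> (a \<otimes>\<^bsub>presented_group X R\<^esub> b) = \<theta> a \<otimes>\<^bsub>H\<^esub> \<theta> b"
        using uv f by (simp add: mult_word_class \<theta> word_eval_append del: append_in_lists_conv)
    next
      show "\<theta> a \<in> carrier H" if "a \<in> carrier (presented_group X R)" for a
        using that unfolding carrier_presented_group
        by (elim imageE) (simp only: \<theta> word_eval_closed[OF f])
    qed
  qed
qed

lemma word_class_inverse:
  assumes "x \<in> X"
  shows "inv\<^bsub>presented_group X R\<^esub> (word_class X R [(x, True)]) = word_class X R [(x, False)]"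
proof -
  interpret group "presented_group X R"
    by (rule group_presented_group)
  have "word_class X R [(x, False), (x, True)] = word_class X R []"
    unfolding word_class_def
    using pres_rel.cancel[OF assms, of False R] by (intro equiv_class_eq[OF equiv_pres_rel]) simp
  then show ?thesis
    using assms by (intro inv_equality) (auto simp: mult_word_class one_presented_group word_class_in_carrier)
qed

lemma word_eval_presented_group:
  assumes "w \<in> words X"
  shows "word_eval (presented_group X R) (\<lambda>x. word_class X R [(x, True)]) w = word_class X R w"
  using assms
proof (induction w rule: lists.induct)
  case (Cons l w)
  obtain x b where l: "l = (x, b)"
    by fastforce
  with Cons.hyps have "x \<in> X" by simp
  then have "word_class X R [(x, c)] \<otimes>\<^bsub>presented_group X R\<^esub> word_class X R w = word_class X R ((x, c) # w)" for c
    using Cons.hyps by (subst mult_word_class) auto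
  then show ?case
    using Cons l \<open>x \<in> X\<close> by (auto simp: word_class_inverse)
qed (simp add: one_presented_group)

lemma word_eval_relator:
  assumes "r \<in> R" "r \<in> words X"
  shows "word_eval (presented_group X R) (\<lambda>x. word_class X R [(x, True)]) r = \<one>\<^bsub>presented_group X R\<^esub>"
  unfolding word_eval_presented_group[OF assms(2)] one_presented_group
  unfolding word_class_def by (rule equiv_class_eq[OF equiv_pres_rel pres_rel.relator[OF assms]])

lemma hom_word_eval:
  assumes "group G" "group H" "\<theta> \<in> hom G H" "f \<in> X \<rightarrow> carrier G" "w \<in> words X"
  shows "\<theta> (word_eval G f w) = word_eval H (\<theta> \<circ> f) w"
proof -
  interpret group_hom G H \<theta>
    using assms by (simp add: group_hom_def group_hom_axioms_def)
  show ?thesis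
    using assms(5)
  proof (induction w rule: lists.induct)
    case (Cons l w)
    then have "f (fst l) \<in> carrier G"
      using assms(4) by auto
    then show ?case
      using Cons.IH G.word_eval_closed[OF assms(4) Cons.hyps(2)] by (cases l) auto
  qed simp
qed

lemma presented_group_hom_eqI:
  assumes "group H" "\<theta>\<^sub>1 \<in> hom (presented_group X R) H" "\<theta>\<^sub>2 \<in> hom (presented_group X R) H"
    and "\<And>x. x \<in> X \<Longrightarrow> \<theta>\<^sub>1 (word_class X R [(x, True)]) = \<theta>\<^sub>2 (word_class X R [(x, True)])"
    and "a \<in> carrier (presented_group X R)"
  shows "\<theta>\<^sub>1 a = \<theta>\<^sub>2 a"
proof -
  let ?c = "\<lambda>x. word_class X R [(x, True)]"
  obtain w where w: "w \<in> words X" "a = word_class X R w"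
    using assms(5) by (auto simp: carrier_presented_group)
  have c: "?c \<in> X \<rightarrow> carrier (presented_group X R)"
    by (auto simp: word_class_in_carrier)
  have "word_eval H (\<theta>\<^sub>1 \<circ> ?c) w = word_eval H (\<theta>\<^sub>2 \<circ> ?c) w"
    using w(1) assms(4) by (induction w) auto
  then show ?thesis
    using hom_word_eval[OF group_presented_group assms(1) assms(2) c w(1)]
      hom_word_eval[OF group_presented_group assms(1) assms(3) c w(1)]
    by (simp add: w word_eval_presented_group)
qed

lemma presented_group_induct [consumes 1, case_names one gen inv_gen]:
  assumes "a \<in> carrier (presented_group X R)"
    and "P \<one>\<^bsub>presented_group X R\<^esub>"
    and "\<And>x a. x \<in> X \<Longrightarrow> a \<in> carrier (presented_group X R) \<Longrightarrow> P a \<Longrightarrow>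
      P (word_class X R [(x, True)] \<otimes>\<^bsub>presented_group X R\<^esub> a)"
    and "\<And>x a. x \<in> X \<Longrightarrow> a \<in> carrier (presented_group X R) \<Longrightarrow> P a \<Longrightarrow>
      P (inv\<^bsub>presented_group X R\<^esub> word_class X R [(x, True)] \<otimes>\<^bsub>presented_group X R\<^esub> a)"
  shows "P a"
proof -
  obtain w where w: "w \<in> words X" "a = word_class X R w"
    using assms(1) by (auto simp: carrier_presented_group)
  have "P (word_class X R w)"
    using w(1)
  proof (induction w rule: lists.induct)
    case (Cons l w)
    obtain x b where l: "l = (x, b)"
      by fastforce
    have "word_class X R (l # w) = word_class X R [l] \<otimes>\<^bsub>presented_group X R\<^esub> word_class X R w"
      using Cons.hyps by (subst mult_word_class) auto
    then show ?case
      using Cons l assms(3,4)[of x "word_class X R w"]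
      by (cases b) (auto simp: word_class_inverse word_class_in_carrier)
  qed (use assms(2) in \<open>simp add: one_presented_group\<close>)
  then show ?thesis
    using w by simp
qed

section \<open>Coxeter groups\<close>

text \<open>The group of order two, target of the sign character of a Coxeter group.\<close>

lemma bool_group: "group \<lparr>carrier = (UNIV :: bool set), monoid.mult = (\<noteq>), one = False\<rparr>" (is "group ?B")
proof (rule groupI)
  show "\<exists>y\<in>carrier ?B. y \<otimes>\<^bsub>?B\<^esub> x = \<one>\<^bsub>?B\<^esub>" for x
    by (rule bexI[of _ x]) auto
qed auto

definition bij_group :: "('y \<Rightarrow> 'y) monoid" where
  "bij_group = \<lparr>carrier = {f. bij f}, monoid.mult = (\<circ>), one = id\<rparr>"

lemma group_bij_group: "group bij_group"
proof (rule groupI)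
  fix x :: "'a \<Rightarrow> 'a" assume x: "x \<in> carrier bij_group"
  show "\<exists>y\<in>carrier bij_group. y \<otimes>\<^bsub>bij_group\<^esub> x = \<one>\<^bsub>bij_group\<^esub>"
    using x by (intro bexI[of _ "inv_into UNIV x"])
      (auto simp: bij_group_def bij_imp_bij_inv bij_is_inj)
qed (auto simp: bij_group_def bij_comp comp_assoc)

lemma pow_bij_group: "f [^]\<^bsub>bij_group\<^esub> (n::nat) = f ^^ n"
  by (induction n) (auto simp: nat_pow_def bij_group_def funpow_swap1 fun_eq_iff)

text \<open>For generators of a Coxeter system this replaces the condition \<open>m(s, t) < \<infinity>\<close>, which implies it.
  The converse, that \<open>m(s, t)\<close> is the exact order of \<open>s t\<close>, is never needed.\<close>

definition fin_prod :: "('a, 'b) monoid_scheme \<Rightarrow> 'a \<Rightarrow> 'a \<Rightarrow> bool" where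
  "fin_prod W s t \<longleftrightarrow> (\<exists>n::nat. 0 < n \<and> (s \<otimes>\<^bsub>W\<^esub> t) [^]\<^bsub>W\<^esub> n = \<one>\<^bsub>W\<^esub>)"

lemma (in group) word_eval_relator_pow:
  assumes "g \<in> S \<rightarrow> carrier G" "s \<in> S" "t \<in> S"
  shows "word_eval G g (concat (replicate n [(s, True), (t, True)])) = (g s \<otimes> g t) [^] n"
proof -
  have "[(s, True), (t, True)] \<in> words S"
    using assms by simp
  moreover have "g s \<in> carrier G" "g t \<in> carrier G"
    using assms by auto
  ultimately show ?thesis
    using word_eval_pow[OF assms(1)] by auto
qed

text \<open>The hypothesis \<open>rel\<close> ranges over the power relations that hold in
  \<open>W\<close> instead of over the matrix \<open>m\<close>: each relator evaluates to the
  identity of \<open>W\<close>, since \<phi> is a homomorphism, and so is one of them.\<close>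

lemma coxeter_hom:
  assumes cox: "coxeter_system W S" and "group H" and f: "f \<in> S \<rightarrow> carrier H"
    and rel: "\<And>s t (n::nat). s \<in> S \<Longrightarrow> t \<in> S \<Longrightarrow> 0 < n \<Longrightarrow> (s \<otimes>\<^bsub>W\<^esub> t) [^]\<^bsub>W\<^esub> n = \<one>\<^bsub>W\<^esub> \<Longrightarrow>
      (f s \<otimes>\<^bsub>H\<^esub> f t) [^]\<^bsub>H\<^esub> n = \<one>\<^bsub>H\<^esub>"
  shows "\<exists>\<theta> \<in> hom W H. \<forall>s\<in>S. \<theta> s = f s"
proof -
  obtain m \<phi> where m: "\<And>s t. s \<in> S \<Longrightarrow> t \<in> S \<Longrightarrow> 1 \<le> (m s t :: enat)"
    and \<phi>: "\<phi> \<in> iso (presented_group S (coxeter_relators S m)) W"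
      "\<And>s. s \<in> S \<Longrightarrow> \<phi> (word_class S (coxeter_relators S m) [(s, True)]) = s"
    using cox unfolding coxeter_system_def by blast
  let ?P = "presented_group S (coxeter_relators S m)"
  let ?c = "\<lambda>s. word_class S (coxeter_relators S m) [(s, True)]"
  have W: "group W" and SW: "S \<subseteq> carrier W"
    using cox by (auto simp: coxeter_system_def)
  interpret W: group W by (rule W)
  interpret H: group H by fact
  interpret P: group ?P by (rule group_presented_group)
  have c: "?c \<in> S \<rightarrow> carrier ?P"
    by (auto simp: word_class_in_carrier)
  have "word_eval H f r = \<one>\<^bsub>H\<^esub>" if r: "r \<in> coxeter_relators S m" "r \<in> words S" for r
  proof -
    obtain s t n where st: "s \<in> S" "t \<in> S" "m s t = enat n" "r = concat (replicate n [(s, True), (t, True)])"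
      using r(1) by (auto simp: coxeter_relators_def)
    have "0 < n"
      using m[OF st(1,2)] st(3) by (auto simp: one_enat_def)
    have "(\<lambda>x. x) \<in> S \<rightarrow> carrier W"
      using SW by auto
    have "\<phi> (word_eval ?P ?c r) = word_eval W (\<phi> \<circ> ?c) r"
      using \<phi>(1) by (intro hom_word_eval[OF P.group_axioms W _ c r(2)]) (simp add: iso_def)
    also have "\<dots> = word_eval W (\<lambda>x. x) r"
      using r(2) by (induction r rule: lists.induct) (auto simp: \<phi>(2) simp del: in_lists_conv_set)
    finally have "word_eval W (\<lambda>x. x) r = \<phi> \<one>\<^bsub>?P\<^esub>"
      using word_eval_relator[OF r] by simp
    also have "\<dots> = \<one>\<^bsub>W\<^esub>"
      using \<phi>(1) P.group_axioms W by (intro hom_one) (simp_all add: iso_def)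
    finally have "(s \<otimes>\<^bsub>W\<^esub> t) [^]\<^bsub>W\<^esub> n = \<one>\<^bsub>W\<^esub>"
      unfolding st(4) W.word_eval_relator_pow[OF \<open>(\<lambda>x. x) \<in> S \<rightarrow> carrier W\<close> st(1,2)] .
    then show ?thesis
      using rel[OF st(1,2) \<open>0 < n\<close>] unfolding st(4) H.word_eval_relator_pow[OF f st(1,2)] by simp
  qed
  from presented_group_hom[OF H.group_axioms f this] obtain \<theta> where
    \<theta>: "\<theta> \<in> hom ?P H" "\<And>s. s \<in> S \<Longrightarrow> \<theta> (?c s) = f s"
    by blast
  have inv: "inv_into (carrier ?P) \<phi> \<in> iso W ?P"
    using P.iso_set_sym[OF \<phi>(1)] .
  show ?thesis
  proof (intro bexI ballI)
    show "\<theta> \<circ> inv_into (carrier ?P) \<phi> \<in> hom W H"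
      using inv \<theta>(1) by (intro hom_compose) (auto simp: iso_def)
    fix s assume s: "s \<in> S"
    then have "inv_into (carrier ?P) \<phi> (\<phi> (?c s)) = ?c s"
      using \<phi>(1) c by (intro inv_into_f_f) (auto simp: iso_def bij_betw_def)
    then show "(\<theta> \<circ> inv_into (carrier ?P) \<phi>) s = f s"
      using \<theta>(2) \<phi>(2) s by simp
  qed
qed

lemma coxeter_generate:
  assumes "coxeter_system W S"
  shows "generate W S = carrier W"
proof -
  obtain m \<phi> where
    \<phi>: "\<phi> \<in> iso (presented_group S (coxeter_relators S m)) W"
      "\<And>s. s \<in> S \<Longrightarrow> \<phi> (word_class S (coxeter_relators S m) [(s, True)]) = s"
    using assms unfolding coxeter_system_def by blast
  let ?P = "presented_group S (coxeter_relators S m)"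
  have W: "group W" and SW: "S \<subseteq> carrier W"
    using assms by (auto simp: coxeter_system_def)
  interpret W: group W by (rule W)
  interpret group_hom ?P W \<phi>
    using \<phi>(1) W by (simp add: group_hom_def group_hom_axioms_def group_presented_group iso_def)
  have "\<phi> a \<in> generate W S" if "a \<in> carrier ?P" for a
    using that
  proof (induction rule: presented_group_induct)
    case one
    then show ?case
      by (simp add: generate.one)
  next
    case (gen x a)
    then show ?case
      using \<phi>(2) by (auto simp: word_class_in_carrier intro: generate.eng generate.incl)
  next
    case (inv_gen x a)
    then show ?case
      using \<phi>(2) by (auto simp: word_class_in_carrier intro: generate.eng generate.inv)
  qed
  moreover have "\<phi> ` carrier ?P = carrier W"
    using \<phi>(1) by (simp add: iso_def bij_betw_def)
  ultimately show ?thesis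
    using W.generate_incl[OF SW] by (metis image_subset_iff subset_antisym)
qed

lemma coxeter_involution:
  assumes "coxeter_system W S" "s \<in> S"
  shows "s \<otimes>\<^bsub>W\<^esub> s = \<one>\<^bsub>W\<^esub>" "s \<noteq> \<one>\<^bsub>W\<^esub>"
proof -
  obtain m \<phi> where m: "\<And>s. s \<in> S \<Longrightarrow> m s s = (1::enat)"
    and \<phi>: "\<phi> \<in> iso (presented_group S (coxeter_relators S m)) W"
      "\<And>s. s \<in> S \<Longrightarrow> \<phi> (word_class S (coxeter_relators S m) [(s, True)]) = s"
    using assms unfolding coxeter_system_def by blast
  let ?P = "presented_group S (coxeter_relators S m)"
  have W: "group W" and SW: "S \<subseteq> carrier W"
    using assms by (auto simp: coxeter_system_def)
  interpret W: group W by (rule W)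
  interpret group_hom ?P W \<phi>
    using \<phi>(1) W by (simp add: group_hom_def group_hom_axioms_def group_presented_group iso_def)
  have "[(s, True), (s, True)] \<in> coxeter_relators S m"
    unfolding coxeter_relators_def using m[OF assms(2)] assms(2)
    by (intro CollectI exI[of _ s] exI[of _ "1::nat"]) (simp add: one_enat_def)
  then have "word_eval ?P (\<lambda>x. word_class S (coxeter_relators S m) [(x, True)]) [(s, True), (s, True)] = \<one>\<^bsub>?P\<^esub>"
    using assms(2) by (intro word_eval_relator) simp_all
  then have "\<phi> (word_class S (coxeter_relators S m) [(s, True)] \<otimes>\<^bsub>?P\<^esub> word_class S (coxeter_relators S m) [(s, True)]) = \<phi> \<one>\<^bsub>?P\<^esub>"
    using assms(2) by (simp add: word_class_in_carrier)
  then show "s \<otimes>\<^bsub>W\<^esub> s = \<one>\<^bsub>W\<^esub>"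
    using \<phi>(2) assms(2) by (simp add: word_class_in_carrier)
  \<comment> \<open>Every relator has even length, so sending all generators to \<open>True\<close>
    defines the sign character, which is nontrivial on \<open>s\<close>.\<close>
  let ?B = "\<lparr>carrier = (UNIV :: bool set), monoid.mult = (\<noteq>), one = False\<rparr>"
  have "(True \<otimes>\<^bsub>?B\<^esub> True) [^]\<^bsub>?B\<^esub> n = \<one>\<^bsub>?B\<^esub>" for n :: nat
    using monoid.nat_pow_one[OF group.is_monoid[OF bool_group]] by simp
  then obtain \<theta> where "\<theta> \<in> hom W ?B" "\<forall>s\<in>S. \<theta> s = True"
    using coxeter_hom[OF assms(1) bool_group, of "\<lambda>_. True"] by auto
  then show "s \<noteq> \<one>\<^bsub>W\<^esub>"
    using Group.hom_one[OF _ W bool_group] assms(2) by fastforce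
qed

section \<open>Dihedral relations and the action on signed elements\<close>

lemma (in group) involution_inv:
  assumes "s \<in> carrier G" "s \<otimes> s = \<one>"
  shows "inv s = s"
  using assms by (simp add: inv_equality)

lemma (in group) inv_cancel_left [simp]:
  assumes "x \<in> carrier G" "y \<in> carrier G"
  shows "inv x \<otimes> (x \<otimes> y) = y" "x \<otimes> (inv x \<otimes> y) = y"
  using assms by (simp_all flip: m_assoc)

lemma (in group) involution_cancel_left:
  assumes "s \<in> carrier G" "s \<otimes> s = \<one>" "y \<in> carrier G"
  shows "s \<otimes> (s \<otimes> y) = y"
  using assms by (simp flip: m_assoc)

text \<open>Conjugation by \<open>t\<close> inverts \<open>s \<otimes> t\<close>, as in every
  dihedral group.\<close>

lemma (in group) involution_pow_swap:
  assumes st: "s \<in> carrier G" "t \<in> carrier G" "s \<otimes> s = \<one>" "t \<otimes> t = \<one>"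
  shows "inv ((s \<otimes> t) [^] (k::nat)) \<otimes> t = t \<otimes> (s \<otimes> t) [^] k"
proof (induction k)
  case (Suc k)
  let ?c = "s \<otimes> t"
  have c: "?c \<in> carrier G" "?c [^] k \<in> carrier G"
    using st by auto
  have "inv (?c [^] Suc k) \<otimes> t = inv (?c \<otimes> ?c [^] k) \<otimes> t"
    using c nat_pow_comm[of ?c k 1] by simp
  also have "\<dots> = inv (?c [^] k) \<otimes> t \<otimes> ?c"
    using c st by (simp add: inv_mult_group involution_inv m_assoc involution_cancel_left)
  also have "\<dots> = t \<otimes> ?c [^] Suc k"
    using Suc c st by (simp add: m_assoc)
  finally show ?case .
qed (use st in simp)

text \<open>The classical action of a generator on reflections with signs: conjugation, with the
  sign flipped exactly at \<open>s\<close> itself. It is extended to all of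
  \<open>carrier W\<close>, and by the identity elsewhere, so that it is a bijection of the whole
  type.\<close>

definition refl_map :: "('a, 'b) monoid_scheme \<Rightarrow> 'a \<Rightarrow> 'a \<times> bool \<Rightarrow> 'a \<times> bool" where
  "refl_map W s = (\<lambda>(t, b). if t \<in> carrier W then (s \<otimes>\<^bsub>W\<^esub> t \<otimes>\<^bsub>W\<^esub> s, b \<noteq> (t = s)) else (t, b))"

lemma (in group) refl_map_refl_map:
  assumes "s \<in> carrier G" "s \<otimes> s = \<one>"
  shows "refl_map G s (refl_map G s p) = p"
proof -
  have "s \<otimes> (s \<otimes> t \<otimes> s) \<otimes> s = t" if "t \<in> carrier G" for t
    using that assms by (simp add: m_assoc involution_cancel_left)
  moreover have "s \<otimes> t \<otimes> s = s \<longleftrightarrow> t = s" if t: "t \<in> carrier G" for t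
  proof
    assume "s \<otimes> t \<otimes> s = s"
    then have "s \<otimes> (s \<otimes> t \<otimes> s) \<otimes> s = s \<otimes> s \<otimes> s"
      by simp
    then show "t = s"
      using t assms by (simp add: m_assoc involution_cancel_left)
  qed (use assms in simp)
  ultimately show ?thesis
    using assms by (auto simp: refl_map_def split: prod.splits)
qed

text \<open>The elements \<open>t \<otimes> (s \<otimes> t) [^] j\<close> are \<open>t\<close>,
  \<open>t s t\<close>, \<open>t s t s t\<close>, ...: those at which the successive factors of the
  alternating product flip the sign of \<open>x\<close>. Even \<open>j\<close> belong to the factors
  \<open>t\<close>, odd \<open>j\<close> to the factors \<open>s\<close>.\<close>

lemma (in group) refl_map_pow:
  assumes st: "s \<in> carrier G" "t \<in> carrier G" "s \<otimes> s = \<one>" "t \<otimes> t = \<one>" and x: "x \<in> carrier G"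
  shows "((refl_map G s \<circ> refl_map G t) ^^ k) (x, b) =
    ((s \<otimes> t) [^] k \<otimes> x \<otimes> inv ((s \<otimes> t) [^] k), b \<noteq> odd (\<Sum>j<2 * k. of_bool (t \<otimes> (s \<otimes> t) [^] j = x) :: nat))"
proof (induction k)
  case 0
  then show ?case
    using x by simp
next
  case (Suc k)
  define c where "c = s \<otimes> t"
  define d where "d = c [^] k"
  have c: "c \<in> carrier G" "d \<in> carrier G"
    using st by (auto simp: c_def d_def)
  define y where "y = d \<otimes> x \<otimes> inv d"
  have y: "y \<in> carrier G"
    using c x by (simp add: y_def)
  have dt: "inv d \<otimes> t = t \<otimes> d"
    using involution_pow_swap[OF st] by (simp add: c_def d_def)
  have conj: "y = z \<longleftrightarrow> inv d \<otimes> z \<otimes> d = x" if z: "z \<in> carrier G" for z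
  proof
    assume "y = z"
    then show "inv d \<otimes> z \<otimes> d = x"
      unfolding y_def using c x by (auto simp: m_assoc)
  next
    assume "inv d \<otimes> z \<otimes> d = x"
    then show "y = z"
      unfolding y_def using c z by (auto simp: m_assoc)
  qed
  have dd: "d \<otimes> d = c [^] (2 * k)"
    using c by (simp add: d_def nat_pow_mult mult_2)
  have 1: "y = t \<longleftrightarrow> t \<otimes> c [^] (2 * k) = x"
    using conj[OF st(2)] dd dt c st by (simp add: m_assoc)
  have "t \<otimes> y \<otimes> t = s \<longleftrightarrow> y = t \<otimes> c"
  proof
    assume "t \<otimes> y \<otimes> t = s"
    then show "y = t \<otimes> c"
      using st y unfolding c_def by (auto simp: m_assoc involution_cancel_left)
  next
    assume "y = t \<otimes> c"
    then show "t \<otimes> y \<otimes> t = s"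
      using st unfolding c_def by (auto simp: m_assoc involution_cancel_left)
  qed
  also have "\<dots> \<longleftrightarrow> inv d \<otimes> (t \<otimes> c) \<otimes> d = x"
    using conj[of "t \<otimes> c"] st c by simp
  also have "inv d \<otimes> (t \<otimes> c) \<otimes> d = t \<otimes> (d \<otimes> c \<otimes> d)"
    using dt st c by (metis inv_closed m_assoc m_closed)
  also have "d \<otimes> c \<otimes> d = c [^] Suc (2 * k)"
  proof -
    have "d \<otimes> c = c \<otimes> d"
      using c nat_pow_comm[of c k 1] by (simp add: d_def)
    then have "d \<otimes> c \<otimes> d = c \<otimes> c [^] (2 * k)"
      using c dd by (simp add: m_assoc)
    then show ?thesis
      using c nat_pow_Suc2 by simp
  qed
  finally have 2: "t \<otimes> y \<otimes> t = s \<longleftrightarrow> t \<otimes> c [^] Suc (2 * k) = x" .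
  have 3: "s \<otimes> (t \<otimes> y \<otimes> t) \<otimes> s = c [^] Suc k \<otimes> x \<otimes> inv (c [^] Suc k)"
  proof -
    have "c [^] Suc k = c \<otimes> d"
      using c nat_pow_comm[of c k 1] by (simp add: d_def)
    moreover have "inv c = t \<otimes> s"
      using st by (simp add: c_def inv_mult_group involution_inv)
    ultimately show ?thesis
      using st c x unfolding y_def by (simp add: inv_mult_group c_def[symmetric] m_assoc)
        (simp add: c_def m_assoc)
  qed
  have "((refl_map G s \<circ> refl_map G t) ^^ Suc k) (x, b) =
      (s \<otimes> (t \<otimes> y \<otimes> t) \<otimes> s, ((b \<noteq> odd (\<Sum>j<2 * k. of_bool (t \<otimes> c [^] j = x) :: nat)) \<noteq> (y = t)) \<noteq> (t \<otimes> y \<otimes> t = s))"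
    unfolding funpow.simps comp_apply Suc.IH[unfolded comp_apply]
    using y st unfolding c_def[symmetric] d_def[symmetric] y_def[symmetric]
    by (simp add: refl_map_def)
  also have "\<dots> = (c [^] Suc k \<otimes> x \<otimes> inv (c [^] Suc k), b \<noteq> odd (\<Sum>j<2 * Suc k. of_bool (t \<otimes> c [^] j = x) :: nat))"
    unfolding 1 2 3 by auto
  finally show ?case
    unfolding c_def .
qed

text \<open>If \<open>(s \<otimes> t) [^] n\<close> is trivial, the sequence of flipping elements
  has period \<open>n\<close>, whether or not \<open>n\<close> is the exact order. Over
  \<open>2 * n\<close> factors every flip thus occurs twice and the signs are restored.\<close>

lemma (in group) refl_map_relator:
  assumes st: "s \<in> carrier G" "t \<in> carrier G" "s \<otimes> s = \<one>" "t \<otimes> t = \<one>" and n: "(s \<otimes> t) [^] (n::nat) = \<one>"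
  shows "(refl_map G s \<circ> refl_map G t) ^^ n = id"
proof (rule ext)
  fix p :: "'a \<times> bool"
  obtain x b where p: "p = (x, b)"
    by fastforce
  show "((refl_map G s \<circ> refl_map G t) ^^ n) p = id p"
  proof (cases "x \<in> carrier G")
    case True
    let ?g = "\<lambda>j. of_bool (t \<otimes> (s \<otimes> t) [^] j = x) :: nat"
    have "?g (j + n) = ?g j" for j :: nat
    proof -
      have "(s \<otimes> t) [^] (j + n) = (s \<otimes> t) [^] j"
        using st n nat_pow_mult[of "s \<otimes> t" j n] by simp
      then show ?thesis
        by simp
    qed
    then have "sum ?g {n..<n + n} = sum ?g {..<n}"
      using sum.shift_bounds_nat_ivl[of ?g 0 n n] by (simp add: lessThan_atLeast0)
    then have "sum ?g {..<2 * n} = 2 * sum ?g {..<n}"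
      using sum.atLeastLessThan_concat[of 0 n "n + n" ?g] by (simp add: lessThan_atLeast0 mult_2)
    then show ?thesis
      using refl_map_pow[OF st True, of n b] n True unfolding p by simp
  next
    case False
    have "((refl_map G s \<circ> refl_map G t) ^^ k) p = p" for k
      by (induction k) (auto simp: refl_map_def p False)
    then show ?thesis
      by simp
  qed
qed

text \<open>\<open>\<eta> w t\<close> is the parity of the number of times the reflection \<open>t\<close> occurs among the elements
  \<open>s\<^sub>k \<dots> s\<^sub>i \<dots> s\<^sub>k\<close> for any expression \<open>w = s\<^sub>1 \<dots> s\<^sub>k\<close>.\<close>

lemma coxeter_cocycle:
  assumes cox: "coxeter_system W S"
  obtains \<eta> where
    "\<And>t. t \<in> carrier W \<Longrightarrow> \<not> \<eta> \<one>\<^bsub>W\<^esub> t"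
    "\<And>s w t. s \<in> S \<Longrightarrow> w \<in> carrier W \<Longrightarrow> t \<in> carrier W \<Longrightarrow>
      \<eta> (s \<otimes>\<^bsub>W\<^esub> w) t = (\<eta> w t \<noteq> (w \<otimes>\<^bsub>W\<^esub> t \<otimes>\<^bsub>W\<^esub> inv\<^bsub>W\<^esub> w = s))"
    "\<And>s w. s \<in> S \<Longrightarrow> w \<in> carrier W \<Longrightarrow> \<eta> (w \<otimes>\<^bsub>W\<^esub> s) s = (\<not> \<eta> w s)"
proof -
  have W: "group W" and SW: "S \<subseteq> carrier W"
    using cox by (auto simp: coxeter_system_def)
  interpret W: group W by (rule W)
  interpret B: group "bij_group :: ('a \<times> bool \<Rightarrow> 'a \<times> bool) monoid" by (rule group_bij_group)
  note S = subsetD[OF SW] coxeter_involution[OF cox]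
  have "\<exists>\<theta> \<in> hom W bij_group. \<forall>s\<in>S. \<theta> s = refl_map W s"
  proof (rule coxeter_hom[OF cox group_bij_group])
    show "refl_map W \<in> S \<rightarrow> carrier bij_group"
    proof
      fix s assume "s \<in> S"
      then have "refl_map W s (refl_map W s p) = p" for p
        using W.refl_map_refl_map S by blast
      then show "refl_map W s \<in> carrier bij_group"
        by (simp add: bij_group_def involuntory_imp_bij)
    qed
    fix s t and n :: nat
    assume st: "s \<in> S" "t \<in> S" "(s \<otimes>\<^bsub>W\<^esub> t) [^]\<^bsub>W\<^esub> n = \<one>\<^bsub>W\<^esub>"
    have "(refl_map W s \<circ> refl_map W t) ^^ n = id"
      using st S by (intro W.refl_map_relator) auto
    then show "(refl_map W s \<otimes>\<^bsub>bij_group\<^esub> refl_map W t) [^]\<^bsub>bij_group\<^esub> n = \<one>\<^bsub>bij_group\<^esub>"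
      unfolding pow_bij_group by (simp add: bij_group_def)
  qed
  then obtain \<theta> where \<theta>: "\<theta> \<in> hom W bij_group" "\<And>s. s \<in> S \<Longrightarrow> \<theta> s = refl_map W s"
    by blast
  have mult: "\<theta> (v \<otimes>\<^bsub>W\<^esub> w) p = \<theta> v (\<theta> w p)" if "v \<in> carrier W" "w \<in> carrier W" for v w p
    using \<theta>(1) that by (simp add: hom_mult bij_group_def)
  have one: "\<theta> \<one>\<^bsub>W\<^esub> p = p" for p
    using Group.hom_one[OF \<theta>(1) W group_bij_group] by (simp add: bij_group_def)
  \<comment> \<open>The sign that \<open>w\<close> gives to \<open>t\<close>;
    \<open>\<theta>_\<eta>\<close> below shows that this sign and conjugation by \<open>w\<close>
    describe \<open>\<theta> w\<close> completely.\<close>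
  define \<eta> where "\<eta> w t = snd (\<theta> w (t, False))" for w t
  have \<theta>_\<eta>: "\<forall>t\<in>carrier W. \<forall>b. \<theta> w (t, b) = (w \<otimes>\<^bsub>W\<^esub> t \<otimes>\<^bsub>W\<^esub> inv\<^bsub>W\<^esub> w, b \<noteq> \<eta> w t)" if "w \<in> carrier W" for w
  proof -
    have "w \<in> generate W S"
      using that coxeter_generate[OF cox] by simp
    then show ?thesis
    proof (induction w rule: generate.induct)
      case one
      then show ?case
        using one by (simp add: \<eta>_def \<open>\<And>p. \<theta> \<one>\<^bsub>W\<^esub> p = p\<close>)
    next
      case (incl h)
      then show ?case
        using S[of h] by (auto simp: \<theta>(2) \<eta>_def refl_map_def W.involution_inv)
    next
      case (inv h)
      then show ?case
        using S[of h] by (auto simp: \<theta>(2) \<eta>_def refl_map_def W.involution_inv)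
    next
      case (eng v w)
      then have vw: "v \<in> carrier W" "w \<in> carrier W"
        using W.generate_in_carrier[OF SW] by auto
      have "\<theta> (v \<otimes>\<^bsub>W\<^esub> w) (t, b) = (v \<otimes>\<^bsub>W\<^esub> w \<otimes>\<^bsub>W\<^esub> t \<otimes>\<^bsub>W\<^esub> inv\<^bsub>W\<^esub> (v \<otimes>\<^bsub>W\<^esub> w),
          (b \<noteq> \<eta> w t) \<noteq> \<eta> v (w \<otimes>\<^bsub>W\<^esub> t \<otimes>\<^bsub>W\<^esub> inv\<^bsub>W\<^esub> w))" if "t \<in> carrier W" for t b
        using eng.IH(1)[rule_format, of "w \<otimes>\<^bsub>W\<^esub> t \<otimes>\<^bsub>W\<^esub> inv\<^bsub>W\<^esub> w"] eng.IH(2)[rule_format, OF that] vw that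
        by (simp add: mult W.m_assoc W.inv_mult_group)
      then show ?case
        by (auto simp: \<eta>_def[of "v \<otimes>\<^bsub>W\<^esub> w"])
    qed
  qed
  show thesis
  proof
    show "\<not> \<eta> \<one>\<^bsub>W\<^esub> t" for t
      by (simp add: \<eta>_def one)
    show "\<eta> (s \<otimes>\<^bsub>W\<^esub> w) t = (\<eta> w t \<noteq> (w \<otimes>\<^bsub>W\<^esub> t \<otimes>\<^bsub>W\<^esub> inv\<^bsub>W\<^esub> w = s))"
      if "s \<in> S" "w \<in> carrier W" "t \<in> carrier W" for s w t
      using that S(1) \<theta>_\<eta>[of w] by (simp add: \<eta>_def[of "s \<otimes>\<^bsub>W\<^esub> w"] mult \<theta>(2) refl_map_def)
    show "\<eta> (w \<otimes>\<^bsub>W\<^esub> s) s = (\<not> \<eta> w s)" if "s \<in> S" "w \<in> carrier W" for s w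
      using that S[of s] \<theta>_\<eta>[of w] by (simp add: \<eta>_def[of "w \<otimes>\<^bsub>W\<^esub> s"] mult \<theta>(2) refl_map_def W.m_assoc)
  qed
qed

section \<open>Length functions and the number of ends\<close>

text \<open>The choice \<open>C = {}\<close> is included, so an unsplittable set is itself connected
  by pairs with product of finite order.\<close>

definition unsplit :: "('a, 'b) monoid_scheme \<Rightarrow> 'a set \<Rightarrow> bool" where
  "unsplit W A \<longleftrightarrow> (\<forall>C\<subseteq>A. finite (generate W C) \<longrightarrow>
    (\<forall>s\<in>A - C. \<forall>t\<in>A - C. (s, t) \<in> {(a, b). a \<in> A - C \<and> b \<in> A - C \<and> fin_prod W a b}\<^sup>*))"

lemma unsplitD:
  assumes "unsplit W A" "C \<subseteq> A" "finite (generate W C)" "s \<in> A - C" "t \<in> A - C"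
  shows "(s, t) \<in> {(a, b). a \<in> A - C \<and> b \<in> A - C \<and> fin_prod W a b}\<^sup>*"
  using assms(1)[unfolded unsplit_def, rule_format, OF assms(2-5)] .

text \<open>What the length arguments use of a Coxeter system: the generators are involutions and
  come with a parity cocycle. Read \<open>\<eta> w s\<close> as: \<open>s\<close> is a right descent
  of \<open>w\<close>.\<close>

locale reflection_group = group G for G :: "'a monoid" (structure) +
  fixes S :: "'a set" and \<eta> :: "'a \<Rightarrow> 'a \<Rightarrow> bool"
  assumes S_carrier: "S \<subseteq> carrier G"
    and S_inv: "s \<in> S \<Longrightarrow> s \<otimes> s = \<one>"
    and \<eta>_one: "t \<in> carrier G \<Longrightarrow> \<not> \<eta> \<one> t"
    and \<eta>_left: "s \<in> S \<Longrightarrow> w \<in> carrier G \<Longrightarrow> t \<in> carrier G \<Longrightarrow>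
      \<eta> (s \<otimes> w) t = (\<eta> w t \<noteq> (w \<otimes> t \<otimes> inv w = s))"
    and \<eta>_right: "s \<in> S \<Longrightarrow> w \<in> carrier G \<Longrightarrow> \<eta> (w \<otimes> s) s = (\<not> \<eta> w s)"
begin

section \<open>Words, the exchange condition and lengths\<close>

definition lprod :: "'a list \<Rightarrow> 'a" where
  "lprod ws = foldr (\<otimes>) ws \<one>"

lemma lprod_simps [simp]: "lprod [] = \<one>" "lprod (x # ws) = x \<otimes> lprod ws"
  by (simp_all add: lprod_def)

lemma lprod_closed: "ws \<in> lists S \<Longrightarrow> lprod ws \<in> carrier G"
  by (induction ws rule: lists.induct) (use S_carrier in auto)

lemma lprod_append:
  "us \<in> lists S \<Longrightarrow> vs \<in> lists S \<Longrightarrow> lprod (us @ vs) = lprod us \<otimes> lprod vs"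
proof (induction us rule: lists.induct)
  case (Cons s us)
  then show ?case
    using lprod_closed[of us] lprod_closed[of vs] S_carrier by (auto simp: m_assoc simp del: in_lists_conv_set)
qed (simp add: lprod_closed)

lemma generate_carrier: "A \<subseteq> S \<Longrightarrow> generate G A \<subseteq> carrier G"
  using S_carrier by (intro generate_incl) auto

lemma generate_eq_lprod:
  assumes A: "A \<subseteq> S"
  shows "generate G A = lprod ` lists A"
proof
  have lists: "ws \<in> lists S" if "ws \<in> lists A" for ws
    using A that by auto
  show "generate G A \<subseteq> lprod ` lists A"
  proof
    fix w assume "w \<in> generate G A"
    then show "w \<in> lprod ` lists A"
    proof (induction rule: generate.induct)
      case one
      show ?case by (rule image_eqI[of _ _ "[]"]) simp_all
    next
      case (incl h)
      then show ?case
        using A S_carrier by (intro image_eqI[of _ _ "[h]"]) auto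
    next
      case (inv h)
      then have "inv h = h"
        using A S_carrier S_inv by (intro involution_inv) auto
      then show ?case
        using A S_carrier inv by (intro image_eqI[of _ _ "[h]"]) auto
    next
      case (eng v w)
      then obtain us vs where "us \<in> lists A" "vs \<in> lists A" "v = lprod us" "w = lprod vs"
        by blast
      then show ?case
        using lists by (intro image_eqI[of _ _ "us @ vs"]) (simp_all add: lprod_append del: in_lists_conv_set)
    qed
  qed
  have "lprod ws \<in> generate G A" if "ws \<in> lists A" for ws
    using that by (induction ws rule: lists.induct) (auto intro: generate.intros)
  then show "lprod ` lists A \<subseteq> generate G A"
    by blast
qed

text \<open>The strong exchange condition. By \<open>\<eta>_left\<close> the parity changes at the
  first letter \<open>s\<close> only if the rest \<open>w\<close> satisfies
  \<open>w t = s w\<close>; then multiplying by \<open>t\<close> deletes this letter. Otherwise the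
  odd parity is inherited by the rest of the word, and it cannot survive down to the empty
  word.\<close>

lemma exchange:
  assumes "ws \<in> lists S" "t \<in> carrier G" "\<eta> (lprod ws) t"
  shows "\<exists>us s vs. ws = us @ s # vs \<and> lprod ws \<otimes> t = lprod (us @ vs)"
  using assms(1,3)
proof (induction ws rule: lists.induct)
  case Nil
  then show ?case
    using \<eta>_one assms(2) by simp
next
  case (Cons s ws)
  have ws: "lprod ws \<in> carrier G" and s: "s \<in> carrier G"
    using Cons.hyps S_carrier by (auto intro: lprod_closed)
  show ?case
  proof (cases "lprod ws \<otimes> t \<otimes> inv (lprod ws) = s")
    case True
    then have *: "lprod ws \<otimes> t = s \<otimes> lprod ws"
      using ws assms(2) by (auto simp: m_assoc)
    have "lprod (s # ws) \<otimes> t = s \<otimes> (lprod ws \<otimes> t)"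
      using ws s assms(2) by (simp add: m_assoc)
    also have "\<dots> = s \<otimes> (s \<otimes> lprod ws)"
      unfolding * ..
    also have "\<dots> = lprod ws"
      using ws s S_inv[OF Cons.hyps(1)] by (simp add: involution_cancel_left)
    finally show ?thesis
      by (intro exI[of _ "[]"]) auto
  next
    case False
    then have "\<eta> (lprod ws) t"
      using Cons.prems \<eta>_left[OF Cons.hyps(1) ws assms(2)] by simp
    then obtain us x vs where "ws = us @ x # vs" "lprod ws \<otimes> t = lprod (us @ vs)"
      using Cons.IH by blast
    then show ?thesis
      using ws s assms(2) by (intro exI[of _ "s # us"] exI[of _ x] exI[of _ vs]) (simp add: m_assoc)
  qed
qed

text \<open>The alphabet is a parameter because lengths over a subset of the generators are compared
  with lengths over the whole set.\<close>

definition len :: "'a set \<Rightarrow> 'a \<Rightarrow> nat" where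
  "len A w = (LEAST k. \<exists>ws\<in>lists A. length ws = k \<and> lprod ws = w)"

lemma reduced_word:
  assumes "A \<subseteq> S" "w \<in> generate G A"
  obtains ws where "ws \<in> lists A" "length ws = len A w" "lprod ws = w"
proof -
  have "\<exists>k. \<exists>ws\<in>lists A. length ws = k \<and> lprod ws = w"
    using assms generate_eq_lprod by auto
  from LeastI_ex[OF this] show thesis
    using that unfolding len_def by blast
qed

lemma len_le: "ws \<in> lists A \<Longrightarrow> len A (lprod ws) \<le> length ws"
  unfolding len_def by (rule Least_le) blast

lemma len_one [simp]: "len A \<one> = 0"
  using len_le[of "[]" A] by simp

lemma len_eq_0: "A \<subseteq> S \<Longrightarrow> w \<in> generate G A \<Longrightarrow> len A w = 0 \<longleftrightarrow> w = \<one>"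
  by (metis reduced_word len_one length_0_conv lprod_simps(1))

lemma len_mult_le:
  assumes "A \<subseteq> S" "w \<in> generate G A" "s \<in> A"
  shows "len A (w \<otimes> s) \<le> Suc (len A w)"
proof -
  obtain ws where ws: "ws \<in> lists A" "length ws = len A w" "lprod ws = w"
    using reduced_word assms by metis
  have "s \<in> carrier G" "ws \<in> lists S" "[s] \<in> lists S"
    using assms S_carrier ws by auto
  then have "lprod (ws @ [s]) = w \<otimes> s"
    using ws(3) by (subst lprod_append) auto
  then show ?thesis
    using len_le[of "ws @ [s]" A] ws assms by simp
qed

lemma descent_less:
  assumes "A \<subseteq> S" "w \<in> generate G A" "s \<in> A" "\<eta> w s"
  shows "len A (w \<otimes> s) < len A w"
proof -
  obtain ws where ws: "ws \<in> lists A" "length ws = len A w" "lprod ws = w"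
    using reduced_word assms by metis
  then have "ws \<in> lists S" "s \<in> carrier G"
    using assms S_carrier by auto
  then obtain us x vs where "ws = us @ x # vs" "w \<otimes> s = lprod (us @ vs)"
    using exchange[of ws s] ws assms S_carrier by blast
  then show ?thesis
    using len_le[of "us @ vs" A] ws by simp
qed

text \<open>By \<open>\<eta>_right\<close>, \<open>s\<close> is a descent of
  \<open>w \<otimes> s\<close>, so returning to \<open>w\<close> shortens the element.\<close>

lemma ascent_eq:
  assumes "A \<subseteq> S" "w \<in> generate G A" "s \<in> A" "\<not> \<eta> w s"
  shows "len A (w \<otimes> s) = Suc (len A w)"
proof -
  have s: "s \<in> S" "s \<in> carrier G" and w: "w \<in> carrier G"
    using assms S_carrier generate_carrier by auto
  have "len A (w \<otimes> s \<otimes> s) < len A (w \<otimes> s)"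
    using assms s w \<eta>_right by (intro descent_less) (auto intro: generate.eng generate.incl)
  then show ?thesis
    using len_mult_le[OF assms(1-3)] s w S_inv by (simp add: m_assoc)
qed

text \<open>If all of \<open>C\<close> descends at \<open>w\<close>, then \<open>w\<close> has an
  expression of minimal length ending in any given reduced word over \<open>C\<close>. So lengths
  over \<open>C\<close> are bounded by \<open>len A w\<close>, and only finitely many words over
  \<open>C\<close> matter.\<close>

lemma finite_generate_descents:
  assumes CA: "C \<subseteq> A" and A: "A \<subseteq> S" and "finite C" and w: "w \<in> generate G A"
    and desc: "\<And>s. s \<in> C \<Longrightarrow> \<eta> w s"
  shows "finite (generate G C)"
proof -
  have C: "C \<subseteq> S"
    using CA A by simp
  have ends: "\<exists>w'\<in>generate G A. w = w' \<otimes> lprod us \<and> len A w' + length us \<le> len A w"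
    if "us \<in> lists C" "length us = len C (lprod us)" for us
    using that
  proof (induction us rule: rev_induct)
    case Nil
    then show ?case
      using w generate_carrier[OF A] by (intro bexI[of _ w]) auto
  next
    case (snoc s us)
    have us: "us \<in> lists C" "us \<in> lists S" and s: "s \<in> C" "s \<in> S" "s \<in> carrier G"
      using snoc.prems C S_carrier by auto
    have u: "lprod us \<in> carrier G" "lprod us \<in> generate G C"
      using us lprod_closed generate_eq_lprod[OF C] by auto
    have us_s: "lprod (us @ [s]) = lprod us \<otimes> s"
      using us s by (subst lprod_append) auto
    have red: "len C (lprod us \<otimes> s) = Suc (length us)"
      using snoc.prems us_s by simp
    then have "length us = len C (lprod us)"
      using len_mult_le[OF C u(2) s(1)] len_le[OF us(1)] by simp
    then obtain w' where w': "w' \<in> generate G A" "w = w' \<otimes> lprod us" "len A w' + length us \<le> len A w"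
      using snoc.IH us by blast
    obtain vs where vs: "vs \<in> lists A" "length vs = len A w'" "lprod vs = w'"
      using reduced_word[OF A w'(1)] by metis
    have vs': "vs \<in> lists S"
      using vs A by auto
    have w_eq: "lprod (vs @ us) = w"
      using w' vs vs' us by (simp add: lprod_append del: in_lists_conv_set)
    obtain ps x qs where ex: "vs @ us = ps @ x # qs" "w \<otimes> s = lprod (ps @ qs)"
      using exchange[of "vs @ us" s] vs' us desc[OF s(1)] s w_eq by auto
    \<comment> \<open>The deleted letter cannot lie in \<open>us\<close>: cancelling
      \<open>w'\<close> would give \<open>lprod us \<otimes> s\<close> a shorter word over
      \<open>C\<close>. So it lies in the prefix, and the shortened prefix is the new
      \<open>w'\<close>.\<close>
    from ex(1) consider us1 where "us = us1 @ x # qs" "ps = vs @ us1" | vs2 where "vs = ps @ x # vs2" "qs = vs2 @ us"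
      by (auto simp: append_eq_append_conv2 append_eq_Cons_conv)
    then show ?case
    proof cases
      case 1
      then have "us1 @ qs \<in> lists C" "us1 @ qs \<in> lists S"
        using us by auto
      have "w' \<otimes> (lprod us \<otimes> s) = w' \<otimes> lprod (us1 @ qs)"
        using ex(2) w' 1 vs vs' \<open>us1 @ qs \<in> lists S\<close> u s generate_carrier[OF A]
        by (subst lprod_append[symmetric, of vs "us1 @ qs", unfolded vs(3)]) (auto simp: m_assoc)
      then have "lprod us \<otimes> s = lprod (us1 @ qs)"
        using w'(1) u s generate_carrier[OF A] lprod_closed[OF \<open>us1 @ qs \<in> lists S\<close>] by (simp add: subset_iff)
      then show ?thesis
        using red len_le[OF \<open>us1 @ qs \<in> lists C\<close>] 1 by simp
    next
      case 2
      have in_lists: "ps @ vs2 \<in> lists A" "ps @ vs2 \<in> lists S"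
        using 2 vs vs' by auto
      let ?w = "lprod (ps @ vs2)"
      have cl: "?w \<in> carrier G"
        by (rule lprod_closed[OF in_lists(2)])
      have "w \<otimes> s = ?w \<otimes> lprod us"
        using ex(2) 2 in_lists us lprod_append[of "ps @ vs2" us] by simp
      then have "w \<otimes> s \<otimes> s = ?w \<otimes> lprod us \<otimes> s"
        by simp
      then have "w = ?w \<otimes> lprod (us @ [s])"
        using us_s cl u s S_inv w generate_carrier[OF A] by (auto simp: m_assoc)
      moreover have "len A ?w + length (us @ [s]) \<le> len A w"
        using len_le[OF in_lists(1)] 2 vs w' by simp
      moreover have "?w \<in> generate G A"
        using in_lists generate_eq_lprod[OF A] by blast
      ultimately show ?thesis
        by blast
    qed
  qed
  have "generate G C \<subseteq> lprod ` {us. set us \<subseteq> C \<and> length us \<le> len A w}"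
  proof
    fix u assume "u \<in> generate G C"
    then obtain us where "us \<in> lists C" "length us = len C u" "lprod us = u"
      using reduced_word[OF C] by metis
    then show "u \<in> lprod ` {us. set us \<subseteq> C \<and> length us \<le> len A w}"
      using ends[of us] by auto
  qed
  then show ?thesis
    using finite_lists_length_le[OF \<open>finite C\<close>] by (rule finite_surj[rotated])
qed

text \<open>Lengths add at a shortest element \<open>a\<close> of a coset. If a letter of a reduced
  word over \<open>B\<close> were a descent after \<open>a\<close>, the exchange condition would
  delete a letter either of that word, against its reducedness, or of a shortest word for
  \<open>a\<close>, producing a shorter element of the coset.\<close>

lemma len_min_coset:
  assumes BA: "B \<subseteq> A" and A: "A \<subseteq> S" and a: "a \<in> generate G A"
    and min: "\<And>u. u \<in> generate G B \<Longrightarrow> len A a \<le> len A (a \<otimes> u)"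
    and u: "u \<in> generate G B"
  shows "len A (a \<otimes> u) = len A a + len B u"
proof -
  have B: "B \<subseteq> S"
    using BA A by simp
  have aG: "a \<in> carrier G"
    using a generate_carrier[OF A] by auto
  have "len A (a \<otimes> lprod us) = len A a + length us"
    if "us \<in> lists B" "length us = len B (lprod us)" for us
    using that
  proof (induction us rule: rev_induct)
    case Nil
    then show ?case
      using aG by simp
  next
    case (snoc s us)
    have us: "us \<in> lists B" "us \<in> lists S" and s: "s \<in> B" "s \<in> S" "s \<in> A" "s \<in> carrier G"
      using snoc.prems B BA S_carrier by auto
    have u: "lprod us \<in> carrier G" "lprod us \<in> generate G B" "lprod us \<in> generate G A"
      using us lprod_closed generate_eq_lprod[OF B] mono_generate[OF BA] by auto
    have us_s: "lprod (us @ [s]) = lprod us \<otimes> s"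
      using us s by (subst lprod_append) auto
    have red: "len B (lprod us \<otimes> s) = Suc (length us)"
      using snoc.prems us_s by simp
    then have "length us = len B (lprod us)"
      using len_mult_le[OF B u(2) s(1)] len_le[OF us(1)] by simp
    then have IH: "len A (a \<otimes> lprod us) = len A a + length us"
      using snoc.IH us by blast
    have "\<not> \<eta> (a \<otimes> lprod us) s"
    proof
      assume \<eta>: "\<eta> (a \<otimes> lprod us) s"
      obtain vs where vs: "vs \<in> lists A" "length vs = len A a" "lprod vs = a"
        using reduced_word[OF A a] by metis
      have vs': "vs \<in> lists S"
        using vs A by auto
      have eq: "lprod (vs @ us) = a \<otimes> lprod us"
        using vs vs' us by (simp add: lprod_append del: in_lists_conv_set)
      obtain ps x qs where ex: "vs @ us = ps @ x # qs" "a \<otimes> lprod us \<otimes> s = lprod (ps @ qs)"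
        using exchange[of "vs @ us" s] vs' us s \<eta> eq by auto
      from ex(1) consider us1 where "us = us1 @ x # qs" "ps = vs @ us1" | vs2 where "vs = ps @ x # vs2" "qs = vs2 @ us"
        by (auto simp: append_eq_append_conv2 append_eq_Cons_conv)
      then show False
      proof cases
        case 1
        then have in_lists: "us1 @ qs \<in> lists B" "us1 @ qs \<in> lists S"
          using us by auto
        have "a \<otimes> (lprod us \<otimes> s) = a \<otimes> lprod (us1 @ qs)"
          using ex(2) aG 1 vs vs' in_lists u s
          by (subst lprod_append[symmetric, of vs "us1 @ qs", unfolded vs(3)]) (auto simp: m_assoc)
        then have "lprod us \<otimes> s = lprod (us1 @ qs)"
          using aG u s lprod_closed[OF in_lists(2)] by simp
        then show ?thesis
          using red len_le[OF in_lists(1)] 1 by simp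
      next
        case 2
        have in_lists: "ps @ vs2 \<in> lists A" "ps @ vs2 \<in> lists S"
          using 2 vs vs' by auto
        let ?w = "lprod (ps @ vs2)"
        have cl: "?w \<in> carrier G"
          by (rule lprod_closed[OF in_lists(2)])
        have "a \<otimes> lprod us \<otimes> s = ?w \<otimes> lprod us"
          using ex(2) 2 in_lists us lprod_append[of "ps @ vs2" us] by simp
        then have "?w \<otimes> lprod us \<otimes> inv (lprod us) = a \<otimes> lprod us \<otimes> s \<otimes> inv (lprod us)"
          by simp
        then have "?w = a \<otimes> (lprod us \<otimes> s \<otimes> inv (lprod us))"
          using cl u s aG by (auto simp: m_assoc)
        moreover have "lprod us \<otimes> s \<otimes> inv (lprod us) \<in> generate G B"
          using u s B S_carrier by (intro generate.eng generate_m_inv_closed) (auto intro: generate.incl)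
        ultimately show ?thesis
          using min len_le[OF in_lists(1)] 2 vs by fastforce
      qed
    qed
    then have "len A (a \<otimes> lprod us \<otimes> s) = Suc (len A (a \<otimes> lprod us))"
      using a u by (intro ascent_eq[OF A _ s(3)] generate.eng)
    then show ?case
      using us_s IH aG u s by (simp add: m_assoc)
  qed
  then show ?thesis
    using reduced_word[OF B u] by metis
qed

text \<open>An element without descents in \<open>B\<close> is the unique shortest one in its coset.
  Otherwise compare it with a shortest element \<open>a\<close>: as lengths add, the last letter of
  a reduced word leading from \<open>a\<close> to \<open>w\<close> would be a descent at
  \<open>w\<close>.\<close>

lemma len_coset_greater:
  assumes BA: "B \<subseteq> A" and A: "A \<subseteq> S" and w: "w \<in> generate G A"
    and asc: "\<And>s. s \<in> B \<Longrightarrow> \<not> \<eta> w s"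
    and u: "u \<in> generate G B" "u \<noteq> \<one>"
  shows "len A w < len A (w \<otimes> u)"
proof -
  have B: "B \<subseteq> S"
    using BA A by simp
  have gens: "generate G B \<subseteq> generate G A" "generate G B \<subseteq> carrier G" "generate G A \<subseteq> carrier G"
    using mono_generate[OF BA] generate_carrier A B by auto
  obtain u0 where u0: "u0 \<in> generate G B" "\<And>u. u \<in> generate G B \<Longrightarrow> len A (w \<otimes> u0) \<le> len A (w \<otimes> u)"
    using ex_has_least_nat[of "\<lambda>u. u \<in> generate G B" \<one> "\<lambda>u. len A (w \<otimes> u)"] generate.one by metis
  let ?a = "w \<otimes> u0"
  have a: "?a \<in> generate G A"
    using w u0 gens by (auto intro: generate.eng)
  have min: "len A (?a \<otimes> v) = len A ?a + len B v" if "v \<in> generate G B" for v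
  proof (rule len_min_coset[OF BA A a _ that])
    fix v assume v: "v \<in> generate G B"
    then have "w \<otimes> u0 \<otimes> v = w \<otimes> (u0 \<otimes> v)"
      using w u0 gens by (intro m_assoc) auto
    then show "len A ?a \<le> len A (?a \<otimes> v)"
      using u0(2)[OF generate.eng[OF u0(1) v]] by simp
  qed
  define v where "v = inv u0"
  have v: "v \<in> generate G B"
    unfolding v_def using u0 B S_carrier by (intro generate_m_inv_closed) auto
  have av: "?a \<otimes> v = w"
    unfolding v_def using subsetD[OF gens(3) w] subsetD[OF gens(2) u0(1)] by (simp add: m_assoc)
  show ?thesis
  proof (cases "v = \<one>")
    case True
    then have "?a = w"
      using av a gens by auto
    then show ?thesis
      using min[OF u(1)] len_eq_0[OF B u(1)] u(2) by simp
  next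
    case False
    obtain vs where vs: "vs \<in> lists B" "length vs = len B v" "lprod vs = v"
      using reduced_word[OF B v] by metis
    with False obtain vs' r where vs': "vs = vs' @ [r]"
      by (cases vs rule: rev_cases) auto
    have r: "r \<in> B" "r \<in> S" "r \<in> carrier G" "r \<in> A" and l: "vs' \<in> lists B" "vs' \<in> lists S"
      using vs vs' B BA S_carrier by auto
    have lp: "lprod vs' \<in> generate G B" "lprod vs' \<in> carrier G"
      using l generate_eq_lprod[OF B] lprod_closed by auto
    have "v = lprod vs' \<otimes> r"
      using vs(3) vs' l r by (auto simp: lprod_append)
    then have "w \<otimes> r = ?a \<otimes> (lprod vs' \<otimes> r) \<otimes> r"
      using av by simp
    also have "\<dots> = ?a \<otimes> lprod vs'"
      using lp r subsetD[OF gens(3) a] subsetD[OF gens(3) w] subsetD[OF gens(2) u0(1)] S_inv[OF r(2)]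
      by (simp add: m_assoc)
    finally have "w \<otimes> r = ?a \<otimes> lprod vs'" .
    then have "len A (w \<otimes> r) \<le> len A ?a + length vs'"
      using min[OF lp(1)] len_le[OF l(1)] by simp
    moreover have "len A w = len A ?a + length vs"
      using min[OF v] av vs by simp
    ultimately have "len A (w \<otimes> r) < len A w"
      using vs' by simp
    then show ?thesis
      using ascent_eq[OF A w r(4) asc[OF r(1)]] by simp
  qed
qed

section \<open>Dihedral cosets and paths outside a ball\<close>

lemma gen_not_one: "s \<in> S \<Longrightarrow> s \<noteq> \<one>"
  using \<eta>_right[of s \<one>] \<eta>_one[of \<one>] S_carrier by fastforce

fun alt :: "'a \<Rightarrow> 'a \<Rightarrow> nat \<Rightarrow> 'a" where
  "alt s t 0 = \<one>"
| "alt s t (Suc k) = alt s t k \<otimes> (if even k then s else t)"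

lemma alt_even: "s \<in> carrier G \<Longrightarrow> t \<in> carrier G \<Longrightarrow> alt s t (2 * k) = (s \<otimes> t) [^] k"
  by (induction k) (auto simp: m_assoc)

lemma alt_in_generate: "alt s t k \<in> generate G {s, t}"
  by (induction k) (auto intro: generate.intros)

text \<open>A trivial odd word says that a power of \<open>s \<otimes> t\<close> equals
  \<open>s\<close>. Then \<open>s\<close> and \<open>t\<close> commute, so that power is
  \<open>\<one>\<close> or \<open>s \<otimes> t\<close>, and \<open>s\<close> or \<open>t\<close>
  would be trivial. Hence the first return of the alternating words to \<open>\<one>\<close> has
  even length.\<close>

lemma alt_odd_not_one:
  assumes "s \<in> S" "t \<in> S" "odd k"
  shows "alt s t k \<noteq> \<one>"
proof
  assume one: "alt s t k = \<one>"
  obtain i where k: "k = Suc (2 * i)"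
    using assms(3) by (metis oddE Suc_eq_plus1)
  have st: "s \<in> carrier G" "t \<in> carrier G" "s \<otimes> s = \<one>" "t \<otimes> t = \<one>"
    using assms S_carrier S_inv by auto
  let ?c = "s \<otimes> t"
  have c: "?c [^] i = s"
    using one st inv_equality[of "?c [^] i" s] by (simp add: k alt_even involution_inv)
  then have "s \<otimes> t = t \<otimes> s"
    using involution_pow_swap[OF st, of i] st by (simp add: involution_inv)
  then have "?c \<otimes> ?c = \<one>"
    using st by (metis involution_cancel_left m_assoc m_closed r_one)
  then have "?c [^] (2 * j) = \<one>" for j :: nat
    using st nat_pow_pow[of ?c 2 j] by (simp add: numeral_2_eq_2)
  then have "s = \<one> \<or> s = ?c"
    using c st by (cases "even i") (auto elim!: evenE oddE)
  then show False
    using gen_not_one[OF assms(1)] gen_not_one[OF assms(2)] st by auto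
qed

text \<open>Edges of the Cayley graph that stay outside the ball of elements of length less than
  \<open>n\<close>.\<close>

definition high :: "'a set \<Rightarrow> nat \<Rightarrow> ('a \<times> 'a) set" where
  "high A n = {(x, x \<otimes> r) | x r. x \<in> generate G A \<and> r \<in> A \<and> n \<le> len A x \<and> n \<le> len A (x \<otimes> r)}"

text \<open>The alternating words in \<open>s\<close> and \<open>t\<close> form a cycle through
  \<open>\<one>\<close>. Its translate by \<open>w\<close> leads from \<open>w \<otimes> s\<close>
  to \<open>w \<otimes> t\<close> the long way round, and as both letters ascend at
  \<open>w\<close>, every vertex on the way is longer than \<open>w\<close>.\<close>

lemma high_dihedral:
  assumes A: "A \<subseteq> S" and w: "w \<in> generate G A" and st: "s \<in> A" "t \<in> A" "\<not> \<eta> w s" "\<not> \<eta> w t"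
    and "fin_prod G s t"
  shows "(w \<otimes> s, w \<otimes> t) \<in> (high A (Suc (len A w)))\<^sup>*"
proof -
  have S: "s \<in> S" "t \<in> S" "s \<in> carrier G" "t \<in> carrier G"
    using st A S_carrier by auto
  have wG: "w \<in> carrier G"
    using w generate_carrier[OF A] by auto
  obtain n :: nat where n: "0 < n" "(s \<otimes> t) [^] n = \<one>"
    using assms(7) unfolding fin_prod_def by blast
  have "0 < 2 * n \<and> alt s t (2 * n) = \<one>"
  proof
    show "0 < 2 * n"
      using n(1) by simp
    show "alt s t (2 * n) = \<one>"
    proof -
      have "alt s t (2 * n) = (s \<otimes> t) [^] n" by (rule alt_even[OF S(3,4)])
      also have "\<dots> = \<one>" by (rule n(2))
      finally show ?thesis .
    qed
  qed
  then obtain k where k: "0 < k" "alt s t k = \<one>" and min: "\<And>j. 0 < j \<Longrightarrow> alt s t j = \<one> \<Longrightarrow> k \<le> j"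
    using ex_has_least_nat[of "\<lambda>k. 0 < k \<and> alt s t k = \<one>" "2 * n" "\<lambda>k. k"] by auto
  \<comment> \<open>Evenness makes \<open>t\<close> the last letter before the return to
    \<open>\<one>\<close>, so the word with one letter less equals \<open>t\<close>, the other
    neighbour of \<open>\<one>\<close> on the cycle.\<close>
  have "even k"
    using alt_odd_not_one[OF S(1,2)] k by blast
  then obtain j where j: "k = Suc j" "odd j"
    using k(1) by (cases k) auto
  have alt: "alt s t i \<in> carrier G" "alt s t i \<in> generate G A" for i
    using alt_in_generate[of s t i] generate_carrier[OF A] mono_generate[of "{s, t}" A] st by auto
  have "alt s t j \<otimes> t \<otimes> t = t"
    using k(2) j S by simp
  then have t: "alt s t j = t"
    using alt S S_inv[OF S(2)] by (simp add: m_assoc)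
  have above: "Suc (len A w) \<le> len A (w \<otimes> alt s t i)" if "0 < i" "i \<le> j" for i
    using len_coset_greater[of "{s, t}" A w "alt s t i"] A w st alt_in_generate[of s t i] min[of i] that j by force
  have step: "(w \<otimes> alt s t i, w \<otimes> alt s t (Suc i)) \<in> high A (Suc (len A w))" if "0 < i" "Suc i \<le> j" for i
  proof -
    let ?r = "if even i then s else t"
    have "?r \<in> A" "w \<otimes> alt s t (Suc i) = w \<otimes> alt s t i \<otimes> ?r" "w \<otimes> alt s t i \<in> generate G A"
      using st S wG w alt by (auto simp: m_assoc intro: generate.eng)
    then show ?thesis
      unfolding high_def using above[of i] above[of "Suc i"] that by auto
  qed
  have "(w \<otimes> s, w \<otimes> alt s t (Suc i)) \<in> (high A (Suc (len A w)))\<^sup>*" if "Suc i \<le> j" for i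
    using that
  proof (induction i)
    case (Suc i)
    then show ?case
      using step[of "Suc i"] by (meson Suc_leD rtrancl.rtrancl_into_rtrancl zero_less_Suc)
  qed (use S in simp)
  from this[of "j - 1"] show ?thesis
    using j t by (cases j) auto
qed

text \<open>A path among the elements of length at least \<open>n\<close> is pushed up, away from each element \<open>w\<close> of
  length exactly \<open>n\<close>: the generators ascending at \<open>w\<close> are connected because the descending ones
  generate a finite subgroup.\<close>

lemma high_connected:
  assumes A: "A \<subseteq> S" "finite A" and "unsplit G A"
    and "x \<in> generate G A" "y \<in> generate G A" "n \<le> len A x" "n \<le> len A y"
  shows "(x, y) \<in> (high A n)\<^sup>*"
  using assms(4-)
proof (induction n arbitrary: x y)
  case 0
  have "(x, x \<otimes> lprod ws) \<in> (high A 0)\<^sup>*" if "x \<in> generate G A" "ws \<in> lists A" for x ws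
    using that(2,1)
  proof (induction ws arbitrary: x rule: lists.induct)
    case Nil
    then show ?case
      using generate_carrier[OF A(1)] by auto
  next
    case (Cons r ws)
    have "(x, x \<otimes> r) \<in> high A 0"
      unfolding high_def using Cons by auto
    moreover have "x \<otimes> r \<in> generate G A"
      using Cons by (auto intro: generate.intros)
    then have "(x \<otimes> r, x \<otimes> r \<otimes> lprod ws) \<in> (high A 0)\<^sup>*"
      using Cons.IH by blast
    moreover have "x \<otimes> r \<otimes> lprod ws = x \<otimes> lprod (r # ws)"
    proof -
      have "lprod ws \<in> carrier G" "r \<in> carrier G" "x \<in> carrier G"
        using Cons A S_carrier generate_carrier[OF A(1)] by (auto intro!: lprod_closed)
      then show ?thesis
        by (simp add: m_assoc)
    qed
    ultimately show ?case
      by (metis converse_rtrancl_into_rtrancl)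
  qed
  moreover have xy: "x \<in> carrier G" "y \<in> carrier G"
    using 0 generate_carrier[OF A(1)] by auto
  have "inv x \<otimes> y \<in> generate G A"
    using 0 A S_carrier by (intro generate.eng generate_m_inv_closed) auto
  then obtain ws where "ws \<in> lists A" "inv x \<otimes> y = lprod ws"
    using generate_eq_lprod[OF A(1)] by auto
  ultimately show ?case
    using 0(1) xy by (metis inv_cancel_left(2))
next
  case (Suc n)
  have swap: "(w \<otimes> s, w \<otimes> t) \<in> (high A (Suc n))\<^sup>*"
    if w: "w \<in> generate G A" "len A w = n" and st: "s \<in> A" "t \<in> A" "\<not> \<eta> w s" "\<not> \<eta> w t" for w s t
  proof -
    let ?C = "{r \<in> A. \<eta> w r}"
    have "finite (generate G ?C)"
      using A w by (intro finite_generate_descents[of ?C A w]) auto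
    then have "(s, t) \<in> {(a, b). a \<in> A - ?C \<and> b \<in> A - ?C \<and> fin_prod G a b}\<^sup>*"
      using st by (intro unsplitD[OF assms(3)]) auto
    then show ?thesis
    proof (induction rule: rtrancl_induct)
      case (step y z)
      then have "(w \<otimes> y, w \<otimes> z) \<in> (high A (Suc n))\<^sup>*"
        using high_dihedral[OF A(1) w(1), of y z] w(2) by auto
      then show ?case
        using step.IH by simp
    qed simp
  qed
  have xy: "n \<le> len A x" "n \<le> len A y"
    using Suc.prems by auto
  \<comment> \<open>A vertex of length exactly \<open>n\<close> is missing from the smaller graph.
    Along the path the invariant replaces it by all its ascending neighbours, which
    \<open>swap\<close> connects to one another.\<close>
  from Suc.IH[OF Suc.prems(1,2) this]
  have "(Suc n \<le> len A y \<longrightarrow> (x, y) \<in> (high A (Suc n))\<^sup>*) \<and>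
    (len A y = n \<longrightarrow> (\<forall>s\<in>A. \<not> \<eta> y s \<longrightarrow> (x, y \<otimes> s) \<in> (high A (Suc n))\<^sup>*))"
  proof (induction rule: rtrancl_induct)
    case base
    then show ?case
      using Suc.prems by auto
  next
    case (step y z)
    then obtain r where r: "y \<in> generate G A" "r \<in> A" "z = y \<otimes> r" "n \<le> len A y" "n \<le> len A z"
      by (auto simp: high_def)
    have zG: "z \<in> generate G A" "y \<in> carrier G" "r \<in> S" "r \<in> carrier G"
      using r A S_carrier generate_carrier[OF A(1)] by (auto intro: generate.intros)
    have y: "y = z \<otimes> r"
      using r zG S_inv[OF zG(3)] by (simp add: m_assoc)
    consider "Suc n \<le> len A y" "Suc n \<le> len A z" | "Suc n \<le> len A y" "len A z = n" | "len A y = n"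
      using r by linarith
    then show ?case
    proof cases
      case 1
      then have "(y, z) \<in> high A (Suc n)"
        using r by (auto simp: high_def)
      then show ?thesis
        using 1 step.IH by (auto intro: rtrancl_into_rtrancl)
    next
      case 2
      have "\<not> \<eta> z r"
        using descent_less[OF A(1) zG(1) r(2)] 2 y by auto
      then show ?thesis
        using 2 step.IH y swap[OF zG(1) 2(2) r(2)] by (auto intro: rtrancl_trans)
    next
      case 3
      have "\<not> \<eta> y r"
        using descent_less[OF A(1) r(1,2)] 3 r by auto
      then show ?thesis
        using 3 step.IH r ascent_eq[OF A(1) r(1,2)] by auto
    qed
  qed
  then show ?case
    using Suc.prems by blast
qed

text \<open>\<open>num_ends\<close> is a supremum over all finite \<open>K\<close>; the value is
  shown to be 1 for each \<open>K\<close> separately. The elements outside a large ball form one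
  connected set, and it is infinite because the ball is finite.\<close>

lemma one_ended_unsplit:
  assumes A: "A \<subseteq> S" "finite A" and "unsplit G A" and inf: "infinite (generate G A)"
  shows "one_ended (subgroup_generated G A)"
proof -
  let ?H = "subgroup_generated G A"
  let ?D = "cayley_graph ?H A"
  have AG: "A \<subseteq> carrier G"
    using A S_carrier by auto
  have car: "carrier ?H = generate G A"
    using AG by (simp add: carrier_subgroup_generated Int_absorb1)
  interpret H: group ?H
    by (rule group_subgroup_generated)
  have "m_inv ?H r = r" if "r \<in> A" for r
  proof -
    have "r \<in> carrier ?H" "r \<otimes> r = \<one>"
      using that A S_inv car by (auto intro: generate.incl)
    then show ?thesis
      by (intro H.involution_inv) auto
  qed
  then have gens: "A \<union> m_inv ?H ` A = A"
    by auto
  have gen_H: "generate ?H A = carrier ?H"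
    using car generate_consistent[of A "generate G A"] AG
    by (metis carrier_subgroup_generated generate.incl generate_is_subgroup subgroup_generated_def subsetI Int_absorb1)
  have verts: "verts ?D = generate G A"
    by (simp add: cayley_graph_def car)
  have adj: "arcs_ends (?D \<restriction> (verts ?D - K)) = {(x, x \<otimes> r) | x r. r \<in> A \<and> x \<in> generate G A - K \<and> x \<otimes> r \<in> generate G A - K}" for K
    unfolding arcs_ends_def induce_subgraph_def arc_to_ends_def gens verts
    by (auto simp: cayley_graph_def car gens image_iff) blast
  have comps: "card {C \<in> pre_digraph.sccs_verts (?D \<restriction> (verts ?D - K)). infinite C} = 1"
    if K: "finite K" "K \<subseteq> verts ?D" for K
  proof -
    let ?DK = "?D \<restriction> (verts ?D - K)"
    have vK: "verts ?DK = generate G A - K"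
      by (simp add: induce_subgraph_def verts)
    \<comment> \<open>Strictly above all lengths in \<open>K\<close>, so that the elements of length
      at least \<open>n\<close> all survive the removal of \<open>K\<close>.\<close>
    obtain n where n: "\<And>x. x \<in> K \<Longrightarrow> len A x < n"
      using finite_nat_set_iff_bounded[of "len A ` K"] K(1) by auto
    let ?U = "{x \<in> generate G A. n \<le> len A x}"
    have UK: "?U \<subseteq> generate G A - K"
      using n by force
    have small: "finite {x \<in> generate G A. len A x < n}"
    proof (rule finite_subset)
      show "{x \<in> generate G A. len A x < n} \<subseteq> lprod ` {ws. set ws \<subseteq> A \<and> length ws \<le> n}"
      proof
        fix x assume "x \<in> {x \<in> generate G A. len A x < n}"
        then obtain ws where "ws \<in> lists A" "length ws = len A x" "lprod ws = x" "len A x < n"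
          using reduced_word[OF A(1)] by (metis (no_types, lifting) mem_Collect_eq)
        then show "x \<in> lprod ` {ws. set ws \<subseteq> A \<and> length ws \<le> n}"
          by (intro image_eqI[of _ _ ws]) auto
      qed
      show "finite (lprod ` {ws. set ws \<subseteq> A \<and> length ws \<le> n})"
        using finite_lists_length_le[OF A(2)] by blast
    qed
    have U: "infinite ?U"
    proof
      assume "finite ?U"
      then have "finite (?U \<union> {x \<in> generate G A. len A x < n})"
        using small by blast
      moreover have "generate G A \<subseteq> ?U \<union> {x \<in> generate G A. len A x < n}"
        by auto
      ultimately show False
        using inf finite_subset by blast
    qed
    have reach: "reachable ?DK x y" if "x \<in> ?U" "y \<in> ?U" for x y
    proof -
      have "(x, y) \<in> (high A n)\<^sup>*"
        using high_connected[OF A assms(3)] that by blast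
      then show ?thesis
        unfolding reachable_def
      proof (induction rule: rtrancl_induct)
        case base
        then show ?case
          using that UK vK by (intro rtrancl_on_refl) blast
      next
        case (step y z)
        then obtain r where r: "y \<in> generate G A" "r \<in> A" "z = y \<otimes> r" "n \<le> len A y" "n \<le> len A z"
          by (auto simp: high_def)
        then have "z \<in> generate G A"
          by (auto intro: generate.intros)
        then have "(y, z) \<in> arcs_ends ?DK" "z \<in> verts ?DK"
          unfolding adj vK using r UK by blast+
        then show ?case
          using step.IH by (rule_tac rtrancl_on_into_rtrancl_on)
      qed
    qed
    obtain u where u: "u \<in> ?U"
      using U by (metis finite.emptyI equals0I)
    define C where "C = {x. reachable ?DK u x \<and> reachable ?DK x u}"
    have rtrans: "reachable ?DK x z" if "reachable ?DK x y" "reachable ?DK y z" for x y z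
      using that unfolding reachable_def by (rule rtrancl_on_trans)
    have UC: "?U \<subseteq> C"
      using reach u by (auto simp: C_def)
    have C: "C \<in> pre_digraph.sccs_verts ?DK"
      unfolding pre_digraph.sccs_verts_def C_def using reach[OF u u] rtrans by blast
    \<comment> \<open>An infinite component cannot fit into the finite ball, so it meets the
      connected set outside.\<close>
    have "C' = C" if C': "C' \<in> pre_digraph.sccs_verts ?DK" "infinite C'" for C'
    proof -
      have "C' \<subseteq> generate G A"
      proof
        fix x assume "x \<in> C'"
        then have "reachable ?DK x x"
          using C' unfolding pre_digraph.sccs_verts_def by blast
        then have "x \<in> verts ?DK"
          unfolding reachable_def by (rule in_rtrancl_on_in_F)
        then show "x \<in> generate G A"
          using vK by blast
      qed
      then obtain x where x: "x \<in> C'" "x \<in> ?U"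
        using C'(2) small by (metis (mono_tags, lifting) finite_subset linorder_not_le mem_Collect_eq subset_iff)
      have "y \<in> C' \<longleftrightarrow> reachable ?DK x y \<and> reachable ?DK y x" for y
        using C'(1) x(1) unfolding pre_digraph.sccs_verts_def by blast
      moreover have "y \<in> C \<longleftrightarrow> reachable ?DK x y \<and> reachable ?DK y x" for y
        using reach[OF u x(2)] reach[OF x(2) u] rtrans unfolding C_def by blast
      ultimately show ?thesis
        by blast
    qed
    moreover have "infinite C"
      using UC U finite_subset by blast
    ultimately have "{C \<in> pre_digraph.sccs_verts ?DK. infinite C} = {C}"
      using C by blast
    then show ?thesis
      by simp
  qed
  have "num_ends ?D = 1"
  proof -
    have "(let \<C> = {C \<in> pre_digraph.sccs_verts (?D \<restriction> (verts ?D - K)). infinite C}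
        in if finite \<C> then enat (card \<C>) else \<infinity>) = 1"
      if "K \<in> {K. finite K \<and> K \<subseteq> verts ?D}" for K
    proof -
      let ?\<C> = "{C \<in> pre_digraph.sccs_verts (?D \<restriction> (verts ?D - K)). infinite C}"
      have "card ?\<C> = 1"
        using that by (intro comps) simp_all
      moreover from this have "finite ?\<C>"
        by (intro card_ge_0_finite) simp
      ultimately show ?thesis
        by (simp add: Let_def one_enat_def)
    qed
    then have "num_ends ?D = (SUP K\<in>{K. finite K \<and> K \<subseteq> verts ?D}. 1)"
      unfolding num_ends_def by (intro SUP_cong) auto
    also have "\<dots> = 1"
      by (rule cSUP_const) auto
    finally show ?thesis .
  qed
  moreover have "A \<subseteq> carrier ?H"
    using car by (auto intro: generate.incl)
  ultimately show ?thesis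
    unfolding one_ended_def using A(2) gen_H by (intro exI[of _ A] conjI)
qed

end

section \<open>Fixed points on trees\<close>

text \<open>A group acting without inversions on a connected graph in which every edge separates its
  ends, that is, on a tree: \<open>P x\<close> collects the arcs that separate \<open>x\<close> from a base point.\<close>

locale tree_action = group G for G :: "'a monoid" (structure) +
  fixes V :: "'x set" and E :: "'y set" and src tgt :: "'y \<Rightarrow> 'x" and bar :: "'y \<Rightarrow> 'y"
    and av :: "'a \<Rightarrow> 'x \<Rightarrow> 'x" and ae :: "'a \<Rightarrow> 'y \<Rightarrow> 'y" and P :: "'x \<Rightarrow> 'y set"
  assumes V_nonempty: "V \<noteq> {}"
    and src_V: "e \<in> E \<Longrightarrow> src e \<in> V"
    and bar_E: "e \<in> E \<Longrightarrow> bar e \<in> E"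
    and src_bar: "e \<in> E \<Longrightarrow> src (bar e) = tgt e"
    and bar_bar: "e \<in> E \<Longrightarrow> bar (bar e) = e"
    and av_V: "g \<in> carrier G \<Longrightarrow> x \<in> V \<Longrightarrow> av g x \<in> V"
    and av_mult: "g \<in> carrier G \<Longrightarrow> h \<in> carrier G \<Longrightarrow> x \<in> V \<Longrightarrow> av (g \<otimes> h) x = av g (av h x)"
    and av_one: "x \<in> V \<Longrightarrow> av \<one> x = x"
    and ae_E: "g \<in> carrier G \<Longrightarrow> e \<in> E \<Longrightarrow> ae g e \<in> E"
    and ae_mult: "g \<in> carrier G \<Longrightarrow> h \<in> carrier G \<Longrightarrow> e \<in> E \<Longrightarrow> ae (g \<otimes> h) e = ae g (ae h e)"
    and ae_one: "e \<in> E \<Longrightarrow> ae \<one> e = e"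
    and src_ae: "g \<in> carrier G \<Longrightarrow> e \<in> E \<Longrightarrow> src (ae g e) = av g (src e)"
    and bar_ae: "g \<in> carrier G \<Longrightarrow> e \<in> E \<Longrightarrow> bar (ae g e) = ae g (bar e)"
    and no_inversion: "g \<in> carrier G \<Longrightarrow> e \<in> E \<Longrightarrow> ae g e \<noteq> bar e"
    and P_tgt: "e \<in> E \<Longrightarrow> d \<in> E \<Longrightarrow> d \<in> P (tgt e) \<longleftrightarrow> (d \<in> P (src e)) \<noteq> (d = e \<or> d = bar e)"
    and P_act: "g \<in> carrier G \<Longrightarrow> d \<in> E \<Longrightarrow> x \<in> V \<Longrightarrow> y \<in> V \<Longrightarrow>
      (ae g d \<in> P (av g x)) = (ae g d \<in> P (av g y)) \<longleftrightarrow> (d \<in> P x) = (d \<in> P y)"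
    and connected: "x \<in> V \<Longrightarrow> y \<in> V \<Longrightarrow> (x, y) \<in> {(src e, tgt e) | e. e \<in> E}\<^sup>*"
begin

text \<open>\<open>P\<close> refers to a base point, and its equivariance \<open>P_act\<close> is
  assumed only for the comparison of two vertices. In \<open>sep\<close> the base point
  cancels.\<close>

definition sep :: "'y \<Rightarrow> 'x \<Rightarrow> 'x \<Rightarrow> bool" where
  "sep e x y \<longleftrightarrow> (e \<in> P x) \<noteq> (e \<in> P y)"

lemma tgt_bar: "e \<in> E \<Longrightarrow> tgt (bar e) = src e"
  using src_bar[OF bar_E] bar_bar by fastforce

lemma tgt_V: "e \<in> E \<Longrightarrow> tgt e \<in> V"
  using src_V[OF bar_E] src_bar by fastforce

lemma tgt_ae: "g \<in> carrier G \<Longrightarrow> e \<in> E \<Longrightarrow> tgt (ae g e) = av g (tgt e)"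
  by (metis ae_E bar_E bar_ae src_ae src_bar)

lemma sep_arc: "e \<in> E \<Longrightarrow> d \<in> E \<Longrightarrow> sep d (src e) (tgt e) \<longleftrightarrow> d = e \<or> d = bar e"
  using P_tgt unfolding sep_def by blast

lemma sep_same [simp]: "\<not> sep e x x"
  by (simp add: sep_def)

lemma sep_sym: "sep e x y \<longleftrightarrow> sep e y x"
  by (auto simp: sep_def)

lemma sep_trans: "sep e x z \<longleftrightarrow> sep e x y \<noteq> sep e y z"
  by (auto simp: sep_def)

lemma sep_act: "g \<in> carrier G \<Longrightarrow> d \<in> E \<Longrightarrow> x \<in> V \<Longrightarrow> y \<in> V \<Longrightarrow> sep (ae g d) (av g x) (av g y) \<longleftrightarrow> sep d x y"
  using P_act unfolding sep_def by blast

lemma sep_bar: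
  assumes "e \<in> E" "x \<in> V" "y \<in> V"
  shows "sep (bar e) x y \<longleftrightarrow> sep e x y"
  using connected[OF assms(2,3)]
proof (induction rule: rtrancl_induct)
  case (step y z)
  then obtain d where d: "d \<in> E" "y = src d" "z = tgt d"
    by auto
  then have "sep (bar e) y z \<longleftrightarrow> sep e y z"
    using sep_arc[OF d(1)] bar_E[OF assms(1)] assms(1) bar_bar by (metis d(2) d(3))
  then show ?case
    using step.IH sep_trans[of _ x z y] by blast
qed simp

lemma finite_sep:
  assumes "x \<in> V" "y \<in> V"
  shows "finite {e \<in> E. sep e x y}"
  using connected[OF assms]
proof (induction rule: rtrancl_induct)
  case (step y z)
  then obtain d where d: "d \<in> E" "y = src d" "z = tgt d"
    by auto
  have "{e \<in> E. sep e x z} \<subseteq> {e \<in> E. sep e x y} \<union> {d, bar d}"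
    using sep_arc[OF d(1)] sep_trans[of _ x z y] d by blast
  then show ?case
    using step.IH by (meson finite.emptyI finite.insertI finite_UnI finite_subset)
qed simp

text \<open>An arc leaving \<open>x\<close> can change its status only when the path passes through
  \<open>x\<close> again. The arc taken at the last departure from \<open>x\<close> therefore
  separates.\<close>

lemma first_arc:
  assumes "x \<in> V" "y \<in> V" "x \<noteq> y"
  shows "\<exists>e\<in>E. src e = x \<and> sep e x y"
  using connected[OF assms(1,2)] assms(3)
proof (induction rule: rtrancl_induct)
  case (step y z)
  then obtain d where d: "d \<in> E" "y = src d" "z = tgt d"
    by auto
  show ?case
  proof (cases "x = y")
    case True
    then show ?thesis
      using d sep_arc[OF d(1) d(1)] by auto
  next
    case False
    then obtain e where e: "e \<in> E" "src e = x" "sep e x y"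
      using step.IH by blast
    have "e \<noteq> d" "e \<noteq> bar d"
      using e d False step.prems src_bar by auto
    then have "\<not> sep e y z"
      using sep_arc[OF d(1) e(1)] d by simp
    then show ?thesis
      using e sep_trans[of e x z y] by blast
  qed
qed simp

text \<open>After its last passage over \<open>e\<close> a path from \<open>src e\<close> avoids
  \<open>e\<close>, starting from one of the two ends. The end \<open>tgt e\<close> is excluded
  because paths avoiding \<open>e\<close> do not change sides.\<close>

lemma side_connected:
  assumes e: "e \<in> E" and x: "x \<in> V" "\<not> sep e (src e) x"
  shows "(src e, x) \<in> {(src d, tgt d) | d. d \<in> E \<and> d \<noteq> e \<and> d \<noteq> bar e}\<^sup>*" (is "_ \<in> ?R\<^sup>*")
proof -
  have keep: "\<not> sep e y z" if "(y, z) \<in> ?R\<^sup>*" for y z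
    using that
  proof (induction rule: rtrancl_induct)
    case (step z w)
    then show ?case
      using sep_arc[OF _ e] bar_bar sep_trans[of e y w z] by force
  qed simp
  have "(src e, x) \<in> ?R\<^sup>* \<or> (tgt e, x) \<in> ?R\<^sup>*"
    using connected[OF src_V[OF e] x(1)]
  proof (induction rule: rtrancl_induct)
    case (step y z)
    then obtain d where d: "d \<in> E" "y = src d" "z = tgt d"
      by auto
    show ?case
    proof (cases "d = e \<or> d = bar e")
      case True
      then show ?thesis
        using d tgt_bar[OF e] by auto
    next
      case False
      then have "(y, z) \<in> ?R"
        using d by auto
      then show ?thesis
        using step.IH by (meson rtrancl.rtrancl_into_rtrancl)
    qed
  qed simp
  then show ?thesis
    using keep[of "tgt e" x] sep_trans[of e "src e" x "tgt e"] sep_arc[OF e e] x(2) by blast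
qed

text \<open>Two disjoint half-trees. A path from \<open>src e\<close> on its own side of
  \<open>e\<close> meets neither end of \<open>d\<close>, so it never crosses \<open>d\<close> and
  cannot reach the side of \<open>tgt d\<close>.\<close>

lemma sides_nested:
  assumes e: "e \<in> E" and d: "d \<in> E"
    and d_far: "sep e (src e) (src d)" "sep e (src e) (tgt d)"
    and e_near: "sep d (src e) (tgt d)"
    and x: "x \<in> V" "\<not> sep d (tgt d) x"
  shows "sep e (src e) x"
proof (rule ccontr)
  let ?R = "{(src d, tgt d) | d. d \<in> E \<and> d \<noteq> e \<and> d \<noteq> bar e}"
  assume "\<not> sep e (src e) x"
  then have "(src e, x) \<in> ?R\<^sup>*"
    using side_connected e x(1) by blast
  then have "\<not> sep e (src e) x \<and> \<not> sep d (src e) x"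
  proof (induction rule: rtrancl_induct)
    case (step y z)
    then obtain c where c: "c \<in> E" "y = src c" "z = tgt c" "c \<noteq> e" "c \<noteq> bar e"
      by auto
    have "\<not> sep e y z"
      using sep_arc[OF c(1) e] c bar_bar e by metis
    then have z: "\<not> sep e (src e) z"
      using step.IH sep_trans[of e "src e" z y] by blast
    have "c \<noteq> d" "c \<noteq> bar d"
      using step.IH d_far c src_bar[OF d] by auto
    then have "\<not> sep d y z"
      using sep_arc[OF c(1) d] c bar_bar by metis
    then show ?case
      using z step.IH sep_trans[of d "src e" z y] by blast
  qed simp
  then show False
    using e_near x(2) sep_trans[of d "src e" "tgt d" x] sep_sym by blast
qed

text \<open>If \<open>r\<close> moves \<open>src e\<close> across \<open>e\<close>, it moves the
  whole half-tree at \<open>src e\<close> across; in particular \<open>r\<close> has no fixed point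
  there. Its image is the half-tree of \<open>d = ae r e\<close> at \<open>src d\<close>, and both
  ends of \<open>d\<close> lie beyond \<open>e\<close>, so nesting applies unless
  \<open>src e\<close> lies in the image.\<close>

lemma involution_side:
  assumes e: "e \<in> E" and r: "r \<in> carrier G" "r \<otimes> r = \<one>" "ae r e \<noteq> e"
    and far: "sep e (src e) (av r (src e))"
    and x: "x \<in> V" "\<not> sep e (src e) x"
  shows "sep e (src e) (av r x)"
proof -
  define d where "d = ae r e"
  have d: "d \<in> E" "d \<noteq> e" "d \<noteq> bar e" "src d = av r (src e)" "tgt d = av r (tgt e)"
    using e r no_inversion by (auto simp: d_def ae_E src_ae tgt_ae)
  have V: "src e \<in> V" "tgt e \<in> V" "av r (src e) \<in> V" "av r (tgt e) \<in> V" "av r x \<in> V"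
    using e r x by (auto simp: src_V tgt_V av_V)
  have rr: "av r (av r y) = y" if "y \<in> V" for y
    using av_mult[OF r(1,1) that] r(2) av_one[OF that] by simp
  have "\<not> sep e (src d) (tgt d)"
    using sep_arc[OF d(1) e] d bar_bar[OF d(1)] by metis
  then have d_far: "sep e (src e) (src d)" "sep e (src e) (tgt d)"
    using far d sep_trans[of e "src e" "tgt d" "src d"] by auto
  have dx: "\<not> sep d (src d) (av r x)"
    using x sep_act[OF r(1) e V(1) x(1)] d(4) by (simp add: d_def)
  show ?thesis
  proof (cases "sep d (src e) (src d)")
    case True
    then show ?thesis
      using sides_nested[OF e bar_E[OF d(1)], of "av r x"] d_far dx V d sep_bar[OF d(1)] src_bar[OF d(1)] tgt_bar[OF d(1)]
      by simp
  next
    case False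
    then have "sep d (src e) (tgt d)"
      using sep_arc[OF d(1) d(1)] sep_trans[of d "src e" "tgt d" "src d"] by blast
    note nested = sides_nested[OF e d(1) d_far this]
    have "\<not> sep d (tgt d) (av r (tgt d))"
    proof -
      have "tgt d = av r (tgt e)" "av r (tgt d) = tgt e"
        using d rr V by auto
      moreover have "\<not> sep d (tgt e) (tgt d)"
      proof -
        have "sep e (src e) (tgt d)" "\<not> sep e (tgt e) (tgt d)"
          using d_far sep_trans[of e "src e" "tgt d" "tgt e"] sep_arc[OF e e] by blast+
        then have "\<not> sep d (av r (tgt e)) (av r (tgt d))"
          using sep_act[OF r(1) e V(2), of "tgt d"] tgt_V[OF d(1)] by (simp add: d_def)
        then show ?thesis
          using d rr V sep_sym by metis
      qed
      ultimately show ?thesis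
        using sep_sym by metis
    qed
    \<comment> \<open>Here \<open>r \<otimes> r = \<one>\<close> is decisive: \<open>src d\<close>
      lies on the side of \<open>tgt e\<close>, and applying \<open>r\<close> returns it to
      \<open>src e\<close>, which thus lies on the side of \<open>tgt d\<close>. Nesting would put
      \<open>src e\<close> beyond \<open>e\<close>.\<close>
    have "\<not> sep e (tgt e) (src d)"
      using d_far sep_trans[of e "src e" "src d" "tgt e"] sep_arc[OF e e] by blast
    then have "\<not> sep d (tgt d) (src e)"
      using sep_act[OF r(1) e V(2), of "src d"] src_V[OF d(1)] d rr V by (metis d_def)
    then have "sep e (src e) (src e)"
      using nested[OF V(1)] by blast
    then show ?thesis
      by simp
  qed
qed

text \<open>Ping-pong. If \<open>t\<close> behaved differently from \<open>r\<close>, it would carry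
  the far side of \<open>e\<close> to the near side while \<open>r\<close> carries the near side to
  the far side. Then \<open>r \<otimes> t\<close> maps the far side into itself, and its powers can
  return to \<open>\<one>\<close> only by contradicting the rule for \<open>t\<close>.\<close>

lemma fin_prod_same_side:
  assumes e: "e \<in> E" and r: "r \<in> carrier G" "r \<otimes> r = \<one>" "ae r e \<noteq> e"
    and t: "t \<in> carrier G" "t \<otimes> t = \<one>" "ae t e \<noteq> e"
    and "fin_prod G r t" and far: "sep e (src e) (av r (src e))"
  shows "sep e (src e) (av t (src e))"
proof (rule ccontr)
  assume near: "\<not> sep e (src e) (av t (src e))"
  let ?c = "r \<otimes> t"
  have V: "src e \<in> V" "tgt e \<in> V"
    using e by (auto simp: src_V tgt_V)
  have ee: "sep e (src e) (tgt e)"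
    using sep_arc[OF e e] by simp
  have be: "src (bar e) = tgt e" "ae t (bar e) \<noteq> bar e"
    using src_bar[OF e] t e bar_ae bar_bar ae_E by metis+
  have te: "ae t e \<in> E" "ae t e \<noteq> bar e" "ae t e \<noteq> e" "bar (ae t e) \<noteq> e"
    using e t no_inversion ae_E bar_bar by metis+
  have "\<not> sep e (av t (src e)) (av t (tgt e))"
    using sep_arc[OF te(1) e] te e t by (auto simp: src_ae tgt_ae)
  \<comment> \<open>Seen from the reversed arc, \<open>t\<close> moves the start across, so
    \<open>involution_side\<close> applies to \<open>bar e\<close>.\<close>
  then have bfar: "sep (bar e) (src (bar e)) (av t (src (bar e)))"
    using near ee V e t be sep_bar[OF e V(2), of "av t (tgt e)"] av_V[OF t(1)]
      sep_trans[of e "src e" "tgt e" "av t (src e)"] sep_trans[of e "tgt e" "av t (tgt e)" "av t (src e)"]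
      sep_sym by metis
  have t_side: "\<not> sep e (src e) (av t x)" if "x \<in> V" "sep e (src e) x" for x
  proof -
    have "\<not> sep (bar e) (src (bar e)) x"
      using that ee sep_trans[of e "src e" x "tgt e"] be sep_bar[OF e V(2) that(1)] by simp
    then have "sep (bar e) (src (bar e)) (av t x)"
      using involution_side[OF bar_E[OF e] t(1,2) be(2) bfar that(1)] by blast
    then show ?thesis
      using ee sep_trans[of e "src e" "av t x" "tgt e"] be sep_bar[OF e V(2) av_V[OF t(1) that(1)]] by simp
  qed
  have c: "?c \<in> carrier G"
    using r t by simp
  have c_av: "av ?c x = av r (av t x)" if "x \<in> V" for x
    using av_mult r t that by blast
  have c_side: "sep e (src e) (av ?c x)" if "x \<in> V" "sep e (src e) x" for x
    using c_av[OF that(1)] t_side[OF that] involution_side[OF e r far av_V[OF t(1) that(1)]] by simp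
  have pow: "sep e (src e) (av (?c [^] n) x)" if "x \<in> V" "sep e (src e) x" for n :: nat and x
    using that(2)
  proof (induction n)
    case (Suc n)
    then have "sep e (src e) (av ?c (av (?c [^] n) x))"
      using c_side av_V c that(1) by (meson nat_pow_closed)
    then show ?case
      using c av_mult[of ?c "?c [^] n" x] that(1) nat_pow_Suc2[OF c, of n] by (simp del: nat_pow_Suc)
  qed (simp add: av_one that)
  \<comment> \<open>Chosen so that closing the orbit of \<open>z\<close> under
    \<open>r \<otimes> t\<close> and cancelling \<open>r\<close> yields a far point \<open>y\<close>
    with \<open>av t y = tgt e\<close>, which is far again.\<close>
  define z where "z = av r (tgt e)"
  have z: "z \<in> V" "sep e (src e) z"
  proof -
    have re: "ae r e \<in> E" "ae r e \<noteq> bar e" "ae r e \<noteq> e" "bar (ae r e) \<noteq> e"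
      using e r no_inversion ae_E bar_bar by metis+
    then have "\<not> sep e (av r (src e)) (av r (tgt e))"
      using sep_arc[OF re(1) e] e r by (auto simp: src_ae tgt_ae)
    then show "sep e (src e) z"
      using far sep_trans[of e "src e" z "av r (src e)"] by (simp add: z_def)
    show "z \<in> V"
      using V r by (simp add: z_def av_V)
  qed
  obtain n :: nat where n: "0 < n" "?c [^] n = \<one>"
    using assms(8) unfolding fin_prod_def by blast
  then obtain k where k: "n = Suc k"
    by (cases n) auto
  define y where "y = av (?c [^] k) z"
  have y: "y \<in> V" "sep e (src e) y"
    using z pow c by (auto simp: y_def av_V)
  have "av r (av t y) = av ?c y"
    using c_av[OF y(1)] by simp
  also have "\<dots> = av (?c [^] n) z"
    using av_mult[of ?c "?c [^] k" z] c z k nat_pow_Suc2[OF c, of k] by (simp add: y_def del: nat_pow_Suc)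
  also have "\<dots> = z"
    using n z av_one by simp
  finally have "av r (av r (av t y)) = av r z"
    by simp
  then have "av t y = tgt e"
    using av_mult[OF r(1,1)] r(2) av_one av_V r t y V by (metis z_def)
  then show False
    using t_side[OF y] ee by simp
qed

theorem unsplit_fixes_vertex:
  assumes A: "finite A" "A \<subseteq> carrier G" "\<And>s. s \<in> A \<Longrightarrow> s \<otimes> s = \<one>" and "unsplit G A"
    and stab: "\<And>e. e \<in> E \<Longrightarrow> finite {g \<in> carrier G. ae g e = e}"
  shows "\<exists>x\<in>V. \<forall>s\<in>A. av s x = x"
proof -
  \<comment> \<open>Both orientations of an edge are counted, so each summand is twice the distance
    from \<open>x\<close> to \<open>av s x\<close>.\<close>
  define f where "f x = (\<Sum>s\<in>A. card {e \<in> E. sep e x (av s x)})" for x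
  obtain x where x: "x \<in> V" and min: "\<And>y. y \<in> V \<Longrightarrow> f x \<le> f y"
    using ex_has_least_nat[of "\<lambda>x. x \<in> V" _ f] V_nonempty by (metis all_not_in_conv)
  have "av s x = x" if s: "s \<in> A" for s
  proof (rule ccontr)
    assume sx: "av s x \<noteq> x"
    obtain e where e: "e \<in> E" "src e = x" "sep e x (av s x)"
      using first_arc[of x "av s x"] sx x av_V s A by (metis subsetD)
    let ?y = "tgt e"
    have y: "?y \<in> V"
      using e by (simp add: tgt_V)
    let ?C = "{r \<in> A. ae r e = e}"
    have "generate G ?C \<subseteq> {g \<in> carrier G. ae g e = e}"
    proof
      fix g assume "g \<in> generate G ?C"
      then show "g \<in> {g \<in> carrier G. ae g e = e}"
      proof (induction rule: generate.induct)
        case one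
        show ?case
          using ae_one e by simp
      next
        case (incl h)
        then show ?case
          using A by auto
      next
        case (inv h)
        then have "inv h = h"
          using A by (intro involution_inv) auto
        then show ?case
          using inv A by auto
      next
        case (eng g h)
        then show ?case
          using ae_mult e by simp
      qed
    qed
    then have "finite (generate G ?C)"
      using stab[OF e(1)] finite_subset by blast
    note conn = unsplitD[OF assms(4) _ this]
    \<comment> \<open>Crossing \<open>e\<close> is passed from \<open>s\<close> to every generator
      of \<open>A\<close> moving \<open>e\<close>, along pairs with product of finite order.\<close>
    have far: "sep e x (av r x)" if r: "r \<in> A" "ae r e \<noteq> e" for r
    proof -
      have "ae s e \<noteq> e"
        using e sx s A src_ae by (metis subsetD)
      then have "(s, r) \<in> {(a, b). a \<in> A - ?C \<and> b \<in> A - ?C \<and> fin_prod G a b}\<^sup>*"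
        using r s by (intro conn) auto
      then show ?thesis
      proof (induction rule: rtrancl_induct)
        case base
        then show ?case
          by (rule e(3))
      next
        case (step r t)
        then show ?case
          using fin_prod_same_side[OF e(1), of r t] e A by auto
      qed
    qed
    have le: "card {d \<in> E. sep d ?y (av r ?y)} \<le> card {d \<in> E. sep d x (av r x)} \<and>
      (ae r e \<noteq> e \<longrightarrow> card {d \<in> E. sep d ?y (av r ?y)} < card {d \<in> E. sep d x (av r x)})"
      if r: "r \<in> A" for r
    proof (cases "ae r e = e")
      case True
      then have "av r ?y = ?y"
        using tgt_ae[of r e] e r A by auto
      then show ?thesis
        using True by simp
    next
      case False
      have rG: "r \<in> carrier G"
        using r A by auto
      let ?d = "ae r e"
      have d: "?d \<in> E" "?d \<noteq> e" "?d \<noteq> bar e" "bar ?d \<in> E"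
        using False e rG no_inversion by (auto simp: ae_E bar_E)
      have "sep ?d (av r x) (av r (av r x))"
        using sep_act[OF rG e(1) x, of "av r x"] far[OF r False] av_V[OF rG x] by simp
      then have d_sep: "sep ?d x (av r x)"
        using av_mult[OF rG rG x] A(3)[OF r] av_one[OF x] sep_sym by metis
      \<comment> \<open>Replacing \<open>x\<close> by \<open>tgt e\<close> toggles \<open>e\<close>
        and its reverse at one end of the path to the translate, and their images under
        \<open>r\<close> at the other. All of these separated \<open>x\<close> from
        \<open>av r x\<close>, so they can only disappear.\<close>
      have sep_y: "sep c ?y (av r ?y) \<longleftrightarrow> sep c x (av r x) \<noteq> ((c = e \<or> c = bar e) \<noteq> (c = ?d \<or> c = bar ?d))"
        if "c \<in> E" for c
      proof -
        have "sep c x ?y \<longleftrightarrow> c = e \<or> c = bar e"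
          using sep_arc[OF e(1) that] e(2) by simp
        moreover have "sep c (av r x) (av r ?y) \<longleftrightarrow> c = ?d \<or> c = bar ?d"
          using sep_arc[OF d(1) that] e rG by (simp add: src_ae tgt_ae)
        ultimately show ?thesis
          unfolding sep_def by blast
      qed
      have sep_x: "sep c x (av r x)" if "c = e \<or> c = bar e \<or> c = ?d \<or> c = bar ?d" for c
        using that far[OF r False] d_sep sep_bar[OF e(1) x] sep_bar[OF d(1) x] av_V[OF rG x] by auto
      have bar_d: "bar ?d \<noteq> e" "bar ?d \<noteq> bar e"
        using d e bar_bar by metis+
      have "{c \<in> E. sep c ?y (av r ?y)} \<subseteq> {c \<in> E. sep c x (av r x)} - {e}"
      proof
        fix c assume "c \<in> {c \<in> E. sep c ?y (av r ?y)}"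
        then have c: "c \<in> E" "sep c ?y (av r ?y)"
          by simp_all
        show "c \<in> {c \<in> E. sep c x (av r x)} - {e}"
          using sep_y[OF c(1)] sep_x[of c] c d(2,3) bar_d by auto
      qed
      moreover have "e \<in> {c \<in> E. sep c x (av r x)}"
        using e far[OF r False] by simp
      ultimately have "{c \<in> E. sep c ?y (av r ?y)} \<subset> {c \<in> E. sep c x (av r x)}"
        by blast
      then have "card {c \<in> E. sep c ?y (av r ?y)} < card {c \<in> E. sep c x (av r x)}"
        using finite_sep[OF x av_V[OF rG x]] by (rule psubset_card_mono[rotated])
      then show ?thesis
        by simp
    qed
    have "ae s e \<noteq> e"
      using e sx s A src_ae by (metis subsetD)
    then have "f ?y < f x"
      unfolding f_def using le s by (intro sum_strict_mono_ex1[OF A(1)]) auto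
    then show False
      using min[OF y] by simp
  qed
  then show ?thesis
    using x by blast
qed

end

section \<open>The Bass--Serre tree\<close>

text \<open>Stated for an arbitrary group \<open>W\<close>: it serves both for the given
  decomposition and, with the identity as \<phi>, for the fundamental group of the one constructed
  from the bags.\<close>

locale bass_serre = group W for W :: "'a monoid" (structure) +
  fixes \<Lambda> :: "('v, 'e, 'g, 'h) graph_of_groups" and T :: "'e set"
    and \<phi> :: "('v, 'e, 'g) pi1_gen word set \<Rightarrow> 'a"
  assumes gog: "graph_of_groups \<Lambda>"
    and tree: "maximal_tree (base \<Lambda>) (opp \<Lambda>) T"
    and iso: "\<phi> \<in> iso (pi1 \<Lambda> T) W"
begin

abbreviation "verts\<^sub>\<Lambda> \<equiv> verts (base \<Lambda>)"
abbreviation "arcs\<^sub>\<Lambda> \<equiv> arcs (base \<Lambda>)"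
abbreviation "tail\<^sub>\<Lambda> \<equiv> tail (base \<Lambda>)"
abbreviation "head\<^sub>\<Lambda> \<equiv> head (base \<Lambda>)"
abbreviation "op \<equiv> opp \<Lambda>"

sublocale D: bidirected_digraph "base \<Lambda>" op
  using gog by (simp add: graph_of_groups_def)

lemma vgroup_group: "v \<in> verts\<^sub>\<Lambda> \<Longrightarrow> group (vgroup \<Lambda> v)"
  and egroup_group: "e \<in> arcs\<^sub>\<Lambda> \<Longrightarrow> group (egroup \<Lambda> e)"
  and egroup_opp: "e \<in> arcs\<^sub>\<Lambda> \<Longrightarrow> egroup \<Lambda> (op e) = egroup \<Lambda> e"
  and einj_hom: "e \<in> arcs\<^sub>\<Lambda> \<Longrightarrow> einj \<Lambda> e \<in> hom (egroup \<Lambda> e) (vgroup \<Lambda> (head\<^sub>\<Lambda> e))"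
  using gog by (auto simp: graph_of_groups_def mon_def)

lemma T_arcs: "e \<in> T \<Longrightarrow> e \<in> arcs\<^sub>\<Lambda>" and T_opp: "e \<in> T \<Longrightarrow> op e \<in> T"
  using tree by (auto simp: maximal_tree_def)

section \<open>Vertex groups, edge groups and stable letters inside \<open>W\<close>\<close>

definition vg :: "'v \<Rightarrow> 'g \<Rightarrow> 'a" where
  "vg v g = \<phi> (pi1_class \<Lambda> T (Vert v g))"

definition st :: "'e \<Rightarrow> 'a" where
  "st e = \<phi> (pi1_class \<Lambda> T (Edge e))"

definition gen :: "('v, 'e, 'g) pi1_gen \<Rightarrow> 'a" where
  "gen x = \<phi> (pi1_class \<Lambda> T x)"

lemma gen_simps [simp]: "gen (Vert v g) = vg v g" "gen (Edge e) = st e"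
  by (simp_all add: gen_def vg_def st_def)

lemma pi1_class_closed: "x \<in> pi1_gens \<Lambda> \<Longrightarrow> pi1_class \<Lambda> T x \<in> carrier (pi1 \<Lambda> T)"
  by (simp add: pi1_class_def pi1_def word_class_in_carrier)

lemma phi_hom: "\<phi> \<in> hom (pi1 \<Lambda> T) W"
  using iso by (simp add: iso_def)

lemma gen_closed: "x \<in> pi1_gens \<Lambda> \<Longrightarrow> gen x \<in> carrier W"
  using phi_hom pi1_class_closed by (auto simp: gen_def hom_def)

lemma gens: "v \<in> verts\<^sub>\<Lambda> \<Longrightarrow> g \<in> carrier (vgroup \<Lambda> v) \<Longrightarrow> Vert v g \<in> pi1_gens \<Lambda>"
  "e \<in> arcs\<^sub>\<Lambda> \<Longrightarrow> Edge e \<in> pi1_gens \<Lambda>"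
  by (auto simp: pi1_gens_def)

lemma vg_closed [simp]: "v \<in> verts\<^sub>\<Lambda> \<Longrightarrow> g \<in> carrier (vgroup \<Lambda> v) \<Longrightarrow> vg v g \<in> carrier W"
  and st_closed [simp]: "e \<in> arcs\<^sub>\<Lambda> \<Longrightarrow> st e \<in> carrier W"
  using gen_closed gens by fastforce+

lemma relator:
  assumes "r \<in> pi1_relators \<Lambda> T" "r \<in> words (pi1_gens \<Lambda>)"
  shows "word_eval W gen r = \<one>"
proof -
  let ?P = "presented_group (pi1_gens \<Lambda>) (pi1_relators \<Lambda> T)"
  let ?c = "\<lambda>x. word_class (pi1_gens \<Lambda>) (pi1_relators \<Lambda> T) [(x, True)]"
  have "gen = \<phi> \<circ> ?c"
    by (auto simp: gen_def pi1_class_def)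
  moreover have "\<phi> (word_eval ?P ?c r) = word_eval W (\<phi> \<circ> ?c) r"
    using phi_hom by (intro hom_word_eval[OF group_presented_group group_axioms _ _ assms(2)])
      (auto simp: pi1_def word_class_in_carrier)
  moreover have "\<phi> \<one>\<^bsub>?P\<^esub> = \<one>"
    using phi_hom by (intro Group.hom_one[OF _ group_presented_group group_axioms]) (simp add: pi1_def)
  ultimately show ?thesis
    using word_eval_relator[OF assms] by simp
qed

lemma vg_mult:
  assumes "v \<in> verts\<^sub>\<Lambda>" "g \<in> carrier (vgroup \<Lambda> v)" "h \<in> carrier (vgroup \<Lambda> v)"
  shows "vg v (g \<otimes>\<^bsub>vgroup \<Lambda> v\<^esub> h) = vg v g \<otimes> vg v h"
proof -
  have gh: "g \<otimes>\<^bsub>vgroup \<Lambda> v\<^esub> h \<in> carrier (vgroup \<Lambda> v)"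
    using assms vgroup_group by (simp add: group.is_monoid monoid.m_closed)
  have "word_eval W gen [(Vert v g, True), (Vert v h, True), (Vert v (g \<otimes>\<^bsub>vgroup \<Lambda> v\<^esub> h), False)] = \<one>"
    using assms gh by (intro relator) (auto simp: pi1_relators_def gens)
  then have "vg v g \<otimes> (vg v h \<otimes> inv (vg v (g \<otimes>\<^bsub>vgroup \<Lambda> v\<^esub> h))) = \<one>"
    using assms gh by simp
  then have "(vg v g \<otimes> vg v h) \<otimes> inv (vg v (g \<otimes>\<^bsub>vgroup \<Lambda> v\<^esub> h)) = \<one>"
    using assms gh by (simp add: m_assoc)
  then show ?thesis
    using assms gh by (metis inv_equality inv_inv inv_closed m_closed vg_closed)
qed

lemma vg_hom: "v \<in> verts\<^sub>\<Lambda> \<Longrightarrow> vg v \<in> hom (vgroup \<Lambda> v) W"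
  by (rule homI) (auto simp: vg_mult)

lemma st_opp:
  assumes "e \<in> arcs\<^sub>\<Lambda>"
  shows "st (op e) = inv (st e)"
proof -
  have "word_eval W gen [(Edge e, True), (Edge (op e), True)] = \<one>"
    using assms by (intro relator) (auto simp: pi1_relators_def gens)
  then have "st e \<otimes> st (op e) = \<one>"
    using assms by simp
  then show ?thesis
    using assms by (metis D.arev_in_arcs inv_equality inv_inv st_closed)
qed

lemma st_tree: "e \<in> T \<Longrightarrow> st e = \<one>"
  using relator[of "[(Edge e, True)]"] T_arcs[of e] by (auto simp: pi1_relators_def gens)

lemma einj_closed:
  assumes "e \<in> arcs\<^sub>\<Lambda>" "a \<in> carrier (egroup \<Lambda> e)"
  shows "einj \<Lambda> e a \<in> carrier (vgroup \<Lambda> (head\<^sub>\<Lambda> e))" "einj \<Lambda> (op e) a \<in> carrier (vgroup \<Lambda> (tail\<^sub>\<Lambda> e))"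
  using einj_hom[OF assms(1)] einj_hom[of "op e"] assms egroup_opp by (auto simp: hom_def)

lemma st_conj:
  assumes e: "e \<in> arcs\<^sub>\<Lambda>" "a \<in> carrier (egroup \<Lambda> e)"
  shows "st e \<otimes> vg (head\<^sub>\<Lambda> e) (einj \<Lambda> e a) = vg (tail\<^sub>\<Lambda> e) (einj \<Lambda> (op e) a) \<otimes> st e"
proof -
  let ?h = "vg (head\<^sub>\<Lambda> e) (einj \<Lambda> e a)" and ?t = "vg (tail\<^sub>\<Lambda> e) (einj \<Lambda> (op e) a)"
  have cl: "?h \<in> carrier W" "?t \<in> carrier W"
    using e einj_closed by auto
  have "word_eval W gen [(Edge e, True), (Vert (head\<^sub>\<Lambda> e) (einj \<Lambda> e a), True), (Edge e, False),
      (Vert (tail\<^sub>\<Lambda> e) (einj \<Lambda> (op e) a), False)] = \<one>"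
    using e einj_closed by (intro relator) (auto simp: pi1_relators_def gens)
  then have "st e \<otimes> (?h \<otimes> (inv (st e) \<otimes> inv ?t)) = \<one>"
    using e cl by simp
  then have "(st e \<otimes> ?h) \<otimes> inv (?t \<otimes> st e) = \<one>"
    using e cl by (simp add: m_assoc inv_mult_group)
  then show ?thesis
    using e cl by (metis inv_equality inv_inv inv_closed m_closed st_closed)
qed

definition Hv :: "'v \<Rightarrow> 'a set" where
  "Hv v = vg v ` carrier (vgroup \<Lambda> v)"

text \<open>\<open>einj e\<close> embeds into the group at the head, so the copy of the edge group
  at the tail is given by the opposite arc.\<close>

definition He :: "'e \<Rightarrow> 'a set" where
  "He e = (\<lambda>a. vg (tail\<^sub>\<Lambda> e) (einj \<Lambda> (op e) a)) ` carrier (egroup \<Lambda> e)"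

lemma Hv_eq: "Hv v = \<phi> ` pi1_vgroup \<Lambda> T v"
  by (simp add: Hv_def pi1_vgroup_def vg_def image_image)

lemma Hv_subgroup: "v \<in> verts\<^sub>\<Lambda> \<Longrightarrow> subgroup (Hv v) W"
  unfolding Hv_def using vg_hom vgroup_group
  by (intro group_hom.img_is_subgroup) (simp add: group_hom_def group_hom_axioms_def group_axioms)

lemma He_subgroup:
  assumes "e \<in> arcs\<^sub>\<Lambda>"
  shows "subgroup (He e) W"
proof -
  have "vg (tail\<^sub>\<Lambda> e) \<circ> einj \<Lambda> (op e) \<in> hom (egroup \<Lambda> e) W"
  proof (rule Group.hom_compose)
    show "einj \<Lambda> (op e) \<in> hom (egroup \<Lambda> e) (vgroup \<Lambda> (tail\<^sub>\<Lambda> e))"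
      using assms einj_hom[of "op e"] egroup_opp by simp
    show "vg (tail\<^sub>\<Lambda> e) \<in> hom (vgroup \<Lambda> (tail\<^sub>\<Lambda> e)) W"
      using assms by (intro vg_hom) simp
  qed
  then have "subgroup ((vg (tail\<^sub>\<Lambda> e) \<circ> einj \<Lambda> (op e)) ` carrier (egroup \<Lambda> e)) W"
    using egroup_group[OF assms]
    by (intro group_hom.img_is_subgroup) (simp add: group_hom_def group_hom_axioms_def group_axioms)
  then show ?thesis
    by (simp add: He_def image_comp comp_def)
qed

lemma He_Hv: "e \<in> arcs\<^sub>\<Lambda> \<Longrightarrow> He e \<subseteq> Hv (tail\<^sub>\<Lambda> e)"
  using einj_closed by (auto simp: He_def Hv_def)

lemma Hv_carrier: "v \<in> verts\<^sub>\<Lambda> \<Longrightarrow> Hv v \<subseteq> carrier W"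
  and He_carrier: "e \<in> arcs\<^sub>\<Lambda> \<Longrightarrow> He e \<subseteq> carrier W"
  using Hv_subgroup He_subgroup by (auto dest: subgroup.subset)

text \<open>The conjugation relation of the edge read on subgroups. It makes right multiplication by
  \<open>st e\<close> carry cosets of \<open>He e\<close> to cosets of
  \<open>He (op e)\<close>.\<close>

lemma He_st:
  assumes e: "e \<in> arcs\<^sub>\<Lambda>"
  shows "He e #> st e = st e <# He (op e)"
proof -
  have "He (op e) = (\<lambda>a. vg (head\<^sub>\<Lambda> e) (einj \<Lambda> e a)) ` carrier (egroup \<Lambda> e)"
    using e egroup_opp by (simp add: He_def)
  then have "st e <# He (op e) = (\<lambda>a. st e \<otimes> vg (head\<^sub>\<Lambda> e) (einj \<Lambda> e a)) ` carrier (egroup \<Lambda> e)"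
    by (auto simp: l_coset_def)
  also have "\<dots> = (\<lambda>a. vg (tail\<^sub>\<Lambda> e) (einj \<Lambda> (op e) a) \<otimes> st e) ` carrier (egroup \<Lambda> e)"
    using st_conj[OF e] by (rule image_cong[OF HOL.refl])
  also have "\<dots> = He e #> st e"
    by (auto simp: He_def r_coset_def)
  finally show ?thesis ..
qed

section \<open>The Bass--Serre graph as a coset graph\<close>

definition V :: "('v \<times> 'a set) set" where
  "V = {(v, g <# Hv v) | v g. v \<in> verts\<^sub>\<Lambda> \<and> g \<in> carrier W}"

definition E :: "('e \<times> 'a set) set" where
  "E = {(e, g <# He e) | e g. e \<in> arcs\<^sub>\<Lambda> \<and> g \<in> carrier W}"

text \<open>The set product enlarges the coset of the edge group to the coset of the vertex group
  containing it, without choosing a representative; right translation in \<open>bar\<close> likewise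
  acts on the coset as a set.\<close>

definition src :: "'e \<times> 'a set \<Rightarrow> 'v \<times> 'a set" where
  "src = (\<lambda>(e, C). (tail\<^sub>\<Lambda> e, C <#> Hv (tail\<^sub>\<Lambda> e)))"

definition bar :: "'e \<times> 'a set \<Rightarrow> 'e \<times> 'a set" where
  "bar = (\<lambda>(e, C). (op e, C #> st e))"

definition tgt :: "'e \<times> 'a set \<Rightarrow> 'v \<times> 'a set" where
  "tgt y = src (bar y)"

definition tr :: "'a \<Rightarrow> 'x \<times> 'a set \<Rightarrow> 'x \<times> 'a set" where
  "tr g = (\<lambda>(x, C). (x, g <# C))"

lemma lcos_eq_iff:
  assumes "subgroup H W" "g \<in> carrier W" "h \<in> carrier W"
  shows "g <# H = h <# H \<longleftrightarrow> (\<exists>k\<in>H. h = g \<otimes> k)"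
proof -
  interpret subgroup H W by fact
  show ?thesis
  proof
    assume "g <# H = h <# H"
    moreover have "h \<in> h <# H"
      unfolding l_coset_def using assms(3) one_closed by force
    ultimately show "\<exists>k\<in>H. h = g \<otimes> k"
      by (auto simp: l_coset_def)
  next
    assume "\<exists>k\<in>H. h = g \<otimes> k"
    then obtain k where k: "k \<in> H" "h = g \<otimes> k"
      by blast
    have "k <# H = H"
      using k(1) assms(1) by (intro coset_join3) auto
    then show "g <# H = h <# H"
      using k assms lcos_m_assoc[OF subset, of g k] by simp
  qed
qed

lemma src_rep:
  assumes "e \<in> arcs\<^sub>\<Lambda>" "g \<in> carrier W"
  shows "src (e, g <# He e) = (tail\<^sub>\<Lambda> e, g <# Hv (tail\<^sub>\<Lambda> e))"
proof -
  interpret K: subgroup "Hv (tail\<^sub>\<Lambda> e)" W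
    using assms by (intro Hv_subgroup) auto
  interpret H: subgroup "He e" W
    using assms by (intro He_subgroup)
  have "He e <#> Hv (tail\<^sub>\<Lambda> e) = Hv (tail\<^sub>\<Lambda> e)"
  proof
    show "He e <#> Hv (tail\<^sub>\<Lambda> e) \<subseteq> Hv (tail\<^sub>\<Lambda> e)"
      using He_Hv[OF assms(1)] by (auto simp: set_mult_def)
    show "Hv (tail\<^sub>\<Lambda> e) \<subseteq> He e <#> Hv (tail\<^sub>\<Lambda> e)"
    proof
      fix x assume "x \<in> Hv (tail\<^sub>\<Lambda> e)"
      moreover from this have "x = \<one> \<otimes> x"
        by simp
      ultimately show "x \<in> He e <#> Hv (tail\<^sub>\<Lambda> e)"
        unfolding set_mult_def using H.one_closed by blast
    qed
  qed
  moreover have "(g <# He e) <#> Hv (tail\<^sub>\<Lambda> e) = g <# (He e <#> Hv (tail\<^sub>\<Lambda> e))"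
    using assms H.subset K.subset by (simp add: setmult_lcos_assoc)
  ultimately show ?thesis
    by (simp add: src_def)
qed

lemma bar_rep:
  assumes "e \<in> arcs\<^sub>\<Lambda>" "g \<in> carrier W"
  shows "bar (e, g <# He e) = (op e, (g \<otimes> st e) <# He (op e))"
proof -
  have "(g <# He e) #> st e = g <# (He e #> st e)"
    using assms subsetD[OF He_carrier[OF assms(1)]] by (force simp: l_coset_def r_coset_def m_assoc)
  also have "\<dots> = (g \<otimes> st e) <# He (op e)"
    using assms He_carrier[of "op e"] by (simp add: He_st lcos_m_assoc)
  finally show ?thesis
    by (simp add: bar_def)
qed

lemma tgt_rep:
  assumes "e \<in> arcs\<^sub>\<Lambda>" "g \<in> carrier W"
  shows "tgt (e, g <# He e) = (head\<^sub>\<Lambda> e, (g \<otimes> st e) <# Hv (head\<^sub>\<Lambda> e))"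
  using assms src_rep[of "op e" "g \<otimes> st e"] by (simp add: tgt_def bar_rep)

lemma tr_rep:
  "g \<in> carrier W \<Longrightarrow> h \<in> carrier W \<Longrightarrow> C \<subseteq> carrier W \<Longrightarrow> tr g (x, h <# C) = (x, (g \<otimes> h) <# C)"
  by (simp add: tr_def lcos_m_assoc)

lemma V_E:
  "v \<in> verts\<^sub>\<Lambda> \<Longrightarrow> g \<in> carrier W \<Longrightarrow> (v, g <# Hv v) \<in> V"
  "e \<in> arcs\<^sub>\<Lambda> \<Longrightarrow> g \<in> carrier W \<Longrightarrow> (e, g <# He e) \<in> E"
  by (auto simp: V_def E_def)

lemma V_cases:
  assumes "x \<in> V" obtains v g where "x = (v, g <# Hv v)" "v \<in> verts\<^sub>\<Lambda>" "g \<in> carrier W"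
  using assms by (auto simp: V_def)

lemma E_cases:
  assumes "y \<in> E" obtains e g where "y = (e, g <# He e)" "e \<in> arcs\<^sub>\<Lambda>" "g \<in> carrier W"
  using assms by (auto simp: E_def)

lemma tr_E: "g \<in> carrier W \<Longrightarrow> y \<in> E \<Longrightarrow> tr g y \<in> E"
  by (elim E_cases) (simp add: tr_rep He_carrier V_E)

lemma tr_V: "g \<in> carrier W \<Longrightarrow> x \<in> V \<Longrightarrow> tr g x \<in> V"
  by (elim V_cases) (simp add: tr_rep Hv_carrier V_E)

lemma tr_mult_E: "g \<in> carrier W \<Longrightarrow> h \<in> carrier W \<Longrightarrow> y \<in> E \<Longrightarrow> tr (g \<otimes> h) y = tr g (tr h y)"
  by (elim E_cases) (simp add: tr_rep He_carrier m_assoc)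

lemma tr_mult_V: "g \<in> carrier W \<Longrightarrow> h \<in> carrier W \<Longrightarrow> x \<in> V \<Longrightarrow> tr (g \<otimes> h) x = tr g (tr h x)"
  by (elim V_cases) (simp add: tr_rep Hv_carrier m_assoc)

lemma tr_one_E: "y \<in> E \<Longrightarrow> tr \<one> y = y"
  by (elim E_cases) (simp add: tr_rep He_carrier)

lemma tr_one_V: "x \<in> V \<Longrightarrow> tr \<one> x = x"
  by (elim V_cases) (simp add: tr_rep Hv_carrier)

lemma bar_E: "y \<in> E \<Longrightarrow> bar y \<in> E"
  by (elim E_cases) (simp add: bar_rep V_E)

lemma bar_bar: "y \<in> E \<Longrightarrow> bar (bar y) = y"
  by (elim E_cases) (simp add: bar_rep st_opp m_assoc)

lemma bar_tr: "g \<in> carrier W \<Longrightarrow> y \<in> E \<Longrightarrow> bar (tr g y) = tr g (bar y)"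
  by (elim E_cases) (simp add: tr_rep bar_rep He_carrier m_assoc)

lemma src_tr: "g \<in> carrier W \<Longrightarrow> y \<in> E \<Longrightarrow> src (tr g y) = tr g (src y)"
  by (elim E_cases) (simp add: tr_rep src_rep He_carrier Hv_carrier m_assoc)

lemma T_connected:
  assumes "u \<in> verts\<^sub>\<Lambda>" "v \<in> verts\<^sub>\<Lambda>"
  shows "(u, v) \<in> {(tail\<^sub>\<Lambda> e, head\<^sub>\<Lambda> e) | e. e \<in> T}\<^sup>*"
proof -
  have "reachable ((base \<Lambda>)\<lparr>arcs := T\<rparr>) u v"
    using tree assms by (auto simp: maximal_tree_def strongly_connected_def)
  moreover have "arcs_ends ((base \<Lambda>)\<lparr>arcs := T\<rparr>) = {(tail\<^sub>\<Lambda> e, head\<^sub>\<Lambda> e) | e. e \<in> T}"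
    by (auto simp: arcs_ends_def arc_to_ends_def)
  ultimately show ?thesis
    unfolding reachable_def by (auto intro: rtrancl_on_rtranclI)
qed

lemma gen_induct [consumes 1, case_names one gen inv]:
  assumes "g \<in> carrier W" and "Q \<one>"
    and "\<And>x g. x \<in> pi1_gens \<Lambda> \<Longrightarrow> g \<in> carrier W \<Longrightarrow> Q g \<Longrightarrow> Q (gen x \<otimes> g)"
    and "\<And>x g. x \<in> pi1_gens \<Lambda> \<Longrightarrow> g \<in> carrier W \<Longrightarrow> Q g \<Longrightarrow> Q (inv (gen x) \<otimes> g)"
  shows "Q g"
proof -
  let ?P = "presented_group (pi1_gens \<Lambda>) (pi1_relators \<Lambda> T)"
  interpret h: group_hom ?P W \<phi>
    using phi_hom by (simp add: group_hom_def group_hom_axioms_def group_presented_group group_axioms pi1_def)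
  obtain a where a: "a \<in> carrier ?P" "g = \<phi> a"
    using assms(1) iso by (auto simp: iso_def bij_betw_def pi1_def)
  have "Q (\<phi> a)"
    using a(1)
  proof (induction rule: presented_group_induct)
    case one
    then show ?case
      using assms(2) by simp
  next
    case (gen x a)
    then show ?case
      using assms(3)[of x "\<phi> a"] by (simp add: word_class_in_carrier gen_def pi1_class_def)
  next
    case (inv_gen x a)
    then show ?case
      using assms(4)[of x "\<phi> a"] by (simp add: word_class_in_carrier gen_def pi1_class_def)
  qed
  then show ?thesis
    using a by simp
qed

text \<open>Over a fixed \<open>g\<close>, the translate of the maximal tree joins the cosets at all
  vertices, as its stable letters are trivial. Passing from \<open>g\<close> to \<open>g\<close>
  times a generator either keeps a coset unchanged or follows an arc.\<close>

lemma connected: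
  assumes "x \<in> V" "y \<in> V"
  shows "(x, y) \<in> {(src e, tgt e) | e. e \<in> E}\<^sup>*" (is "_ \<in> ?R\<^sup>*")
proof -
  have "sym ?R"
  proof (rule symI)
    fix x y assume "(x, y) \<in> ?R"
    then obtain e where "e \<in> E" "x = src e" "y = tgt e"
      by auto
    then show "(y, x) \<in> ?R"
      using bar_E[of e] bar_bar[of e] unfolding tgt_def by (intro CollectI exI[of _ "bar e"]) simp
  qed
  then have sym: "sym (?R\<^sup>*)"
    by (rule sym_rtrancl)
  have arc: "((tail\<^sub>\<Lambda> e, g <# Hv (tail\<^sub>\<Lambda> e)), (head\<^sub>\<Lambda> e, (g \<otimes> st e) <# Hv (head\<^sub>\<Lambda> e))) \<in> ?R"
    if "e \<in> arcs\<^sub>\<Lambda>" "g \<in> carrier W" for e g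
    using src_rep[OF that] tgt_rep[OF that] V_E(2)[OF that]
    by (intro CollectI exI[of _ "(e, g <# He e)"]) simp
  have level: "((u, g <# Hv u), (v, g <# Hv v)) \<in> ?R\<^sup>*"
    if "u \<in> verts\<^sub>\<Lambda>" "v \<in> verts\<^sub>\<Lambda>" "g \<in> carrier W" for u v g
    using T_connected[OF that(1,2)]
  proof (induction rule: rtrancl_induct)
    case (step y z)
    then obtain e where "e \<in> T" "y = tail\<^sub>\<Lambda> e" "z = head\<^sub>\<Lambda> e"
      by auto
    then have "((y, g <# Hv y), (z, g <# Hv z)) \<in> ?R"
      using arc[of e g] that(3) T_arcs[of e] st_tree[of e] by simp
    then show ?case
      using step.IH by (meson rtrancl.rtrancl_into_rtrancl)
  qed simp
  have gen_step: "\<exists>u\<in>verts\<^sub>\<Lambda>. \<exists>w\<in>verts\<^sub>\<Lambda>. ((u, h <# Hv u), (w, (h \<otimes> gen x) <# Hv w)) \<in> ?R\<^sup>*"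
    if x: "x \<in> pi1_gens \<Lambda>" and h: "h \<in> carrier W" for x h
  proof -
    from x consider v g where "x = Vert v g" "v \<in> verts\<^sub>\<Lambda>" "g \<in> carrier (vgroup \<Lambda> v)" | e where "x = Edge e" "e \<in> arcs\<^sub>\<Lambda>"
      by (auto simp: pi1_gens_def)
    then show ?thesis
    proof cases
      case 1
      then have "h <# Hv v = (h \<otimes> gen x) <# Hv v"
        using h lcos_eq_iff[OF Hv_subgroup[OF 1(2)], of h "h \<otimes> vg v g"] by (auto simp: Hv_def)
      then show ?thesis
        using 1(2) by (intro bexI[of _ v]) simp_all
    next
      case 2
      then have "tail\<^sub>\<Lambda> e \<in> verts\<^sub>\<Lambda>" "head\<^sub>\<Lambda> e \<in> verts\<^sub>\<Lambda>"
        by auto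
      moreover have "((tail\<^sub>\<Lambda> e, h <# Hv (tail\<^sub>\<Lambda> e)), (head\<^sub>\<Lambda> e, (h \<otimes> gen x) <# Hv (head\<^sub>\<Lambda> e))) \<in> ?R\<^sup>*"
        using arc[OF 2(2) h] 2 by auto
      ultimately show ?thesis
        by blast
    qed
  qed
  have gen_conn: "((u, h <# Hv u), (v, (h \<otimes> gen x) <# Hv v)) \<in> ?R\<^sup>*"
    if uv: "u \<in> verts\<^sub>\<Lambda>" "v \<in> verts\<^sub>\<Lambda>" and x: "x \<in> pi1_gens \<Lambda>" and h: "h \<in> carrier W" for u v x h
  proof -
    obtain a b where "a \<in> verts\<^sub>\<Lambda>" "b \<in> verts\<^sub>\<Lambda>" "((a, h <# Hv a), (b, (h \<otimes> gen x) <# Hv b)) \<in> ?R\<^sup>*"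
      using gen_step[OF x h] by blast
    then show ?thesis
      using level[of u a h] level[of b v "h \<otimes> gen x"] uv h gen_closed[OF x] by (meson m_closed rtrancl_trans)
  qed
  \<comment> \<open>The quantifier over \<open>h\<close> is needed because the induction splits
    generators off on the left of \<open>g\<close>, and these are absorbed into
    \<open>h\<close>.\<close>
  have conn: "\<forall>h\<in>carrier W. \<forall>u\<in>verts\<^sub>\<Lambda>. \<forall>v\<in>verts\<^sub>\<Lambda>. ((u, h <# Hv u), (v, (h \<otimes> g) <# Hv v)) \<in> ?R\<^sup>*"
    if "g \<in> carrier W" for g
    using that
  proof (induction g rule: gen_induct)
    case one
    then show ?case
      using level by simp
  next
    case (gen x g)
    show ?case
    proof (intro ballI)
      fix h u v assume h: "h \<in> carrier W" "u \<in> verts\<^sub>\<Lambda>" "v \<in> verts\<^sub>\<Lambda>"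
      have "((u, (h \<otimes> gen x) <# Hv u), (v, (h \<otimes> gen x \<otimes> g) <# Hv v)) \<in> ?R\<^sup>*"
        using gen h gen_closed by simp
      then show "((u, h <# Hv u), (v, (h \<otimes> (gen x \<otimes> g)) <# Hv v)) \<in> ?R\<^sup>*"
        using gen_conn[OF h(2,2) gen(1) h(1)] gen h gen_closed by (simp add: m_assoc)
    qed
  next
    case (inv x g)
    show ?case
    proof (intro ballI)
      fix h u v assume h: "h \<in> carrier W" "u \<in> verts\<^sub>\<Lambda>" "v \<in> verts\<^sub>\<Lambda>"
      let ?h = "h \<otimes> inv (gen x)"
      have hc: "?h \<in> carrier W" "?h \<otimes> gen x = h" "?h \<otimes> g = h \<otimes> (inv (gen x) \<otimes> g)"
        using h inv gen_closed[OF inv(1)] by (auto simp: m_assoc)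
      have 1: "((u, ?h <# Hv u), (v, (?h \<otimes> g) <# Hv v)) \<in> ?R\<^sup>*"
        using inv.IH hc(1) h by blast
      have "((u, ?h <# Hv u), (u, h <# Hv u)) \<in> ?R\<^sup>*"
        using gen_conn[OF h(2,2) inv(1) hc(1)] unfolding hc(2) .
      then have "((u, h <# Hv u), (u, ?h <# Hv u)) \<in> ?R\<^sup>*"
        by (rule symD[OF sym])
      then show "((u, h <# Hv u), (v, (h \<otimes> (inv (gen x) \<otimes> g)) <# Hv v)) \<in> ?R\<^sup>*"
        using 1 unfolding hc(3) by (rule rtrancl_trans)
    qed
  qed
  obtain u g where x: "x = (u, g <# Hv u)" "u \<in> verts\<^sub>\<Lambda>" "g \<in> carrier W"
    using assms(1) by (rule V_cases)
  obtain v h where y: "y = (v, h <# Hv v)" "v \<in> verts\<^sub>\<Lambda>" "h \<in> carrier W"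
    using assms(2) by (rule V_cases)
  have h: "g \<otimes> (inv g \<otimes> h) = h"
    using x y by simp
  have "inv g \<otimes> h \<in> carrier W"
    using x y by simp
  from conn[OF this, rule_format, OF x(3,2) y(2)] show ?thesis
    unfolding h x(1) y(1) .
qed

section \<open>Cutting the maximal tree at an edge\<close>

definition root :: 'v where
  "root = (SOME v. v \<in> verts\<^sub>\<Lambda>)"

lemma root: "root \<in> verts\<^sub>\<Lambda>"
  using gog unfolding root_def graph_of_groups_def strongly_connected_def
  by (metis all_not_in_conv someI)

definition cut :: "'e \<Rightarrow> ('v \<times> 'v) set" where
  "cut f = {(tail\<^sub>\<Lambda> g, head\<^sub>\<Lambda> g) | g. g \<in> T \<and> g \<noteq> f \<and> g \<noteq> op f}"

lemma sym_cut: "sym ((cut f)\<^sup>*)"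
proof (rule sym_rtrancl, rule symI)
  fix x y assume "(x, y) \<in> cut f"
  then obtain g where g: "g \<in> T" "g \<noteq> f" "g \<noteq> op f" "x = tail\<^sub>\<Lambda> g" "y = head\<^sub>\<Lambda> g"
    by (auto simp: cut_def)
  then have "op g \<in> T" "op g \<noteq> f" "op g \<noteq> op f"
    using T_opp D.arev_eq_iff by (auto simp: D.arev_eq_iff)
  then show "(y, x) \<in> cut f"
    unfolding cut_def using g T_arcs[of g] by (intro CollectI exI[of _ "op g"]) auto
qed

text \<open>Built arc by arc: a new arc that reverses the last one deletes it instead of being
  appended. This gives the backtracking-free walks that \<open>maximal_tree\<close> speaks
  of.\<close>

lemma reduced_walk:
  assumes "(u, v) \<in> (cut f)\<^sup>*"
  shows "\<exists>p. set p \<subseteq> T - {f, op f} \<and> pre_digraph.cas (base \<Lambda>) u p v \<and> successively (\<lambda>e f. f \<noteq> op e) p"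
  using assms
proof (induction rule: rtrancl_induct)
  case base
  show ?case
    by (intro exI[of _ "[]"]) (simp add: pre_digraph.cas.simps)
next
  case (step y z)
  obtain g where g: "g \<in> T" "g \<noteq> f" "g \<noteq> op f" "y = tail\<^sub>\<Lambda> g" "z = head\<^sub>\<Lambda> g"
    using step.hyps by (auto simp: cut_def)
  obtain p where p: "set p \<subseteq> T - {f, op f}" "pre_digraph.cas (base \<Lambda>) u p y" "successively (\<lambda>e f. f \<noteq> op e) p"
    using step.IH by blast
  have cas_snoc: "pre_digraph.cas (base \<Lambda>) a (q @ [e]) b \<longleftrightarrow> pre_digraph.cas (base \<Lambda>) a q (tail\<^sub>\<Lambda> e) \<and> b = head\<^sub>\<Lambda> e" for a b q e
    by (induction q arbitrary: a) (auto simp: pre_digraph.cas.simps)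
  show ?case
  proof (cases "p \<noteq> [] \<and> last p = op g")
    case True
    then obtain q where q: "p = q @ [op g]"
      by (metis append_butlast_last_id)
    then have "pre_digraph.cas (base \<Lambda>) u q z"
      using p(2) g T_arcs[OF g(1)] unfolding q cas_snoc by simp
    then show ?thesis
      using p q by (intro exI[of _ q]) (auto simp: successively_append_iff)
  next
    case False
    have "successively (\<lambda>e f. f \<noteq> op e) (p @ [g])"
      using p(3) False by (auto simp: successively_append_iff)
    moreover have "pre_digraph.cas (base \<Lambda>) u (p @ [g]) z"
      unfolding cas_snoc using p(2) g(4,5) by simp
    moreover have "set (p @ [g]) \<subseteq> T - {f, op f}"
      using p(1) g(1-3) by simp
    ultimately show ?thesis
      by blast
  qed
qed

text \<open>A reduced walk from the head of \<open>f\<close> back to its tail avoids both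
  \<open>f\<close> and \<open>op f\<close>. Putting \<open>f\<close> in front keeps it reduced and
  closes it, which a tree forbids.\<close>

lemma cut_separates:
  assumes f: "f \<in> T"
  shows "(head\<^sub>\<Lambda> f, tail\<^sub>\<Lambda> f) \<notin> (cut f)\<^sup>*"
proof
  assume "(head\<^sub>\<Lambda> f, tail\<^sub>\<Lambda> f) \<in> (cut f)\<^sup>*"
  then obtain p where p: "set p \<subseteq> T - {f, op f}" "pre_digraph.cas (base \<Lambda>) (head\<^sub>\<Lambda> f) p (tail\<^sub>\<Lambda> f)"
    "successively (\<lambda>e f. f \<noteq> op e) p"
    using reduced_walk by blast
  let ?D = "(base \<Lambda>)\<lparr>arcs := T\<rparr>"
  have cas: "pre_digraph.cas ?D a q b \<longleftrightarrow> pre_digraph.cas (base \<Lambda>) a q b" for a b q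
    by (induction q arbitrary: a) (auto simp: pre_digraph.cas.simps)
  have "pre_digraph.awalk ?D (tail\<^sub>\<Lambda> f) (f # p) (tail\<^sub>\<Lambda> f)"
    using p f T_arcs[OF f] by (auto simp: pre_digraph.awalk_def cas pre_digraph.cas.simps)
  moreover have "successively (\<lambda>e f. f \<noteq> op e) (f # p)"
    using p by (cases p) auto
  ultimately have "f # p = []"
    using tree unfolding maximal_tree_def by blast
  then show False
    by simp
qed

text \<open>Without \<open>f\<close> the tree falls into exactly two parts, one at each end of
  \<open>f\<close>: every vertex is joined to one of the ends, and the root not to both.\<close>

lemma cut_arc:
  assumes e: "e \<in> T" and f: "f \<in> T"
  shows "((root, head\<^sub>\<Lambda> e) \<in> (cut f)\<^sup>*) = ((root, tail\<^sub>\<Lambda> e) \<in> (cut f)\<^sup>*) \<longleftrightarrow> \<not> (f = e \<or> f = op e)"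
proof (cases "f = e \<or> f = op e")
  case False
  then have "e \<noteq> f" "e \<noteq> op f"
    by auto
  then have "(tail\<^sub>\<Lambda> e, head\<^sub>\<Lambda> e) \<in> cut f"
    using e by (auto simp: cut_def)
  then have "(tail\<^sub>\<Lambda> e, head\<^sub>\<Lambda> e) \<in> (cut f)\<^sup>*" "(head\<^sub>\<Lambda> e, tail\<^sub>\<Lambda> e) \<in> (cut f)\<^sup>*"
    using sym_cut by (auto dest: symD)
  then show ?thesis
    using False by (meson rtrancl_trans)
next
  case True
  then have cut: "cut f = cut e"
    by (auto simp: cut_def)
  have "(head\<^sub>\<Lambda> e, v) \<in> (cut e)\<^sup>* \<or> (tail\<^sub>\<Lambda> e, v) \<in> (cut e)\<^sup>*" if "v \<in> verts\<^sub>\<Lambda>" for v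
  proof -
    have "(head\<^sub>\<Lambda> e, v) \<in> {(tail\<^sub>\<Lambda> e, head\<^sub>\<Lambda> e) | e. e \<in> T}\<^sup>*"
      using T_connected[of "head\<^sub>\<Lambda> e" v] T_arcs[OF e] that by simp
    then show ?thesis
    proof (induction rule: rtrancl_induct)
      case (step y z)
      then obtain g where g: "g \<in> T" "y = tail\<^sub>\<Lambda> g" "z = head\<^sub>\<Lambda> g"
        by auto
      show ?case
      proof (cases "g = e \<or> g = op e")
        case True
        then show ?thesis
          using g T_arcs[OF e] by auto
      next
        case False
        then have "(y, z) \<in> cut e"
          using g by (auto simp: cut_def)
        then show ?thesis
          using step.IH by (meson rtrancl.rtrancl_into_rtrancl)
      qed
    qed simp
  qed
  from this[OF root] have "(root, head\<^sub>\<Lambda> e) \<in> (cut e)\<^sup>* \<or> (root, tail\<^sub>\<Lambda> e) \<in> (cut e)\<^sup>*"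
    using sym_cut by (meson symD)
  moreover have "\<not> ((root, head\<^sub>\<Lambda> e) \<in> (cut e)\<^sup>* \<and> (root, tail\<^sub>\<Lambda> e) \<in> (cut e)\<^sup>*)"
    using cut_separates[OF e] sym_cut by (meson rtrancl_trans symD)
  ultimately show ?thesis
    using True cut by auto
qed

section \<open>The derivation counting edge crossings\<close>

lemma tr_inv_E: "g \<in> carrier W \<Longrightarrow> y \<in> E \<Longrightarrow> tr (inv g) (tr g y) = y"
  "g \<in> carrier W \<Longrightarrow> y \<in> E \<Longrightarrow> tr g (tr (inv g) y) = y"
  by (simp_all flip: tr_mult_E add: tr_one_E)

lemma tr_image_E: "g \<in> carrier W \<Longrightarrow> D \<subseteq> E \<Longrightarrow> tr g ` D \<subseteq> E"
  using tr_E by blast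

lemma mem_tr_image:
  assumes "g \<in> carrier W" "D \<subseteq> E" "y \<in> E"
  shows "y \<in> tr g ` D \<longleftrightarrow> tr (inv g) y \<in> D"
proof
  assume "y \<in> tr g ` D"
  then show "tr (inv g) y \<in> D"
    using assms tr_inv_E by auto
next
  assume "tr (inv g) y \<in> D"
  then show "y \<in> tr g ` D"
    using assms tr_inv_E(2) by (metis image_eqI)
qed

text \<open>The semidirect product of the sets of arcs under symmetric difference with \<open>W\<close>: a
  homomorphism into it over the identity of \<open>W\<close> is a derivation.\<close>

definition sd :: "(('e \<times> 'a set) set \<times> 'a) monoid" where
  "sd = \<lparr>carrier = Pow E \<times> carrier W,
    monoid.mult = (\<lambda>(D, g) (D', g'). (sym_diff D (tr g ` D'), g \<otimes> g')),
    one = ({}, \<one>)\<rparr>"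

lemma sdiff_E: "A \<subseteq> E \<Longrightarrow> B \<subseteq> E \<Longrightarrow> sym_diff A B \<subseteq> E"
  by blast

lemma tr_image_mult:
  "g \<in> carrier W \<Longrightarrow> h \<in> carrier W \<Longrightarrow> D \<subseteq> E \<Longrightarrow> tr (g \<otimes> h) ` D = tr g ` tr h ` D"
  using tr_mult_E by (auto simp: image_image subset_iff intro!: image_cong)

lemma tr_image_one: "D \<subseteq> E \<Longrightarrow> tr \<one> ` D = D"
  using tr_one_E by (force simp: subset_iff image_iff)

lemma tr_image_sdiff:
  assumes "g \<in> carrier W" "D \<subseteq> E" "D' \<subseteq> E"
  shows "tr g ` sym_diff D D' = sym_diff (tr g ` D) (tr g ` D')"
proof -
  have "inj_on (tr g) E"
    using tr_inv_E(1)[OF assms(1)] by (rule inj_on_inverseI)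
  then show ?thesis
    using assms by (simp add: image_Un inj_on_image_set_diff[of "tr g" E] subset_iff)
qed

lemma sdiff_assoc: "sym_diff (sym_diff A B) C = sym_diff A (sym_diff B C)"
  by blast

lemma group_sd: "group sd"
proof (rule groupI)
  fix x y z assume "x \<in> carrier sd" "y \<in> carrier sd" "z \<in> carrier sd"
  then obtain A B C a b c where xyz: "x = (A, a)" "y = (B, b)" "z = (C, c)"
    and E: "A \<subseteq> E" "B \<subseteq> E" "C \<subseteq> E" and car: "a \<in> carrier W" "b \<in> carrier W" "c \<in> carrier W"
    by (auto simp: sd_def)
  have "sym_diff (sym_diff A (tr a ` B)) (tr (a \<otimes> b) ` C) = sym_diff A (tr a ` sym_diff B (tr b ` C))"
    using E car by (simp only: tr_image_mult tr_image_sdiff tr_image_E sdiff_assoc)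
  then show "x \<otimes>\<^bsub>sd\<^esub> y \<otimes>\<^bsub>sd\<^esub> z = x \<otimes>\<^bsub>sd\<^esub> (y \<otimes>\<^bsub>sd\<^esub> z)"
    using car by (simp add: sd_def xyz m_assoc)
next
  fix x y assume "x \<in> carrier sd" "y \<in> carrier sd"
  then obtain A B a b where xy: "x = (A, a)" "y = (B, b)"
    and E: "A \<subseteq> E" "B \<subseteq> E" and car: "a \<in> carrier W" "b \<in> carrier W"
    by (auto simp: sd_def)
  then show "x \<otimes>\<^bsub>sd\<^esub> y \<in> carrier sd"
    using sdiff_E[OF E(1) tr_image_E[OF car(1) E(2)]] by (simp add: sd_def)
next
  show "\<one>\<^bsub>sd\<^esub> \<in> carrier sd"
    by (simp add: sd_def)
next
  fix x assume "x \<in> carrier sd"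
  then obtain A a where x: "x = (A, a)" "A \<subseteq> E" "a \<in> carrier W"
    by (auto simp: sd_def)
  then show "\<one>\<^bsub>sd\<^esub> \<otimes>\<^bsub>sd\<^esub> x = x"
    by (simp add: sd_def tr_image_one)
  show "\<exists>y\<in>carrier sd. y \<otimes>\<^bsub>sd\<^esub> x = \<one>\<^bsub>sd\<^esub>"
    using x tr_image_E[of "inv a" A] by (intro bexI[of _ "(tr (inv a) ` A, inv a)"]) (simp_all add: sd_def)
qed

text \<open>The arcs, in both directions, of the lift of the maximal tree through the trivial cosets
  that separate the lift of the root from the lift of \<open>v\<close>.\<close>

definition pset :: "'v \<Rightarrow> ('e \<times> 'a set) set" where
  "pset v = {(f, He f) | f. f \<in> T \<and> (root, v) \<notin> (cut f)\<^sup>*}"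

definition eps :: "'e \<Rightarrow> ('e \<times> 'a set) set" where
  "eps e = {(e, He e), bar (e, He e)}"

lemma arc_rep: "e \<in> arcs\<^sub>\<Lambda> \<Longrightarrow> \<one> <# He e = He e"
  using He_carrier by (simp add: lcos_mult_one)

lemma arc_E: "e \<in> arcs\<^sub>\<Lambda> \<Longrightarrow> (e, He e) \<in> E"
  using V_E(2)[of e \<one>] arc_rep by simp

lemma bar_arc: "e \<in> arcs\<^sub>\<Lambda> \<Longrightarrow> bar (e, He e) = (op e, st e <# He (op e))"
  using bar_rep[of e \<one>] arc_rep by simp

lemma tr_arc: "e \<in> arcs\<^sub>\<Lambda> \<Longrightarrow> g \<in> carrier W \<Longrightarrow> tr g (e, He e) = (e, g <# He e)"
  by (simp add: tr_def)

lemma eps_E: "e \<in> arcs\<^sub>\<Lambda> \<Longrightarrow> eps e \<subseteq> E"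
  using arc_E bar_E by (auto simp: eps_def)

lemma pset_E: "pset v \<subseteq> E"
  using arc_E T_arcs by (auto simp: pset_def)

lemma tr_eps: "e \<in> arcs\<^sub>\<Lambda> \<Longrightarrow> g \<in> carrier W \<Longrightarrow> tr g ` eps e = {(e, g <# He e), bar (e, g <# He e)}"
  using arc_E tr_arc bar_tr[of g "(e, He e)"] by (simp add: eps_def)

lemma eps_opp:
  assumes "e \<in> arcs\<^sub>\<Lambda>"
  shows "tr (st e) ` eps (op e) = eps e"
proof -
  have "(op e, st e <# He (op e)) = bar (e, He e)"
    using assms by (simp add: bar_arc)
  moreover have "tr (st e) ` eps (op e) = {(op e, st e <# He (op e)), bar (op e, st e <# He (op e))}"
    using assms by (intro tr_eps) auto
  ultimately show ?thesis
    using bar_bar[OF arc_E[OF assms]] by (simp add: eps_def insert_commute)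
qed

lemma eps_fixed:
  assumes "e \<in> arcs\<^sub>\<Lambda>" "a \<in> carrier (egroup \<Lambda> e)"
  shows "tr (vg (tail\<^sub>\<Lambda> e) (einj \<Lambda> (op e) a)) ` eps e = eps e"
proof -
  let ?g = "vg (tail\<^sub>\<Lambda> e) (einj \<Lambda> (op e) a)"
  have "?g \<in> He e"
    using assms by (auto simp: He_def)
  then have "?g <# He e = He e"
    using He_subgroup[OF assms(1)] He_carrier[OF assms(1)] by (intro coset_join3) auto
  moreover have "tr ?g ` eps e = {(e, ?g <# He e), bar (e, ?g <# He e)}"
    using assms einj_closed by (intro tr_eps) auto
  ultimately show ?thesis
    by (simp add: eps_def)
qed

lemma pset_tree:
  assumes "e \<in> T"
  shows "pset (head\<^sub>\<Lambda> e) = sym_diff (pset (tail\<^sub>\<Lambda> e)) (eps e)"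
proof -
  have e: "e \<in> arcs\<^sub>\<Lambda>"
    using assms T_arcs by simp
  have eps: "eps e = {(e, He e), (op e, He (op e))}"
    using e arc_rep[of "op e"] by (simp add: eps_def bar_arc st_tree[OF assms])
  show ?thesis
  proof (rule Set.set_eqI)
    fix y :: "'e \<times> 'a set"
    obtain f C where y: "y = (f, C)"
      by fastforce
    show "y \<in> pset (head\<^sub>\<Lambda> e) \<longleftrightarrow> y \<in> sym_diff (pset (tail\<^sub>\<Lambda> e)) (eps e)"
    proof (cases "f \<in> T \<and> C = He f")
      case True
      then show ?thesis
        using cut_arc[OF assms, of f] unfolding y eps pset_def by auto
    next
      case False
      then show ?thesis
        using assms T_opp unfolding y eps pset_def by auto
    qed
  qed
qed

text \<open>The first component counts crossings modulo 2 on a path from the lifted root to its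
  translate by the generator. For an element of the group at \<open>v\<close> the path runs through
  the lifted tree to \<open>v\<close>, which the element fixes, and returns through the translated
  tree. For a stable letter it runs to the tail of \<open>e\<close>, crosses \<open>e\<close>, and
  returns from the head through the tree translated by \<open>st e\<close>.\<close>

fun gen_sd :: "('v, 'e, 'g) pi1_gen \<Rightarrow> ('e \<times> 'a set) set \<times> 'a" where
  "gen_sd (Vert v g) = (sym_diff (pset v) (tr (vg v g) ` pset v), vg v g)"
| "gen_sd (Edge e) = (sym_diff (sym_diff (pset (tail\<^sub>\<Lambda> e)) (eps e)) (tr (st e) ` pset (head\<^sub>\<Lambda> e)), st e)"

lemma gen_sd_closed: "gen_sd \<in> pi1_gens \<Lambda> \<rightarrow> carrier sd"
proof
  fix x assume "x \<in> pi1_gens \<Lambda>"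
  then consider v g where "x = Vert v g" "v \<in> verts\<^sub>\<Lambda>" "g \<in> carrier (vgroup \<Lambda> v)" | e where "x = Edge e" "e \<in> arcs\<^sub>\<Lambda>"
    by (auto simp: pi1_gens_def)
  then show "gen_sd x \<in> carrier sd"
  proof cases
    case 1
    then show ?thesis
      using sdiff_E[OF pset_E[of v] tr_image_E[OF _ pset_E[of v], of "vg v g"]] by (simp add: sd_def)
  next
    case 2
    then show ?thesis
      using sdiff_E[OF sdiff_E[OF pset_E[of "tail\<^sub>\<Lambda> e"] eps_E[of e]] tr_image_E[OF _ pset_E[of "head\<^sub>\<Lambda> e"], of "st e"]]
      by (simp add: sd_def)
  qed
qed

lemma sd_mult: "(A, a) \<otimes>\<^bsub>sd\<^esub> (B, b) = (sym_diff A (tr a ` B), a \<otimes> b)"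
  by (simp add: sd_def)

lemma sd_cancel: "sym_diff (sym_diff A B) (sym_diff B C) = sym_diff A C"
  by blast

lemma sd_zero: "sym_diff (sym_diff (sym_diff A B) C) (sym_diff (sym_diff C B) A) = {}"
  by blast

text \<open>The crossings cancel along each relator: products in a vertex group telescope,
  \<open>op e\<close> retraces \<open>e\<close>, the edge group fixes the arc
  (\<open>eps_fixed\<close>), and on a tree arc the three terms cancel by
  \<open>pset_tree\<close>.\<close>

lemma gen_sd_relator:
  assumes r: "r \<in> pi1_relators \<Lambda> T" "r \<in> words (pi1_gens \<Lambda>)"
  shows "word_eval sd gen_sd r = \<one>\<^bsub>sd\<^esub>"
proof -
  interpret sd: group sd
    by (rule group_sd)
  note cl = funcset_mem[OF gen_sd_closed]
  consider (mult) v g h where "r = [(Vert v g, True), (Vert v h, True), (Vert v (g \<otimes>\<^bsub>vgroup \<Lambda> v\<^esub> h), False)]"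
      "v \<in> verts\<^sub>\<Lambda>" "g \<in> carrier (vgroup \<Lambda> v)" "h \<in> carrier (vgroup \<Lambda> v)"
    | (opp) e where "r = [(Edge e, True), (Edge (op e), True)]" "e \<in> arcs\<^sub>\<Lambda>"
    | (conj) e a where "r = [(Edge e, True), (Vert (head\<^sub>\<Lambda> e) (einj \<Lambda> e a), True), (Edge e, False),
        (Vert (tail\<^sub>\<Lambda> e) (einj \<Lambda> (op e) a), False)]" "e \<in> arcs\<^sub>\<Lambda>" "a \<in> carrier (egroup \<Lambda> e)"
    | (tree) e where "r = [(Edge e, True)]" "e \<in> T"
    using r(1) unfolding pi1_relators_def by auto
  then show ?thesis
  proof cases
    case mult
    have gh: "g \<otimes>\<^bsub>vgroup \<Lambda> v\<^esub> h \<in> carrier (vgroup \<Lambda> v)"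
      using mult vgroup_group by (simp add: group.is_monoid monoid.m_closed)
    have "gen_sd (Vert v g) \<otimes>\<^bsub>sd\<^esub> gen_sd (Vert v h) = gen_sd (Vert v (g \<otimes>\<^bsub>vgroup \<Lambda> v\<^esub> h))"
      using mult pset_E tr_image_E[OF _ pset_E]
      by (simp only: gen_sd.simps sd_mult vg_mult tr_image_sdiff tr_image_mult sd_cancel vg_closed)
    then show ?thesis
      using cl[OF gens(1)] mult gh unfolding mult(1) by (simp flip: sd.m_assoc)
  next
    case opp
    have E: "pset (tail\<^sub>\<Lambda> e) \<subseteq> E" "pset (head\<^sub>\<Lambda> e) \<subseteq> E" "eps (op e) \<subseteq> E" "st e \<in> carrier W" "inv (st e) \<in> carrier W"
      using pset_E opp eps_E[of "op e"] by auto
    have "tr (st e) ` tr (st (op e)) ` pset (tail\<^sub>\<Lambda> e) = pset (tail\<^sub>\<Lambda> e)"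
      using opp E by (simp add: st_opp tr_image_one flip: tr_image_mult)
    moreover have "tr (st e) ` sym_diff (sym_diff (pset (head\<^sub>\<Lambda> e)) (eps (op e))) (tr (st (op e)) ` pset (tail\<^sub>\<Lambda> e))
      = sym_diff (sym_diff (tr (st e) ` pset (head\<^sub>\<Lambda> e)) (tr (st e) ` eps (op e))) (tr (st e) ` tr (st (op e)) ` pset (tail\<^sub>\<Lambda> e))"
      using E opp tr_image_E[OF E(5,1)] by (simp only: tr_image_sdiff sdiff_E st_opp)
    ultimately have "gen_sd (Edge e) \<otimes>\<^bsub>sd\<^esub> gen_sd (Edge (op e)) = ({}, st e \<otimes> st (op e))"
      using opp by (simp only: gen_sd.simps sd_mult eps_opp sd_zero D.head_arev D.tail_arev)
    also have "\<dots> = \<one>\<^bsub>sd\<^esub>"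
      using opp by (simp add: st_opp sd_def)
    finally show ?thesis
      using cl[OF gens(2), of "op e"] opp(2) unfolding opp(1) by (simp del: gen_sd.simps)
  next
    case conj
    let ?h = "vg (head\<^sub>\<Lambda> e) (einj \<Lambda> e a)" and ?t = "vg (tail\<^sub>\<Lambda> e) (einj \<Lambda> (op e) a)"
    let ?P = "pset (tail\<^sub>\<Lambda> e)" and ?Q = "pset (head\<^sub>\<Lambda> e)"
    have ht: "?h \<in> carrier W" "?t \<in> carrier W" "st e \<in> carrier W"
      using conj einj_closed by auto
    have E: "?P \<subseteq> E" "?Q \<subseteq> E" "eps e \<subseteq> E" "tr ?h ` ?Q \<subseteq> E" "tr (st e) ` ?Q \<subseteq> E"
      using pset_E conj eps_E[of e] tr_image_E[OF _ pset_E] ht by auto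
    have 1: "tr (st e) ` sym_diff ?Q (tr ?h ` ?Q) = sym_diff (tr (st e) ` ?Q) (tr (st e \<otimes> ?h) ` ?Q)"
      using ht E by (simp only: tr_image_sdiff tr_image_mult)
    have 2: "tr ?t ` sym_diff (sym_diff ?P (eps e)) (tr (st e) ` ?Q) = sym_diff (sym_diff (tr ?t ` ?P) (eps e)) (tr (st e \<otimes> ?h) ` ?Q)"
      using ht E conj by (simp only: tr_image_sdiff tr_image_mult sdiff_E st_conj eps_fixed)
    have "gen_sd (Edge e) \<otimes>\<^bsub>sd\<^esub> gen_sd (Vert (head\<^sub>\<Lambda> e) (einj \<Lambda> e a)) =
      gen_sd (Vert (tail\<^sub>\<Lambda> e) (einj \<Lambda> (op e) a)) \<otimes>\<^bsub>sd\<^esub> gen_sd (Edge e)"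
      unfolding gen_sd.simps sd_mult 1 2 using st_conj[OF conj(2,3)] by auto
    then have "gen_sd (Edge e) \<otimes>\<^bsub>sd\<^esub> gen_sd (Vert (head\<^sub>\<Lambda> e) (einj \<Lambda> e a)) \<otimes>\<^bsub>sd\<^esub>
      inv\<^bsub>sd\<^esub> (gen_sd (Vert (tail\<^sub>\<Lambda> e) (einj \<Lambda> (op e) a)) \<otimes>\<^bsub>sd\<^esub> gen_sd (Edge e)) = \<one>\<^bsub>sd\<^esub>"
      using cl[OF gens(1)] cl[OF gens(2)] conj einj_closed[OF conj(2,3)] by (simp del: gen_sd.simps)
    then show ?thesis
      using cl[OF gens(1)] cl[OF gens(2)] conj einj_closed[OF conj(2,3)] unfolding conj(1)
      by (simp add: sd.inv_mult_group sd.m_assoc del: gen_sd.simps)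
  next
    case tree
    have "gen_sd (Edge e) = \<one>\<^bsub>sd\<^esub>"
      by (simp add: st_tree[OF tree(2)] tr_image_one[OF pset_E] flip: pset_tree[OF tree(2)]) (simp add: sd_def)
    then show ?thesis
      unfolding tree(1) by simp
  qed
qed

lemma derivation:
  obtains d where "\<And>g. g \<in> carrier W \<Longrightarrow> d g \<subseteq> E"
    "\<And>g h. g \<in> carrier W \<Longrightarrow> h \<in> carrier W \<Longrightarrow> d (g \<otimes> h) = sym_diff (d g) (tr g ` d h)"
    "\<And>x. x \<in> pi1_gens \<Lambda> \<Longrightarrow> d (gen x) = fst (gen_sd x)"
proof -
  let ?P = "presented_group (pi1_gens \<Lambda>) (pi1_relators \<Lambda> T)"
  let ?c = "\<lambda>x. word_class (pi1_gens \<Lambda>) (pi1_relators \<Lambda> T) [(x, True)]"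
  obtain \<theta> where \<theta>: "\<theta> \<in> hom ?P sd" "\<And>x. x \<in> pi1_gens \<Lambda> \<Longrightarrow> \<theta> (?c x) = gen_sd x"
    using presented_group_hom[OF group_sd gen_sd_closed gen_sd_relator] by blast
  have phi: "\<phi> \<in> iso ?P W"
    using iso by (simp add: pi1_def)
  \<comment> \<open>The second component agrees with \<phi> on generators, hence everywhere; so the
    twist in the product rule is translation by the element of \<open>W\<close> itself.\<close>
  have snd: "snd (\<theta> a) = \<phi> a" if "a \<in> carrier ?P" for a
  proof -
    have "snd \<circ> \<theta> \<in> hom ?P W"
    proof (rule Group.hom_compose[OF \<theta>(1)])
      show "snd \<in> hom sd W"
        by (rule homI) (auto simp: sd_def)
    qed
    moreover have "(snd \<circ> \<theta>) (?c x) = \<phi> (?c x)" if "x \<in> pi1_gens \<Lambda>" for x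
      using \<theta>(2)[OF that] by (cases x) (simp_all add: vg_def st_def pi1_class_def)
    ultimately show ?thesis
      using presented_group_hom_eqI[OF group_axioms, of "snd \<circ> \<theta>" _ _ \<phi>] phi that by (auto simp: iso_def)
  qed
  define \<psi> where "\<psi> = inv_into (carrier ?P) \<phi>"
  have psi: "\<psi> \<in> iso W ?P"
    using group.iso_set_sym[OF group_presented_group phi] by (simp add: \<psi>_def)
  have psi_car: "\<psi> g \<in> carrier ?P" "\<phi> (\<psi> g) = g" if "g \<in> carrier W" for g
    using psi phi that by (auto simp: iso_def hom_def \<psi>_def bij_betw_def f_inv_into_f)
  have psi_gen: "\<psi> (gen x) = ?c x" if "x \<in> pi1_gens \<Lambda>" for x
    using phi that by (simp add: \<psi>_def gen_def pi1_class_def iso_def bij_betw_def word_class_in_carrier)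
  show thesis
  proof
    show "fst (\<theta> (\<psi> g)) \<subseteq> E" if "g \<in> carrier W" for g
      using \<theta>(1) psi_car[OF that] by (force simp: hom_def sd_def)
    show "fst (\<theta> (\<psi> (g \<otimes> h))) = sym_diff (fst (\<theta> (\<psi> g))) (tr g ` fst (\<theta> (\<psi> h)))"
      if "g \<in> carrier W" "h \<in> carrier W" for g h
    proof -
      have "\<theta> (\<psi> (g \<otimes> h)) = \<theta> (\<psi> g) \<otimes>\<^bsub>sd\<^esub> \<theta> (\<psi> h)"
        using Group.hom_mult[of \<psi> W ?P, OF _ that] psi
          Group.hom_mult[OF \<theta>(1) psi_car(1)[OF that(1)] psi_car(1)[OF that(2)]]
        by (simp add: iso_def)
      moreover have "snd (\<theta> (\<psi> g)) = g"
        using snd psi_car that by simp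
      ultimately show ?thesis
        by (cases "\<theta> (\<psi> g)", cases "\<theta> (\<psi> h)") (simp add: sd_mult)
    qed
    show "fst (\<theta> (\<psi> (gen x))) = fst (gen_sd x)" if "x \<in> pi1_gens \<Lambda>" for x
      using psi_gen \<theta>(2) that by simp
  qed
qed

lemma tree_action:
  obtains P where "tree_action W V E src tgt bar tr tr P"
proof -
  obtain d where d_E: "\<And>g. g \<in> carrier W \<Longrightarrow> d g \<subseteq> E"
    and d_mult: "\<And>g h. g \<in> carrier W \<Longrightarrow> h \<in> carrier W \<Longrightarrow> d (g \<otimes> h) = sym_diff (d g) (tr g ` d h)"
    and d_gen: "\<And>x. x \<in> pi1_gens \<Lambda> \<Longrightarrow> d (gen x) = fst (gen_sd x)"
    using derivation by metis
  \<comment> \<open>Crossings on a path from the lifted root to its translate by \<open>g\<close>,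
    continued through the translated tree to \<open>v\<close>. Another representative differs by an
    element of \<open>Hv v\<close>, whose derivation cancels the change of the tree part.\<close>
  define P where "P = (\<lambda>(v, C). let g = (SOME g. g \<in> carrier W \<and> C = g <# Hv v) in sym_diff (d g) (tr g ` pset v))"
  have P_rep: "P (v, g <# Hv v) = sym_diff (d g) (tr g ` pset v)" if v: "v \<in> verts\<^sub>\<Lambda>" and g: "g \<in> carrier W" for v g
  proof -
    let ?g = "SOME h. h \<in> carrier W \<and> g <# Hv v = h <# Hv v"
    have g': "?g \<in> carrier W" "g <# Hv v = ?g <# Hv v"
      using someI[of "\<lambda>h. h \<in> carrier W \<and> g <# Hv v = h <# Hv v" g] g by auto
    then obtain k where k: "k \<in> carrier (vgroup \<Lambda> v)" "?g = g \<otimes> vg v k"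
      using lcos_eq_iff[OF Hv_subgroup[OF v] g, of ?g] by (auto simp: Hv_def)
    have "d ?g = sym_diff (d g) (tr g ` sym_diff (pset v) (tr (vg v k) ` pset v))"
      using k v g d_gen[OF gens(1)[OF v k(1)]] by (simp add: d_mult)
    also have "\<dots> = sym_diff (d g) (sym_diff (tr g ` pset v) (tr ?g ` pset v))"
      using k v g pset_E tr_image_E[OF _ pset_E] by (simp only: tr_image_sdiff tr_image_mult vg_closed)
    finally have "sym_diff (d ?g) (tr ?g ` pset v) = sym_diff (d g) (tr g ` pset v)"
      by blast
    then show ?thesis
      by (simp add: P_def Let_def)
  qed
  have P_E: "P x \<subseteq> E" if "x \<in> V" for x
    using that
  proof (rule V_cases)
    fix v g assume x: "x = (v, g <# Hv v)" "v \<in> verts\<^sub>\<Lambda>" "g \<in> carrier W"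
    then show ?thesis
      using sdiff_E[OF d_E[OF x(3)] tr_image_E[OF x(3) pset_E[of v]]] by (simp add: P_rep)
  qed
  \<comment> \<open>The correction \<open>d g\<close> is the same for all vertices, so it drops out
    when two of them are compared.\<close>
  have P_tr: "P (tr g x) = sym_diff (d g) (tr g ` P x)" if "g \<in> carrier W" "x \<in> V" for g x
    using that(2)
  proof (rule V_cases)
    fix v h assume x: "x = (v, h <# Hv v)" "v \<in> verts\<^sub>\<Lambda>" "h \<in> carrier W"
    have "P (tr g x) = sym_diff (sym_diff (d g) (tr g ` d h)) (tr g ` tr h ` pset v)"
      using x that(1) Hv_carrier pset_E by (simp add: tr_rep P_rep d_mult tr_image_mult)
    also have "\<dots> = sym_diff (d g) (tr g ` sym_diff (d h) (tr h ` pset v))"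
      using x that(1) d_E pset_E tr_image_E by (simp only: tr_image_sdiff sdiff_assoc)
    finally show ?thesis
      using x by (simp add: P_rep)
  qed
  have P_tgt: "P (tgt y) = sym_diff (P (src y)) {y, bar y}" if "y \<in> E" for y
    using that
  proof (rule E_cases)
    fix e g assume y: "y = (e, g <# He e)" "e \<in> arcs\<^sub>\<Lambda>" "g \<in> carrier W"
    let ?P = "pset (tail\<^sub>\<Lambda> e)" and ?Q = "pset (head\<^sub>\<Lambda> e)"
    have E: "?P \<subseteq> E" "?Q \<subseteq> E" "eps e \<subseteq> E" "tr (st e) ` ?Q \<subseteq> E" "sym_diff ?P (eps e) \<subseteq> E"
      using y pset_E eps_E tr_image_E[OF st_closed pset_E] sdiff_E[OF pset_E eps_E] by auto
    have "P (tgt y) = sym_diff (sym_diff (d g) (tr g ` sym_diff (sym_diff ?P (eps e)) (tr (st e) ` ?Q))) (tr g ` tr (st e) ` ?Q)"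
      using y E d_gen[OF gens(2)[OF y(2)]] by (simp add: tgt_rep P_rep d_mult tr_image_mult)
    also have "tr g ` sym_diff (sym_diff ?P (eps e)) (tr (st e) ` ?Q) =
        sym_diff (sym_diff (tr g ` ?P) (tr g ` eps e)) (tr g ` tr (st e) ` ?Q)"
      using y E by (simp only: tr_image_sdiff)
    also have "tr g ` eps e = {y, bar y}"
      using y by (simp add: tr_eps)
    also have "sym_diff (sym_diff (d g) (sym_diff (sym_diff (tr g ` ?P) {y, bar y}) (tr g ` tr (st e) ` ?Q))) (tr g ` tr (st e) ` ?Q)
        = sym_diff (sym_diff (d g) (tr g ` ?P)) {y, bar y}"
      by blast
    also have "sym_diff (d g) (tr g ` ?P) = P (src y)"
      using y by (simp add: src_rep P_rep)
    finally show ?thesis .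
  qed
  have src_V: "src y \<in> V" if "y \<in> E" for y
    using that by (rule E_cases) (auto simp: src_rep intro!: V_E)
  have "tree_action W V E src tgt bar tr tr P"
  proof (unfold_locales)
    show "V \<noteq> {}"
      using V_E(1)[OF root one_closed] by blast
    show "src (bar y) = tgt y" for y
      by (simp add: tgt_def)
    show "(y \<in> P (tgt x)) = ((y \<in> P (src x)) \<noteq> (y = x \<or> y = bar x))" if "x \<in> E" for x y
      unfolding P_tgt[OF that] by blast
    show "((tr g y \<in> P (tr g u)) = (tr g y \<in> P (tr g v))) = ((y \<in> P u) = (y \<in> P v))"
      if "g \<in> carrier W" "y \<in> E" "u \<in> V" "v \<in> V" for g y u v
    proof -
      have "tr g y \<in> tr g ` P x \<longleftrightarrow> y \<in> P x" if "x \<in> V" for x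
        using mem_tr_image[OF \<open>g \<in> carrier W\<close> P_E[OF that], of "tr g y"] tr_E tr_inv_E(1) \<open>g \<in> carrier W\<close> \<open>y \<in> E\<close> by simp
      then show ?thesis
        using that P_tr[of g u] P_tr[of g v] by auto
    qed
    \<comment> \<open>Translation keeps the label of an arc, whereas reversal changes it.\<close>
    show "tr g y \<noteq> bar y" if g: "g \<in> carrier W" and yE: "y \<in> E" for g y
    proof -
      obtain e h where y: "y = (e, h <# He e)" "e \<in> arcs\<^sub>\<Lambda>" "h \<in> carrier W"
        using yE by (rule E_cases)
      then have "op e \<noteq> e"
        using D.arev_neq by simp
      then show ?thesis
        using y by (simp add: tr_def bar_def)
    qed
  qed (use src_V bar_E bar_bar tr_V tr_mult_V tr_one_V tr_E tr_mult_E tr_one_E src_tr bar_tr connected in auto)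
  then show thesis
    by (rule that)
qed

text \<open>The stabilizer of a coset of \<open>He e\<close> lies in a conjugate of
  \<open>He e\<close>, which is an image of the finite edge group.\<close>

lemma arc_stabilizer_finite:
  assumes "\<And>e. e \<in> arcs\<^sub>\<Lambda> \<Longrightarrow> finite (carrier (egroup \<Lambda> e))" "y \<in> E"
  shows "finite {g \<in> carrier W. tr g y = y}"
  using assms(2)
proof (rule E_cases)
  fix e h assume y: "y = (e, h <# He e)" "e \<in> arcs\<^sub>\<Lambda>" "h \<in> carrier W"
  have "{g \<in> carrier W. tr g y = y} \<subseteq> (\<lambda>k. h \<otimes> k \<otimes> inv h) ` He e"
  proof
    fix g assume "g \<in> {g \<in> carrier W. tr g y = y}"
    then have g: "g \<in> carrier W" "h <# He e = (g \<otimes> h) <# He e"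
      using y tr_rep[of g h "He e" e] He_carrier[OF y(2)] by auto
    then obtain k where k: "k \<in> He e" "g \<otimes> h = h \<otimes> k"
      using lcos_eq_iff[OF He_subgroup[OF y(2)] y(3), of "g \<otimes> h"] y(3) by auto
    have "g = g \<otimes> h \<otimes> inv h"
      using g y by (simp add: m_assoc)
    then show "g \<in> (\<lambda>k. h \<otimes> k \<otimes> inv h) ` He e"
      using k by auto
  qed
  moreover have "finite (He e)"
    using assms(1)[OF y(2)] by (simp add: He_def)
  ultimately show ?thesis
    using finite_surj by blast
qed

text \<open>The fixed vertex is a coset \<open>w <# Hv u\<close>, and whatever fixes it lies in the
  conjugate of \<open>Hv u\<close> by \<open>w\<close>.\<close>

theorem unsplit_in_conjugate:
  assumes fin: "\<And>e. e \<in> arcs\<^sub>\<Lambda> \<Longrightarrow> finite (carrier (egroup \<Lambda> e))"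
    and A: "finite A" "A \<subseteq> carrier W" "\<And>s. s \<in> A \<Longrightarrow> s \<otimes> s = \<one>" "unsplit W A"
  shows "\<exists>u\<in>verts\<^sub>\<Lambda>. \<exists>w\<in>carrier W. generate W A \<subseteq> (w <# (\<phi> ` pi1_vgroup \<Lambda> T u)) #> inv w"
proof -
  obtain P where "tree_action W V E src tgt bar tr tr P"
    by (rule tree_action)
  then interpret tree_action W V E src tgt bar tr tr P .
  obtain x where x: "x \<in> V" "\<And>s. s \<in> A \<Longrightarrow> tr s x = x"
    using unsplit_fixes_vertex[OF A arc_stabilizer_finite[OF fin]] by blast
  obtain u w where u: "x = (u, w <# Hv u)" "u \<in> verts\<^sub>\<Lambda>" "w \<in> carrier W"
    using x(1) by (rule V_cases)
  have "g \<in> carrier W \<and> tr g x = x" if "g \<in> generate W A" for g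
    using that
  proof (induction rule: generate.induct)
    case one
    then show ?case
      using tr_one_V x by simp
  next
    case (incl h)
    then show ?case
      using x A by auto
  next
    case (inv h)
    then have "inv h = h"
      using A by (intro involution_inv) auto
    then show ?case
      using inv x A by auto
  next
    case (eng g h)
    then show ?case
      using tr_mult_V x by simp
  qed
  then have stab: "g \<in> carrier W" "w <# Hv u = (g \<otimes> w) <# Hv u" if "g \<in> generate W A" for g
    using that u tr_rep[of g w "Hv u" u] Hv_carrier by auto
  have "generate W A \<subseteq> (w <# Hv u) #> inv w"
  proof
    fix g assume g: "g \<in> generate W A"
    obtain k where k: "k \<in> Hv u" "g \<otimes> w = w \<otimes> k"
      using lcos_eq_iff[OF Hv_subgroup[OF u(2)] u(3), of "g \<otimes> w"] stab[OF g] u(3) by auto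
    have "g = w \<otimes> k \<otimes> inv w"
      using k(2) stab(1)[OF g] u(3) by (simp add: m_assoc flip: k(2))
    then show "g \<in> (w <# Hv u) #> inv w"
      unfolding l_coset_def r_coset_def using k(1) by blast
  qed
  then show ?thesis
    unfolding Hv_eq using u by blast
qed

end

section \<open>Tree decompositions of the generating set\<close>

text \<open>Adjacent elements outside a separator lie in the same component, so a splitting never
  cuts a clique. Separators and the generators of a single Coxeter relator are both cliques.\<close>

definition clique :: "('a, 'b) monoid_scheme \<Rightarrow> 'a set \<Rightarrow> bool" where
  "clique W C \<longleftrightarrow> (\<forall>s\<in>C. \<forall>t\<in>C. fin_prod W s t)"

lemma (in group) clique_finite_generate:
  assumes "C \<subseteq> carrier G" "finite (generate G C)"
  shows "clique G C"
  unfolding clique_def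
proof (intro ballI)
  fix s t assume st: "s \<in> C" "t \<in> C"
  let ?H = "subgroup_generated G C"
  interpret H: group ?H
    by (rule group_subgroup_generated)
  have car: "carrier ?H = generate G C"
    using assms by (simp add: carrier_subgroup_generated Int_absorb1)
  have "s \<otimes> t \<in> carrier ?H"
    using st car by (auto intro: generate.intros)
  then have "0 < H.ord (s \<otimes> t)" "(s \<otimes> t) [^]\<^bsub>?H\<^esub> H.ord (s \<otimes> t) = \<one>\<^bsub>?H\<^esub>"
    using H.ord_ge_1[of "s \<otimes> t"] assms(2) car by auto
  then show "fin_prod G s t"
    unfolding fin_prod_def by (auto simp: pow_subgroup_generated)
qed

text \<open>A tree decomposition of the set \<open>A\<close> of generators, listed so that each bag meets the union of
  the preceding ones inside a single preceding bag.\<close>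

definition bag_list :: "('a, 'b) monoid_scheme \<Rightarrow> 'a set \<Rightarrow> 'a set list \<Rightarrow> bool" where
  "bag_list W A L \<longleftrightarrow> L \<noteq> [] \<and> \<Union> (set L) = A \<and> (\<forall>B\<in>set L. unsplit W B) \<and>
    (\<forall>C\<subseteq>A. clique W C \<longrightarrow> (\<exists>B\<in>set L. C \<subseteq> B)) \<and>
    (\<forall>i. 0 < i \<and> i < length L \<longrightarrow>
      finite (generate W (L ! i \<inter> \<Union> (set (take i L)))) \<and>
      (\<exists>j<i. L ! i \<inter> \<Union> (set (take i L)) \<subseteq> L ! j))"

lemma bag_list_sep:
  assumes "bag_list W A L" "0 < i" "i < length L"
  shows "finite (generate W (L ! i \<inter> \<Union> (set (take i L))))"
    "\<exists>j<i. L ! i \<inter> \<Union> (set (take i L)) \<subseteq> L ! j"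
  using assms by (simp_all add: bag_list_def)

text \<open>The first bag of the second list contains \<open>C\<close> and is attached to a bag of
  the first list that contains the clique \<open>C\<close>. Later bags of the second list meet
  \<open>A\<^sub>1\<close> only within \<open>C\<close>, which that first bag already covers, so
  their separators are unchanged.\<close>

lemma bag_list_append:
  assumes 1: "bag_list W A\<^sub>1 L\<^sub>1" and 2: "bag_list W A\<^sub>2 L\<^sub>2"
    and C: "A\<^sub>1 \<inter> A\<^sub>2 = C" "finite (generate W C)" "clique W C" "C \<subseteq> hd L\<^sub>2"
    and cl: "\<And>K. K \<subseteq> A\<^sub>1 \<union> A\<^sub>2 \<Longrightarrow> clique W K \<Longrightarrow> K \<subseteq> A\<^sub>1 \<or> K \<subseteq> A\<^sub>2"
  shows "bag_list W (A\<^sub>1 \<union> A\<^sub>2) (L\<^sub>1 @ L\<^sub>2)"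
proof -
  let ?L = "L\<^sub>1 @ L\<^sub>2" and ?n = "length L\<^sub>1"
  have L: "L\<^sub>1 \<noteq> []" "L\<^sub>2 \<noteq> []" "\<Union> (set L\<^sub>1) = A\<^sub>1" "\<Union> (set L\<^sub>2) = A\<^sub>2"
    using 1 2 by (auto simp: bag_list_def)
  have sep: "finite (generate W (?L ! i \<inter> \<Union> (set (take i ?L)))) \<and> (\<exists>j<i. ?L ! i \<inter> \<Union> (set (take i ?L)) \<subseteq> ?L ! j)"
    if i: "0 < i" "i < length ?L" for i
  proof (cases "i < ?n")
    case True
    then have "finite (generate W (L\<^sub>1 ! i \<inter> \<Union> (set (take i L\<^sub>1))))"
      "\<exists>j<i. L\<^sub>1 ! i \<inter> \<Union> (set (take i L\<^sub>1)) \<subseteq> L\<^sub>1 ! j"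
      using bag_list_sep[OF 1 i(1)] by simp_all
    moreover have "?L ! i = L\<^sub>1 ! i" "take i ?L = take i L\<^sub>1" "\<And>j. j < i \<Longrightarrow> ?L ! j = L\<^sub>1 ! j"
      using True by (auto simp: nth_append)
    ultimately show ?thesis
      by metis
  next
    case False
    then obtain k where k: "i = ?n + k"
      using le_Suc_ex not_less by blast
    have bag: "?L ! i = L\<^sub>2 ! k" "\<Union> (set (take i ?L)) = A\<^sub>1 \<union> \<Union> (set (take k L\<^sub>2))" "k < length L\<^sub>2"
      using k i L by (auto simp: nth_append)
    show ?thesis
    proof (cases k)
      case 0
      have "L\<^sub>2 ! k \<subseteq> A\<^sub>2" "C \<subseteq> L\<^sub>2 ! k"
        using L(4) bag(3) C(4) L(2) 0 by (auto simp: hd_conv_nth)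
      then have eq: "?L ! i \<inter> \<Union> (set (take i ?L)) = C"
        using C(1) 0 unfolding bag by auto
      have "C \<subseteq> A\<^sub>1"
        using C(1) by auto
      then obtain B where "B \<in> set L\<^sub>1" "C \<subseteq> B"
        using 1 C(3) unfolding bag_list_def by blast
      then obtain j where "j < ?n" "C \<subseteq> L\<^sub>1 ! j"
        by (metis in_set_conv_nth)
      then show ?thesis
        unfolding eq using C(2) k 0 by (auto simp: nth_append)
    next
      case (Suc k')
      have "hd L\<^sub>2 \<in> set (take k L\<^sub>2)"
        using L(2) Suc by (cases L\<^sub>2) auto
      then have "C \<subseteq> \<Union> (set (take k L\<^sub>2))"
        using C(4) by blast
      moreover have "L\<^sub>2 ! k \<inter> A\<^sub>1 \<subseteq> C"
        using L(4) bag(3) C(1) nth_mem by blast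
      ultimately have eq: "?L ! i \<inter> \<Union> (set (take i ?L)) = L\<^sub>2 ! k \<inter> \<Union> (set (take k L\<^sub>2))"
        unfolding bag by blast
      have "0 < k"
        using Suc by simp
      note sep\<^sub>2 = bag_list_sep[OF 2 this bag(3)]
      have fin: "finite (generate W (L\<^sub>2 ! k \<inter> \<Union> (set (take k L\<^sub>2))))"
        and "\<exists>j<k. L\<^sub>2 ! k \<inter> \<Union> (set (take k L\<^sub>2)) \<subseteq> L\<^sub>2 ! j"
        using sep\<^sub>2 by simp_all
      then obtain j where "j < k" "L\<^sub>2 ! k \<inter> \<Union> (set (take k L\<^sub>2)) \<subseteq> L\<^sub>2 ! j"
        by blast
      then have "?n + j < i \<and> L\<^sub>2 ! k \<inter> \<Union> (set (take k L\<^sub>2)) \<subseteq> ?L ! (?n + j)"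
        using k by simp
      then show ?thesis
        unfolding eq using fin by blast
    qed
  qed
  have cliques: "\<exists>B\<in>set ?L. K \<subseteq> B" if K: "K \<subseteq> A\<^sub>1 \<union> A\<^sub>2" "clique W K" for K
  proof -
    have "(\<exists>B\<in>set L\<^sub>1. K \<subseteq> B) \<or> (\<exists>B\<in>set L\<^sub>2. K \<subseteq> B)"
      using cl[OF K] 1 2 K(2) unfolding bag_list_def by metis
    then show ?thesis
      by auto
  qed
  have uns: "\<forall>B\<in>set ?L. unsplit W B"
    using 1 2 unfolding bag_list_def by auto
  have un: "\<Union> (set ?L) = A\<^sub>1 \<union> A\<^sub>2" "?L \<noteq> []"
    using L by auto
  show ?thesis
    unfolding bag_list_def
  proof (intro conjI)
    show "\<forall>C\<subseteq>A\<^sub>1 \<union> A\<^sub>2. clique W C \<longrightarrow> (\<exists>B\<in>set ?L. C \<subseteq> B)"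
      using cliques by blast
    show "\<forall>i. 0 < i \<and> i < length ?L \<longrightarrow> finite (generate W (?L ! i \<inter> \<Union> (set (take i ?L)))) \<and>
      (\<exists>j<i. ?L ! i \<inter> \<Union> (set (take i ?L)) \<subseteq> ?L ! j)"
      using sep by blast
  qed (use un uns in auto)
qed

text \<open>The prescribed clique \<open>K\<close> strengthens the induction: the list for one half
  of a splitting must begin with a bag containing the separator, so that it can be appended to the
  list for the other half.\<close>

lemma bag_list_exists:
  assumes "group W" "finite A" "A \<subseteq> carrier W" "K \<subseteq> A" "clique W K"
  shows "\<exists>L. bag_list W A L \<and> K \<subseteq> hd L"
  using assms(2-)
proof (induction A arbitrary: K rule: finite_psubset_induct)
  case (psubset A)
  show ?case
  proof (cases "unsplit W A")
    case True
    then have "bag_list W A [A]"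
      by (auto simp: bag_list_def)
    then show ?thesis
      using psubset.prems by (intro exI[of _ "[A]"]) auto
  next
    case False
    then obtain C s t where C: "C \<subseteq> A" "finite (generate W C)" and st: "s \<in> A - C" "t \<in> A - C"
      and nconn: "(s, t) \<notin> {(a, b). a \<in> A - C \<and> b \<in> A - C \<and> fin_prod W a b}\<^sup>*"
      unfolding unsplit_def by blast
    let ?R = "{(a, b). a \<in> A - C \<and> b \<in> A - C \<and> fin_prod W a b}"
    \<comment> \<open>The separator together with the component of \<open>s\<close>, and together
      with all other components.\<close>
    define A\<^sub>1 where "A\<^sub>1 = C \<union> {x \<in> A - C. (s, x) \<in> ?R\<^sup>*}"
    define A\<^sub>2 where "A\<^sub>2 = C \<union> {x \<in> A - C. (s, x) \<notin> ?R\<^sup>*}"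
    have un: "A\<^sub>1 \<union> A\<^sub>2 = A" "A\<^sub>2 \<union> A\<^sub>1 = A" and int: "A\<^sub>1 \<inter> A\<^sub>2 = C" "A\<^sub>2 \<inter> A\<^sub>1 = C"
      using C(1) by (auto simp: A\<^sub>1_def A\<^sub>2_def)
    have "t \<notin> A\<^sub>1" "s \<notin> A\<^sub>2"
      using st nconn by (auto simp: A\<^sub>1_def A\<^sub>2_def)
    then have sub: "A\<^sub>1 \<subset> A" "A\<^sub>2 \<subset> A"
      using st un by auto
    have car: "A\<^sub>1 \<subseteq> carrier W" "A\<^sub>2 \<subseteq> carrier W" "C \<subseteq> carrier W"
      using sub C(1) psubset.prems(1) by auto
    have C_cl: "clique W C"
      using group.clique_finite_generate[OF assms(1) car(3) C(2)] .
    have cl: "K \<subseteq> A\<^sub>1 \<or> K \<subseteq> A\<^sub>2" if K: "K \<subseteq> A" "clique W K" for K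
    proof (rule ccontr)
      assume "\<not> (K \<subseteq> A\<^sub>1 \<or> K \<subseteq> A\<^sub>2)"
      then obtain x y where xy: "x \<in> K" "x \<notin> A\<^sub>1" "y \<in> K" "y \<notin> A\<^sub>2"
        by blast
      then have "x \<in> A - C" "(s, x) \<notin> ?R\<^sup>*" "y \<in> A - C" "(s, y) \<in> ?R\<^sup>*"
        using K(1) by (auto simp: A\<^sub>1_def A\<^sub>2_def)
      moreover have "fin_prod W y x"
        using K(2) xy by (auto simp: clique_def)
      ultimately show False
        by (metis (mono_tags, lifting) case_prodI mem_Collect_eq rtrancl.rtrancl_into_rtrancl)
    qed
    have CA: "C \<subseteq> A\<^sub>1" "C \<subseteq> A\<^sub>2"
      by (auto simp: A\<^sub>1_def A\<^sub>2_def)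
    \<comment> \<open>The half \<open>B\<close> containing \<open>K\<close> comes first and keeps
      \<open>K\<close> in the head; the other half is listed with the separator in its head.\<close>
    have glue: "\<exists>L. bag_list W A L \<and> K \<subseteq> hd L"
      if B: "B \<union> B' = A" "B \<inter> B' = C" "B \<subset> A" "B' \<subset> A" "K \<subseteq> B" "C \<subseteq> B'"
        "B \<subseteq> carrier W" "B' \<subseteq> carrier W"
        "\<And>K. K \<subseteq> A \<Longrightarrow> clique W K \<Longrightarrow> K \<subseteq> B \<or> K \<subseteq> B'" for B B'
    proof -
      obtain L where L: "bag_list W B L" "K \<subseteq> hd L"
        using psubset.IH[OF B(3,7,5)] psubset.prems(3) by blast
      obtain L' where L': "bag_list W B' L'" "C \<subseteq> hd L'"
        using psubset.IH[OF B(4,8,6) C_cl] by blast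
      have "bag_list W (B \<union> B') (L @ L')"
        using B(9) by (intro bag_list_append[OF L(1) L'(1) B(2) C(2) C_cl L'(2)]) (simp_all add: B(1))
      moreover have "hd (L @ L') = hd L"
        using L(1) by (simp add: bag_list_def)
      ultimately show ?thesis
        using L(2) B(1) by auto
    qed
    from cl[OF psubset.prems(2,3)] show ?thesis
    proof
      assume "K \<subseteq> A\<^sub>1"
      then show ?thesis
        using un int sub CA car cl by (intro glue[of A\<^sub>1 A\<^sub>2])
    next
      assume "K \<subseteq> A\<^sub>2"
      then show ?thesis
        using un int sub CA car cl[THEN disj_commute[THEN iffD1]] by (intro glue[of A\<^sub>2 A\<^sub>1])
    qed
  qed
qed

section \<open>The visual decomposition\<close>

locale bag_tree = group W for W :: "'a monoid" (structure) +
  fixes S :: "'a set" and L :: "'a set list" and p :: "nat \<Rightarrow> nat"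
  assumes cox: "coxeter_system W S"
    and bags: "bag_list W S L"
    and parent: "0 < i \<Longrightarrow> i < length L \<Longrightarrow> p i < i \<and> L ! i \<inter> \<Union> (set (take i L)) \<subseteq> L ! p i"
begin

abbreviation "n \<equiv> length L"

definition sepr :: "nat \<Rightarrow> 'a set" where
  "sepr i = L ! i \<inter> \<Union> (set (take i L))"

text \<open>The arcs \<open>2 i\<close> and \<open>2 i + 1\<close> run from the bag \<open>i > 0\<close> to its parent and back.\<close>

definition \<Psi> :: "(nat, nat, 'a, 'a) graph_of_groups" where
  "\<Psi> = \<lparr> base = \<lparr>verts = {..<n}, arcs = {2..<2 * n},
        tail = (\<lambda>e. if even e then e div 2 else p (e div 2)),
        head = (\<lambda>e. if even e then p (e div 2) else e div 2)\<rparr>,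
      opp = (\<lambda>e. if e \<in> {2..<2 * n} then if even e then e + 1 else e - 1 else e),
      vgroup = (\<lambda>i. subgroup_generated W (L ! i)),
      egroup = (\<lambda>e. subgroup_generated W (sepr (e div 2))),
      einj = (\<lambda>e a. a) \<rparr>"

abbreviation "T\<^sub>\<Psi> \<equiv> {2..<2 * n}"

lemma \<Psi>_simps [simp]:
  "verts (base \<Psi>) = {..<n}" "arcs (base \<Psi>) = {2..<2 * n}"
  "tail (base \<Psi>) e = (if even e then e div 2 else p (e div 2))"
  "head (base \<Psi>) e = (if even e then p (e div 2) else e div 2)"
  "opp \<Psi> e = (if e \<in> {2..<2 * n} then if even e then e + 1 else e - 1 else e)"
  "vgroup \<Psi> i = subgroup_generated W (L ! i)"
  "egroup \<Psi> e = subgroup_generated W (sepr (e div 2))"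
  "einj \<Psi> e a = a"
  by (simp_all add: \<Psi>_def)

section \<open>The graph of groups of the bags\<close>

lemma S_carrier: "S \<subseteq> carrier W"
  using cox by (simp add: coxeter_system_def)

lemma L_S: "i < n \<Longrightarrow> L ! i \<subseteq> S"
  using bags by (auto simp: bag_list_def)

lemma n_pos: "0 < n"
  using bags by (simp add: bag_list_def)

lemma L_carrier: "i < n \<Longrightarrow> L ! i \<subseteq> carrier W"
  using L_S S_carrier by blast

lemma carrier_bag: "i < n \<Longrightarrow> carrier (subgroup_generated W (L ! i)) = generate W (L ! i)"
  using L_carrier by (simp add: carrier_subgroup_generated Int_absorb1)

lemma sepr_S: "i < n \<Longrightarrow> sepr i \<subseteq> S"
  using L_S by (auto simp: sepr_def)

lemma carrier_sepr: "i < n \<Longrightarrow> carrier (subgroup_generated W (sepr i)) = generate W (sepr i)"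
  using subset_trans[OF sepr_S S_carrier, of i] by (simp add: carrier_subgroup_generated Int_absorb1)

lemma arc_index: "e \<in> {2..<2 * n} \<Longrightarrow> 0 < e div 2 \<and> e div 2 < n"
  by auto

lemma arc_ends: "e \<in> {2..<2 * n} \<Longrightarrow> p (e div 2) < e div 2 \<and> e div 2 < n \<and> p (e div 2) < n"
  using arc_index[of e] parent[of "e div 2"] by auto

lemma opp_div: "opp \<Psi> e div 2 = e div 2"
  by (auto elim!: evenE oddE)

lemma opp_even: "e \<in> {2..<2 * n} \<Longrightarrow> even (opp \<Psi> e) \<longleftrightarrow> odd e"
  by auto

lemma opp_arc: "e \<in> {2..<2 * n} \<Longrightarrow> opp \<Psi> e \<in> {2..<2 * n}"
  by (auto elim!: evenE oddE)

lemma opp_opp: "opp \<Psi> (opp \<Psi> e) = e"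
  by (auto elim!: evenE oddE)

lemma bidirected: "bidirected_digraph (base \<Psi>) (opp \<Psi>)"
proof
  fix e assume e: "e \<in> arcs (base \<Psi>)"
  show "tail (base \<Psi>) e \<in> verts (base \<Psi>)" "head (base \<Psi>) e \<in> verts (base \<Psi>)"
    using arc_ends[of e] e by auto
  show "opp \<Psi> (opp \<Psi> e) = e"
    by (rule opp_opp)
  show "tail (base \<Psi>) (opp \<Psi> e) = head (base \<Psi>) e"
    using e opp_div[of e] opp_even[of e] by (simp del: \<Psi>_simps(5))
qed auto

lemma strongly: "strongly_connected (base \<Psi>)"
proof -
  have up: "(i, p i) \<in> arcs_ends (base \<Psi>)" "(p i, i) \<in> arcs_ends (base \<Psi>)" if "0 < i" "i < n" for i
  proof -
    show "(i, p i) \<in> arcs_ends (base \<Psi>)"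
      unfolding arcs_ends_def arc_to_ends_def using that by (intro image_eqI[of _ _ "2 * i"]) auto
    show "(p i, i) \<in> arcs_ends (base \<Psi>)"
      unfolding arcs_ends_def arc_to_ends_def using that by (intro image_eqI[of _ _ "2 * i + 1"]) auto
  qed
  have "reachable (base \<Psi>) i 0 \<and> reachable (base \<Psi>) 0 i" if "i < n" for i
    using that
  proof (induction i rule: less_induct)
    case (less i)
    show ?case
    proof (cases "i = 0")
      case True
      then show ?thesis
        using n_pos by (auto simp: reachable_def)
    next
      case False
      then have i: "0 < i" "p i < i"
        using parent less.prems by auto
      then have IH: "reachable (base \<Psi>) (p i) 0" "reachable (base \<Psi>) 0 (p i)"
        using less by auto
      then show ?thesis
        using up[OF i(1) less.prems] less.prems unfolding reachable_def
        by (auto intro: converse_rtrancl_on_into_rtrancl_on rtrancl_on_into_rtrancl_on)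
    qed
  qed
  then show ?thesis
    unfolding strongly_connected_def using n_pos
    by (metis \<Psi>_simps(1) empty_iff lessThan_iff reachable_def rtrancl_on_trans)
qed

lemma sepr_sub: "e \<in> {2..<2 * n} \<Longrightarrow> sepr (e div 2) \<subseteq> L ! (head (base \<Psi>) e)"
  using arc_index[of e] parent[of "e div 2"] by (auto simp: sepr_def)

lemma inclusion_mon:
  assumes "C \<subseteq> B" "B \<subseteq> carrier W"
  shows "(\<lambda>a. a) \<in> mon (subgroup_generated W C) (subgroup_generated W B)"
proof -
  have "generate W C \<subseteq> generate W B"
    using assms(1) by (rule mono_generate)
  then show ?thesis
    using assms by (auto simp: mon_def hom_def carrier_subgroup_generated Int_absorb1 inj_on_def)
qed

lemma gog: "graph_of_groups \<Psi>"
proof -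
  have "einj \<Psi> e \<in> mon (egroup \<Psi> e) (vgroup \<Psi> (head (base \<Psi>) e))" if e: "e \<in> arcs (base \<Psi>)" for e
  proof -
    have "head (base \<Psi>) e < n"
      using e arc_ends[of e] by auto
    then show ?thesis
      using inclusion_mon[OF sepr_sub[of e] L_carrier] e by (simp add: \<Psi>_def)
  qed
  then show ?thesis
    unfolding graph_of_groups_def using bidirected strongly opp_div by (simp del: \<Psi>_simps(5))
qed

lemma cas_append:
  "pre_digraph.cas (base \<Psi>) a (q @ r) b \<longleftrightarrow> (\<exists>c. pre_digraph.cas (base \<Psi>) a q c \<and> pre_digraph.cas (base \<Psi>) c r b)"
  by (induction q arbitrary: a) (simp_all add: pre_digraph.cas.simps)

text \<open>A reduced closed walk starts and ends at the largest index \<open>m\<close> of a bag whose edge to the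
  parent it uses, so it has the form \<open>2 m, \<dots>, 2 m + 1\<close> with a reduced closed walk at \<open>p m\<close> in between.\<close>

lemma no_reduced_closed_walk:
  assumes "set q \<subseteq> {2..<2 * n}" "pre_digraph.cas (base \<Psi>) u q u" "successively (\<lambda>e f. f \<noteq> opp \<Psi> e) q"
  shows "q = []"
  using assms
proof (induction q arbitrary: u rule: length_induct)
  case (1 q)
  show ?case
  proof (rule ccontr)
    assume q: "q \<noteq> []"
    define m where "m = Max ((\<lambda>e. e div 2) ` set q)"
    have le: "e div 2 \<le> m" if "e \<in> set q" for e
      using that by (simp add: m_def)
    have tail_m: "e = 2 * m" if "e \<in> set q" "tail (base \<Psi>) e = m" for e
      using le[OF that(1)] that arc_ends[of e] 1(2) by (cases "even e") auto
    have head_m: "e = 2 * m + 1" if "e \<in> set q" "head (base \<Psi>) e = m" for e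
      using le[OF that(1)] that arc_ends[of e] 1(2) by (cases "even e") auto
    have "m \<in> (\<lambda>e. e div 2) ` set q"
      unfolding m_def using q by (intro Max_in) auto
    then obtain e where e: "e \<in> set q" "e div 2 = m"
      by auto
    have eT: "e \<in> {2..<2 * n}"
      using e 1(2) by auto
    obtain xs ys where split: "q = xs @ e # ys"
      using e(1) by (meson split_list)
    obtain c where c: "pre_digraph.cas (base \<Psi>) u xs c" "c = tail (base \<Psi>) e"
      "pre_digraph.cas (base \<Psi>) (head (base \<Psi>) e) ys u"
      using 1(3) unfolding split by (auto simp: cas_append pre_digraph.cas.simps)
    have u: "u = m"
    proof (cases "even e")
      case True
      have "xs = []"
      proof (rule ccontr)
        assume "xs \<noteq> []"
        then obtain zs g where xs: "xs = zs @ [g]"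
          by (metis append_butlast_last_id)
        then have "head (base \<Psi>) g = m"
          using c e(2) True by (simp add: cas_append pre_digraph.cas.simps)
        then have "g = 2 * m + 1"
          using head_m[of g] split xs by simp
        moreover have "e \<noteq> opp \<Psi> g"
          using 1(4) unfolding split xs by (simp add: successively_append_iff)
        moreover have "g \<in> {2..<2 * n}"
          using 1(2) unfolding split xs by simp
        ultimately show False
          using True e(2) by auto
      qed
      then show ?thesis
        using c True e(2) by (simp add: pre_digraph.cas.simps)
    next
      case False
      have "ys = []"
      proof (rule ccontr)
        assume "ys \<noteq> []"
        then obtain g zs where ys: "ys = g # zs"
          by (cases ys) auto
        then have "tail (base \<Psi>) g = m"
          using c e(2) False by (simp add: pre_digraph.cas.simps)
        then have "g = 2 * m"
          using tail_m[of g] split ys by simp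
        moreover have "g \<noteq> opp \<Psi> e"
          using 1(4) unfolding split ys by (simp add: successively_append_iff)
        ultimately show False
          using False e(2) eT by (auto elim!: oddE)
      qed
      then show ?thesis
        using c False e(2) by (simp add: pre_digraph.cas.simps)
    qed
    obtain f r where f: "q = f # r"
      using q by (cases q) auto
    have "f = 2 * m"
      using 1(3) u tail_m[of f] unfolding f by (simp add: pre_digraph.cas.simps)
    have "\<exists>zs g. q = zs @ [g]"
      using q by (metis append_butlast_last_id)
    then obtain zs g where g: "q = zs @ [g]"
      by blast
    have "g = 2 * m + 1"
      using 1(3) u head_m[of g] unfolding g by (simp add: cas_append pre_digraph.cas.simps)
    then obtain r' where r': "q = 2 * m # r' @ [2 * m + 1]"
      using f g \<open>f = 2 * m\<close> by (cases zs) auto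
    have "pre_digraph.cas (base \<Psi>) (p m) r' (p m)"
      using 1(3) unfolding r' by (auto simp: cas_append pre_digraph.cas.simps)
    moreover have "set r' \<subseteq> {2..<2 * n}" "length r' < length q"
      using 1(2) r' by auto
    moreover have "successively (\<lambda>e f. f \<noteq> opp \<Psi> e) r'"
      using 1(4) unfolding r' by (auto simp: successively_append_iff successively_Cons)
    ultimately have "r' = []"
      using 1(1) by blast
    then show False
      using 1(2,4) unfolding r' by (simp add: successively_Cons)
  qed
qed

text \<open>The whole graph is a tree, so the maximal tree has all the arcs and every stable letter
  becomes trivial.\<close>

lemma max_tree: "maximal_tree (base \<Psi>) (opp \<Psi>) T\<^sub>\<Psi>"
proof -
  have eq: "(base \<Psi>)\<lparr>arcs := T\<^sub>\<Psi>\<rparr> = base \<Psi>"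
    by (simp add: \<Psi>_def)
  have "opp \<Psi> ` T\<^sub>\<Psi> \<subseteq> T\<^sub>\<Psi>"
    using opp_arc by blast
  then show ?thesis
    unfolding maximal_tree_def eq using strongly no_reduced_closed_walk
    by (auto simp: pre_digraph.awalk_def simp del: \<Psi>_simps(3-5))
qed

section \<open>Comparison of the fundamental group with \<open>W\<close>\<close>

abbreviation "\<Gamma> \<equiv> pi1 \<Psi> T\<^sub>\<Psi>"

lemma group_\<Gamma>: "group \<Gamma>"
  by (simp add: pi1_def group_presented_group)

text \<open>Makes the relations between vertex elements and stable letters available inside
  \<open>\<Gamma>\<close>.\<close>

lemma bass_serre_\<Gamma>: "bass_serre \<Gamma> \<Psi> T\<^sub>\<Psi> id"
  using group_\<Gamma> gog max_tree by (simp add: bass_serre_def bass_serre_axioms_def iso_def hom_def)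

sublocale B: bass_serre \<Gamma> \<Psi> T\<^sub>\<Psi> id
  by (rule bass_serre_\<Gamma>)

abbreviation "vcl \<equiv> \<lambda>i g. pi1_class \<Psi> T\<^sub>\<Psi> (Vert i g)"
abbreviation "ecl \<equiv> \<lambda>e. pi1_class \<Psi> T\<^sub>\<Psi> (Edge e)"

lemma vcl_hom: "i < n \<Longrightarrow> vcl i \<in> hom (subgroup_generated W (L ! i)) \<Gamma>"
  using B.vg_hom[of i] by (simp add: B.vg_def[abs_def])

lemma ecl_one: "e \<in> {2..<2 * n} \<Longrightarrow> ecl e = \<one>\<^bsub>\<Gamma>\<^esub>"
  using B.st_tree[of e] by (simp add: B.st_def)

text \<open>The edge relation with trivial stable letter: separator elements are identified across
  the edge.\<close>

lemma vcl_parent: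
  assumes "0 < i" "i < n" "a \<in> sepr i"
  shows "vcl i a = vcl (p i) a"
proof -
  have e: "2 * i \<in> {2..<2 * n}"
    using assms by auto
  have a: "a \<in> carrier (subgroup_generated W (sepr i))"
    using assms carrier_sepr by (auto intro: generate.incl)
  have "a \<in> carrier (subgroup_generated W (L ! i))" "a \<in> carrier (subgroup_generated W (L ! p i))"
    using assms parent[of i] carrier_bag[of i] carrier_bag[of "p i"]
    by (auto simp: sepr_def intro!: generate.incl)
  then have "vcl i a \<in> carrier \<Gamma>" "vcl (p i) a \<in> carrier \<Gamma>"
    using vcl_hom[of i] vcl_hom[of "p i"] assms parent[of i] by (auto simp: hom_def)
  moreover have "B.st (2 * i) = \<one>\<^bsub>\<Gamma>\<^esub>"
    using B.st_tree[OF e] .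
  ultimately show ?thesis
    using B.st_conj[of "2 * i" a] e a monoid.l_one[OF group.is_monoid[OF group_\<Gamma>]]
      monoid.r_one[OF group.is_monoid[OF group_\<Gamma>]] by (simp add: B.vg_def)
qed

definition idx :: "'a \<Rightarrow> nat" where
  "idx s = (LEAST i. i < n \<and> s \<in> L ! i)"

lemma idx: "s \<in> S \<Longrightarrow> idx s < n \<and> s \<in> L ! idx s"
proof -
  assume "s \<in> S"
  then obtain B where "B \<in> set L" "s \<in> B"
    using bags by (auto simp: bag_list_def)
  then have "\<exists>i. i < n \<and> s \<in> L ! i"
    by (metis in_set_conv_nth)
  then show ?thesis
    unfolding idx_def by (rule LeastI_ex)
qed

text \<open>If \<open>s\<close> already occurs in an earlier bag, it lies in the separator of bag
  \<open>i\<close> and hence in the parent, where it has the same class. Descending ends at the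
  first bag containing \<open>s\<close>, so the class of a generator does not depend on the
  bag.\<close>

lemma vcl_idx:
  assumes "i < n" "s \<in> L ! i"
  shows "vcl i s = vcl (idx s) s"
  using assms
proof (induction i rule: less_induct)
  case (less i)
  show ?case
  proof (cases "i = idx s")
    case False
    have "idx s \<le> i"
      unfolding idx_def using less.prems by (intro Least_le) simp
    with False have lt: "idx s < i"
      by simp
    have s: "s \<in> L ! idx s" "idx s < n"
      using idx less.prems L_S by blast+
    have "L ! idx s \<in> set (take i L)"
      using lt less.prems by (auto simp: in_set_conv_nth intro!: exI[of _ "idx s"])
    then have "s \<in> sepr i"
      using s less.prems by (auto simp: sepr_def)
    then show ?thesis
      using vcl_parent[of i s] less.IH[of "p i"] parent[of i] lt less.prems by (auto simp: sepr_def)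
  qed simp
qed

text \<open>Two inverse homomorphisms, one from each presentation: \<psi> forgets the label of the
  bag and kills stable letters, \<theta> sends a generator to its class in some bag.\<close>

lemma visual: "visual_decomposition W S \<Psi>"
proof -
  interpret \<Gamma>: group \<Gamma>
    by (rule group_\<Gamma>)
  let ?f = "\<lambda>x. case x of Vert v g \<Rightarrow> g | Edge e \<Rightarrow> \<one>"
  have f_closed: "?f \<in> pi1_gens \<Psi> \<rightarrow> carrier W"
    using subsetD[OF carrier_subgroup_generated_subset] by (auto simp: pi1_gens_def)
  have f_rel: "word_eval W ?f r = \<one>" if "r \<in> pi1_relators \<Psi> T\<^sub>\<Psi>" "r \<in> words (pi1_gens \<Psi>)" for r
    using that(1) carrier_subgroup_generated_subset unfolding pi1_relators_def
    by (auto simp: subset_iff simp flip: m_assoc simp del: \<Psi>_simps(3-5))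
  obtain \<psi> where \<psi>: "\<psi> \<in> hom \<Gamma> W"
    "\<And>x. x \<in> pi1_gens \<Psi> \<Longrightarrow> \<psi> (pi1_class \<Psi> T\<^sub>\<Psi> x) = ?f x"
    using presented_group_hom[OF group_axioms f_closed f_rel] unfolding pi1_def pi1_class_def by blast
  have \<psi>_vcl: "\<psi> (vcl i g) = g" if "i < n" "g \<in> carrier (subgroup_generated W (L ! i))" for i g
    using \<psi>(2)[of "Vert i g"] that by (simp add: pi1_gens_def)
  have vcl_closed: "vcl (idx s) s \<in> carrier \<Gamma>" if "s \<in> S" for s
    using vcl_hom[of "idx s"] idx[OF that] carrier_bag[of "idx s"] by (auto simp: hom_def intro: generate.incl)
  have "\<exists>\<theta>\<in>hom W \<Gamma>. \<forall>s\<in>S. \<theta> s = vcl (idx s) s"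
  proof (rule coxeter_hom[OF cox group_\<Gamma>])
    show "(\<lambda>s. vcl (idx s) s) \<in> S \<rightarrow> carrier \<Gamma>"
      using vcl_closed by blast
    fix s t and k :: nat
    assume st: "s \<in> S" "t \<in> S" "0 < k" "(s \<otimes> t) [^] k = \<one>"
    have inv: "x \<in> carrier W" "x \<otimes> x = \<one>" if "x \<in> S" for x
      using that S_carrier coxeter_involution[OF cox] by auto
    have "(t \<otimes> s) [^] k = inv ((s \<otimes> t) [^] k)"
      using st inv nat_pow_inv[of "s \<otimes> t" k] by (simp add: inv_mult_group involution_inv)
    then have "fin_prod W s t" "fin_prod W t s" "fin_prod W s s" "fin_prod W t t"
      using st inv by (auto simp: fin_prod_def intro: exI[of _ k] exI[of _ 1])
    \<comment> \<open>The two letters of the relation share a bag \<open>i\<close>. The relation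
      holds in the group of that bag, and \<open>vcl i\<close> transports it to
      \<open>\<Gamma>\<close>.\<close>
    then have "clique W {s, t}"
      by (simp add: clique_def)
    then obtain B where "B \<in> set L" "s \<in> B" "t \<in> B"
      using bags st unfolding bag_list_def by (metis empty_subsetI insert_subset)
    then obtain i where i: "i < n" "s \<in> L ! i" "t \<in> L ! i"
      by (metis in_set_conv_nth)
    let ?H = "subgroup_generated W (L ! i)"
    interpret h: group_hom ?H \<Gamma> "vcl i"
      using vcl_hom[OF i(1)] by (simp add: group_hom_def group_hom_axioms_def group_\<Gamma>)
    have car: "s \<in> carrier ?H" "t \<in> carrier ?H"
      using i carrier_bag by (auto intro: generate.incl)
    have "vcl (idx s) s \<otimes>\<^bsub>\<Gamma>\<^esub> vcl (idx t) t = vcl i (s \<otimes>\<^bsub>?H\<^esub> t)"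
      unfolding h.hom_mult[OF car] using vcl_idx[OF i(1,2)] vcl_idx[OF i(1,3)] by simp
    moreover have "vcl i (s \<otimes>\<^bsub>?H\<^esub> t) [^]\<^bsub>\<Gamma>\<^esub> k = vcl i ((s \<otimes>\<^bsub>?H\<^esub> t) [^]\<^bsub>?H\<^esub> k)"
      using car by (intro h.hom_nat_pow[symmetric] h.G.m_closed)
    moreover have "(s \<otimes>\<^bsub>?H\<^esub> t) [^]\<^bsub>?H\<^esub> k = \<one>\<^bsub>?H\<^esub>"
      using st by (simp add: pow_subgroup_generated)
    ultimately show "(vcl (idx s) s \<otimes>\<^bsub>\<Gamma>\<^esub> vcl (idx t) t) [^]\<^bsub>\<Gamma>\<^esub> k = \<one>\<^bsub>\<Gamma>\<^esub>"
      using h.hom_one by simp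
  qed
  then obtain \<theta> where \<theta>: "\<theta> \<in> hom W \<Gamma>" "\<And>s. s \<in> S \<Longrightarrow> \<theta> s = vcl (idx s) s"
    by blast
  interpret \<theta>: group_hom W \<Gamma> \<theta>
    using \<theta>(1) by (simp add: group_hom_def group_hom_axioms_def group_axioms group_\<Gamma>)
  interpret \<psi>: group_hom \<Gamma> W \<psi>
    using \<psi>(1) by (simp add: group_hom_def group_hom_axioms_def group_axioms group_\<Gamma>)
  have \<psi>\<theta>_gen: "\<psi> (\<theta> s) = s" if "s \<in> S" for s
  proof -
    have "s \<in> carrier (subgroup_generated W (L ! idx s))"
      using idx[OF that] carrier_bag[of "idx s"] by (auto intro: generate.incl)
    then show ?thesis
      using \<theta>(2)[OF that] \<psi>_vcl[of "idx s" s] idx[OF that] by simp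
  qed
  have \<psi>\<theta>: "\<psi> (\<theta> g) = g" if "g \<in> carrier W" for g
    using that unfolding coxeter_generate[OF cox, symmetric]
  proof (induction rule: generate.induct)
    case (incl s)
    then show ?case
      by (rule \<psi>\<theta>_gen)
  next
    case (inv s)
    have "s \<in> carrier W"
      using inv S_carrier by auto
    then have "\<psi> (\<theta> (inv s)) = inv (\<psi> (\<theta> s))"
      by simp
    then show ?case
      using \<psi>\<theta>_gen[OF inv] by simp
  next
    case (eng g h)
    then have "g \<in> carrier W" "h \<in> carrier W"
      using generate_in_carrier[OF S_carrier] by auto
    then show ?case
      using eng.IH by simp
  qed simp
  have \<theta>_vcl: "\<theta> g = vcl i g" if i: "i < n" and "g \<in> generate W (L ! i)" for i g
    using that(2)
  proof (induction rule: generate.induct)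
    let ?H = "subgroup_generated W (L ! i)"
    interpret h: group_hom ?H \<Gamma> "vcl i"
      using vcl_hom[OF i] by (simp add: group_hom_def group_hom_axioms_def group_\<Gamma>)
    case one
    then show ?case
      using h.hom_one by simp
  next
    case (incl s)
    then show ?case
      using \<theta>(2)[of s] vcl_idx[OF i incl] L_S[OF i] by auto
  next
    let ?H = "subgroup_generated W (L ! i)"
    interpret h: group_hom ?H \<Gamma> "vcl i"
      using vcl_hom[OF i] by (simp add: group_hom_def group_hom_axioms_def group_\<Gamma>)
    case (inv s)
    have s: "s \<in> carrier ?H" "s \<in> carrier W"
      using inv carrier_bag[OF i] L_carrier[OF i] by (auto intro: generate.incl)
    have "vcl i (inv s) = inv\<^bsub>\<Gamma>\<^esub> (vcl i s)"
      using h.hom_inv[OF s(1)] s(1) by simp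
    moreover have "\<theta> s = vcl i s"
      using \<theta>(2)[of s] vcl_idx[OF i inv] L_S[OF i] inv by auto
    ultimately show ?case
      using s(2) by simp
  next
    let ?H = "subgroup_generated W (L ! i)"
    interpret h: group_hom ?H \<Gamma> "vcl i"
      using vcl_hom[OF i] by (simp add: group_hom_def group_hom_axioms_def group_\<Gamma>)
    case (eng g k)
    have gk: "g \<in> carrier ?H" "k \<in> carrier ?H" "g \<in> carrier W" "k \<in> carrier W"
      using eng carrier_bag[OF i] generate_in_carrier[OF L_carrier[OF i]] by auto
    then show ?case
      using eng.IH h.hom_mult[OF gk(1,2)] by simp
  qed
  have \<theta>\<psi>: "\<theta> (\<psi> a) = a" if "a \<in> carrier \<Gamma>" for a
  proof -
    have gen: "(\<theta> \<circ> \<psi>) (pi1_class \<Psi> T\<^sub>\<Psi> x) = id (pi1_class \<Psi> T\<^sub>\<Psi> x)" if x: "x \<in> pi1_gens \<Psi>" for x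
    proof (cases x)
      case (Vert i g)
      then have "i < n" "g \<in> generate W (L ! i)"
        using x carrier_bag by (auto simp: pi1_gens_def)
      then show ?thesis
        using \<theta>_vcl \<psi>_vcl carrier_bag Vert by simp
    next
      case (Edge e)
      then have "e \<in> {2..<2 * n}"
        using x by (auto simp: pi1_gens_def)
      then show ?thesis
        using \<psi>(2)[OF x] ecl_one Edge by simp
    qed
    have comp: "\<theta> \<circ> \<psi> \<in> hom \<Gamma> \<Gamma>"
      by (rule Group.hom_compose[OF \<psi>(1) \<theta>(1)])
    have "(\<theta> \<circ> \<psi>) a = id a"
    proof (rule presented_group_hom_eqI[OF group_\<Gamma>, where X = "pi1_gens \<Psi>" and R = "pi1_relators \<Psi> T\<^sub>\<Psi>"
        and \<theta>\<^sub>1 = "\<theta> \<circ> \<psi>" and \<theta>\<^sub>2 = id and a = a])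
      show "\<theta> \<circ> \<psi> \<in> hom (presented_group (pi1_gens \<Psi>) (pi1_relators \<Psi> T\<^sub>\<Psi>)) \<Gamma>"
        using comp by (simp only: pi1_def)
      show "id \<in> hom (presented_group (pi1_gens \<Psi>) (pi1_relators \<Psi> T\<^sub>\<Psi>)) \<Gamma>"
        by (simp add: pi1_def hom_def)
      show "a \<in> carrier (presented_group (pi1_gens \<Psi>) (pi1_relators \<Psi> T\<^sub>\<Psi>))"
        using that by (simp only: pi1_def)
    qed (use gen in \<open>simp only: pi1_class_def\<close>)
    then show ?thesis
      by simp
  qed
  have "bij_betw \<psi> (carrier \<Gamma>) (carrier W)"
    using \<psi>\<theta> \<theta>\<psi> by (intro bij_betw_byWitness[where f' = \<theta>]) auto
  then have "\<psi> \<in> iso \<Gamma> W"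
    using \<psi>(1) by (simp add: iso_def)
  moreover have "\<psi> (ecl e) = \<one>" if "e \<in> arcs (base \<Psi>)" for e
    using \<psi>(2)[of "Edge e"] that by (simp add: pi1_gens_def)
  moreover have "special_subgroup W S (vgroup \<Psi> i)" if "i < n" for i
    unfolding special_subgroup_def using L_S[OF that] by auto
  moreover have "special_subgroup W S (egroup \<Psi> e)" if "e \<in> {2..<2 * n}" for e
    unfolding special_subgroup_def using sepr_S arc_index[OF that] by auto
  ultimately show ?thesis
    unfolding visual_decomposition_def using gog max_tree \<psi>_vcl
    by (auto simp del: \<Psi>_simps(3-5) intro!: exI[of _ "T\<^sub>\<Psi>"] bexI[of _ \<psi>])
qed

end

theorem corollary18:
  fixes W :: "'a monoid"
    and S :: "'a set"
    and \<Lambda> :: "('v, 'e, 'g, 'h) graph_of_groups"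
    and T :: "'e set"
    and \<phi> :: "('v, 'e, 'g) pi1_gen word set \<Rightarrow> 'a"
  assumes "coxeter_system W S"
    and "finite S"
    and "graph_of_groups \<Lambda>"
    and "maximal_tree (base \<Lambda>) (opp \<Lambda>) T"
    and "\<phi> \<in> iso (pi1 \<Lambda> T) W"
    and "\<forall>e \<in> arcs (base \<Lambda>). finite (carrier (egroup \<Lambda> e))"
  shows "\<exists>\<Psi> :: (nat, nat, 'a, 'a) graph_of_groups.
    visual_decomposition W S \<Psi> \<and>
    (\<forall>v \<in> verts (base \<Psi>).
      (one_ended (vgroup \<Psi> v) \<or> finite (carrier (vgroup \<Psi> v))) \<and>
      (\<exists>u \<in> verts (base \<Lambda>). \<exists>w \<in> carrier W.
        carrier (vgroup \<Psi> v) \<subseteq> (w <#\<^bsub>W\<^esub> (\<phi> ` pi1_vgroup \<Lambda> T u)) #>\<^bsub>W\<^esub> (inv\<^bsub>W\<^esub> w))) \<and>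
    (\<forall>e \<in> arcs (base \<Psi>). finite (carrier (egroup \<Psi> e)))"
proof -
  have W: "group W" and S: "S \<subseteq> carrier W"
    using assms(1) by (auto simp: coxeter_system_def)
  obtain L where L: "bag_list W S L"
    \<comment> \<open>At the top level no clique has to be placed in the first bag, so the empty one
      is prescribed.\<close>
    using bag_list_exists[OF W assms(2) S, of "{}"] by (auto simp: clique_def)
  define p where "p i = (SOME j. j < i \<and> L ! i \<inter> \<Union> (set (take i L)) \<subseteq> L ! j)" for i
  have "p i < i \<and> L ! i \<inter> \<Union> (set (take i L)) \<subseteq> L ! p i" if "0 < i" "i < length L" for i
    unfolding p_def using bag_list_sep(2)[OF L that] by (rule someI_ex)
  then interpret bag_tree W S L p
    using W assms(1) L by (auto simp: bag_tree_def bag_tree_axioms_def)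
  obtain \<eta> where "reflection_group W S \<eta>"
  proof (rule coxeter_cocycle[OF assms(1)])
    fix \<eta>
    assume "\<And>t. t \<in> carrier W \<Longrightarrow> \<not> \<eta> \<one>\<^bsub>W\<^esub> t"
      and "\<And>s w t. s \<in> S \<Longrightarrow> w \<in> carrier W \<Longrightarrow> t \<in> carrier W \<Longrightarrow>
        \<eta> (s \<otimes>\<^bsub>W\<^esub> w) t = (\<eta> w t \<noteq> (w \<otimes>\<^bsub>W\<^esub> t \<otimes>\<^bsub>W\<^esub> inv\<^bsub>W\<^esub> w = s))"
      and "\<And>s w. s \<in> S \<Longrightarrow> w \<in> carrier W \<Longrightarrow> \<eta> (w \<otimes>\<^bsub>W\<^esub> s) s = (\<not> \<eta> w s)"
    then have "reflection_group W S \<eta>"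
      using W S coxeter_involution[OF assms(1)] by (simp add: reflection_group_def reflection_group_axioms_def)
    then show thesis
      by (rule that)
  qed
  then interpret R: reflection_group W S \<eta> .
  interpret A: bass_serre W \<Lambda> T \<phi>
    using W assms by (simp add: bass_serre_def bass_serre_axioms_def)
  show ?thesis
  proof (intro exI[of _ \<Psi>] conjI ballI)
    show "visual_decomposition W S \<Psi>"
      by (rule visual)
    fix i assume "i \<in> verts (base \<Psi>)"
    then have i: "i < length L"
      by simp
    then have Li: "L ! i \<subseteq> S" "unsplit W (L ! i)" "finite (L ! i)"
      using L L_S[OF i] assms(2) finite_subset by (auto simp: bag_list_def)
    show "one_ended (vgroup \<Psi> i) \<or> finite (carrier (vgroup \<Psi> i))"
      using R.one_ended_unsplit[OF Li(1,3,2)] carrier_bag[OF i] by auto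
    have "\<exists>u\<in>verts (base \<Lambda>). \<exists>w\<in>carrier W. generate W (L ! i) \<subseteq> (w <#\<^bsub>W\<^esub> (\<phi> ` pi1_vgroup \<Lambda> T u)) #>\<^bsub>W\<^esub> inv\<^bsub>W\<^esub> w"
      using assms(6) Li L_carrier[OF i] coxeter_involution[OF assms(1)]
      by (intro A.unsplit_in_conjugate) auto
    then show "\<exists>u \<in> verts (base \<Lambda>). \<exists>w \<in> carrier W.
        carrier (vgroup \<Psi> i) \<subseteq> (w <#\<^bsub>W\<^esub> (\<phi> ` pi1_vgroup \<Lambda> T u)) #>\<^bsub>W\<^esub> (inv\<^bsub>W\<^esub> w)"
      using carrier_bag[OF i] by simp
  next
    fix e assume "e \<in> arcs (base \<Psi>)"
    then have "0 < e div 2" "e div 2 < length L"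
      using arc_index[of e] by simp_all
    then show "finite (carrier (egroup \<Psi> e))"
      using L carrier_sepr[of "e div 2"] by (simp add: bag_list_def sepr_def)
  qed
qed

end
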